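(* Let $0 < \beta \leq \alpha < 1$ and $\kappa > 0$. Then, for every $\gamma \in \left(\frac{\alpha - \beta}{1 - \beta},1\right]$, there exist $\epsilon,\epsilon_{0},\delta_{0} \in (0,\tfrac{1}{2}]$, depending only on $\alpha,\beta,\gamma,\kappa$, such that the following holds. Let $\delta \in 2^{-\mathbb{N}}$ with $\delta \in (0,\delta_{0}]$, and let $A,B \subset (\delta \cdot \mathbb{Z}) \cap [0,1]$ satisfy: (A) $|A| \leq \delta^{-\alpha}$; (B) $|B| \geq \delta^{-\beta}$, and $|B \cap B(x,r)| \leq r^{\kappa}|B|$ for all $x \in \mathbb{R}$ and all $\delta \leq r \leq \delta^{\epsilon_{0}}$. Further, let $\nu$ be a Borel probability measure with $\operatorname{spt}(\nu) \subset [\tfrac{1}{2},1]$ satisfying $\nu(B(x,r)) \leq r^{\gamma}$ for all $x \in \mathbb{R}$ and $\delta \leq r \leq \delta^{\epsilon_{0}}$. Then there exists $c \in \operatorname{spt}(\nu)$ such that \[ |A + cB|_{\delta} \geq \delta^{-\epsilon}|A|. \]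
   Context: $|\cdot|$ denotes cardinality, $B(x,r)$ the open ball (interval) of radius $r$ centred at $x$, and for a bounded set $E \subset \mathbb{R}$ and $\delta \in 2^{-\mathbb{N}}$, $|E|_{\delta}$ denotes the least number of dyadic intervals of the form $[k\delta,(k+1)\delta)$, $k \in \mathbb{Z}$, needed to cover $E$. $A + cB = \{a + cb : a \in A, b \in B\}$. *)

theory Defs
  imports "HOL-Probability.Probability"
begin

definition dyadic_scales :: "real set"
  where "dyadic_scales = {2 powr (- real n) | n. True}"

definition dyadic_intervals :: "real \<Rightarrow> real set set"
  where "dyadic_intervals \<delta> = {{of_int k * \<delta> ..< (of_int k + 1) * \<delta>} | k :: int. True}"

text \<open>Only meaningful for bounded \<open>E\<close> and \<open>\<delta> > 0\<close>: otherwise there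
  may be no finite cover, and the \<open>LEAST\<close> is unspecified.\<close>

definition dyadic_covering_number :: "real set \<Rightarrow> real \<Rightarrow> nat"
  where "dyadic_covering_number E \<delta> =
    (LEAST n. \<exists>\<I>. \<I> \<subseteq> dyadic_intervals \<delta> \<and> finite \<I> \<and> card \<I> = n \<and> E \<subseteq> \<Union>\<I>)"

definition scaled_grid :: "real \<Rightarrow> real set"
  where "scaled_grid \<delta> = {\<delta> * of_int k | k :: int. True}"

definition sum_dilate :: "real set \<Rightarrow> real \<Rightarrow> real set \<Rightarrow> real set"
  where "sum_dilate A c B = {a + c * b | a b. a \<in> A \<and> b \<in> B}"

text \<open>Topological support; intended for Borel measures, for which open sets are measurable.\<close>

definition spt :: "'a::topological_space measure \<Rightarrow> 'a set"
  where "spt \<nu> = {x. \<forall>U. open U \<longrightarrow> x \<in> U \<longrightarrow> emeasure \<nu> U > 0}"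

end

theory Submission
  imports Defs "HOL-Library.Set_Algebras" "HOL-Library.Discrete_Functions"
begin

text \<open>
  Suppose \<open>|A + cB| < \<delta> powr (- \<epsilon>) |A|\<close> for all \<open>c\<close> in the support. By the Pluennecke--Ruzsa
  inequality, all bounded sums and differences of the sets \<open>cB\<close> then have size at most about
  \<open>\<delta> powr (- \<alpha>)\<close>, so it suffices to find such combinations of size about \<open>\<delta> powr (- \<alpha> - \<sigma>)\<close>,
  where \<open>\<alpha> + \<sigma> = \<beta> + g (1 - \<beta>)\<close> and \<open>g < \<gamma>\<close>.

  Pass to a subset of \<open>B\<close> which is a binary tree branching at a set \<open>S\<close> of scales only, with
  \<open>L |S| \<ge> \<beta> log (1/\<delta>)\<close> up to small errors, and consider random points
  \<open>\<Sum> i\<^sub>k b\<^sub>k + \<Sum> t\<^sub>l b'\<^sub>l\<close>, where the \<open>b\<close>'s are uniform on the tree, \<open>i\<^sub>k < 2 ^ D\<close> are integers, and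
  the \<open>t\<^sub>l\<close> are rescaled differences of points of the support. A branching at scale \<open>a\<close>, multiplied by
  the integers, produces full entropy on the \<open>D\<close> scales just coarser than \<open>a\<close>. On the gaps in between, multiplication
  by the \<open>t\<^sub>l\<close> gives entropy at least \<open>g\<close> per scale, because their law is \<open>g\<close>-dimensional. Thus the full
  part, a proportion \<open>\<beta>\<close> of all scales, contributes \<open>\<beta>\<close>, and the gaps contribute \<open>g (1 - \<beta>)\<close>.
\<close>


text \<open>The threshold for \<gamma> is the point where \<beta> + g (1 - \<beta>) passes \<alpha>.
  The obstacle is that a gap gains entropy only while the leaves still vary: n independent leaves
  agree on the scales from p to y with probability 2 powr (- n |S \<inter> [p, y)|), and this has to
  beat 2 powr (- g (y - p)). A large n makes a sparse tree sufficient, and the non-concentration of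
  B supplies it by putting a positive density of branchings into every long initial stretch of
  scales.

  Cardinalities at different scales do not chain, entropies do. They are averaged over the
  multipliers throughout, since each scale is favourable only for most multipliers; a single choice
  good for all scales is extracted at the very end.

  The constants all come from the block length L. A block costs log (2 L) bits, little compared with
  L. Spacing D = L^2 thins S by about a factor L, so that D |S'| stays close to L |S|. With n - 1 =
  L^4 the branchings swallowed by gaps cost only a proportion D / L^4 = 1 / L^2 of all scales. The
  exponent \<epsilon> is fixed after L, because Pluennecke--Ruzsa is applied to about L^4 2^(L^2)
  summands.\<close>

section \<open>Sumset inequalities and covering numbers\<close>

text \<open>Petridis' argument: \<open>X\<close> minimises \<open>|X + D| / |X|\<close> over the
  nonempty subsets of \<open>A\<close>, and \<open>C\<close> is built up point by point. For a new
  point \<open>c\<close>, let \<open>Z\<close> be the part of \<open>X\<close> whose translates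
  \<open>x + D + c\<close> are already covered. The new point adds at most
  \<open>|X + D| - |Z + D|\<close>, and minimality gives \<open>K |Z| \<le> |Z + D|\<close>.\<close>

lemma petridis:
  fixes A D :: "'a::ab_group_add set"
  assumes "finite A" "A \<noteq> {}" "finite D"
  obtains X where "X \<subseteq> A" "X \<noteq> {}"
    "\<And>C. finite C \<Longrightarrow>
      real (card (X + D + C)) \<le> real (card (A + D)) / real (card A) * real (card (X + C))"
proof -
  define r where "r = (\<lambda>X. real (card (X + D)) / real (card X))"
  define X where "X = arg_min_on r (Pow A - {{}})"
  have ne: "finite (Pow A - {{}})" "Pow A - {{}} \<noteq> {}" using assms by auto
  have X: "X \<in> Pow A - {{}}" unfolding X_def by (rule arg_min_if_finite(1)[OF ne])
  have min: "r X \<le> r Y" if "Y \<in> Pow A - {{}}" for Y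
    unfolding X_def by (rule arg_min_least[OF ne that])
  have fX: "finite X" and X0: "X \<noteq> {}" and XA: "X \<subseteq> A"
    using X assms finite_subset by auto
  define K where "K = r X"
  have K0: "K \<ge> 0" by (simp add: K_def r_def)
  have KA: "K \<le> real (card (A + D)) / real (card A)"
    using min[of A] assms unfolding K_def r_def by auto
  have KX: "real (card (X + D)) = K * real (card X)"
    using fX X0 by (simp add: K_def r_def)
  have KZ: "K * real (card Z) \<le> real (card (Z + D))" if "Z \<subseteq> X" for Z
  proof (cases "Z = {}")
    case False
    then have "r X \<le> r Z" using min[of Z] that XA by auto
    moreover have "card Z > 0" using False that fX finite_subset by (auto simp: card_gt_0_iff)
    moreover have "r Z = real (card (Z + D)) / real (card Z)" by (simp add: r_def)
    ultimately show ?thesis by (simp add: K_def field_simps)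
  qed auto
  have main: "real (card (X + D + C)) \<le> K * real (card (X + C))" if "finite C" for C
    using that
  proof (induction C rule: finite_induct)
    case empty
    then show ?case by simp
  next
    case (insert c C)
    define Z where "Z = {x \<in> X. \<forall>d\<in>D. x + d + c \<in> X + D + C}"
    define V where "V = {x \<in> X. x + c \<in> X + C}"
    have ZX: "Z \<subseteq> X" and VZ: "V \<subseteq> Z"
    proof -
      show "Z \<subseteq> X" by (auto simp: Z_def)
      show "V \<subseteq> Z"
      proof
        fix v assume v: "v \<in> V"
        then have "v + c \<in> X + C" by (simp add: V_def)
        then obtain x e where xe: "v + c = x + e" "x \<in> X" "e \<in> C"
          by (blast elim: set_plus_elim)
        have "v + d + c \<in> X + D + C" if "d \<in> D" for d
        proof -
          have "v + d + c = (v + c) + d" by (simp add: algebra_simps)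
          also have "\<dots> = (x + d) + e" by (simp only: xe(1)) (simp add: algebra_simps)
          finally show ?thesis using xe that by (metis set_plus_intro)
        qed
        with v show "v \<in> Z" by (auto simp: Z_def V_def)
      qed
    qed
    have fin: "finite (X + D + C)" "finite (X + D)" "finite (X + C)" "finite (Z + D)"
      using fX assms insert ZX finite_subset by (auto intro!: finite_set_plus)
    have ZD: "Z + D \<subseteq> X + D" by (rule set_plus_mono2[OF ZX order.refl])
    have sub1: "X + D + insert c C \<subseteq> (X + D + C) \<union> (\<lambda>x. x + c) ` ((X + D) - (Z + D))"
    proof
      fix y assume "y \<in> X + D + insert c C"
      then obtain u e where y: "y = u + e" "u \<in> X + D" "e \<in> insert c C"
        by (auto elim: set_plus_elim)
      show "y \<in> (X + D + C) \<union> (\<lambda>x. x + c) ` ((X + D) - (Z + D))"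
      proof (cases "e = c")
        case True
        show ?thesis
        proof (cases "u \<in> Z + D")
          case True
          then obtain z d where "u = z + d" "z \<in> Z" "d \<in> D" by (auto elim: set_plus_elim)
          then have "y \<in> X + D + C" using y \<open>e = c\<close> by (auto simp: Z_def)
          then show ?thesis by simp
        next
          case False
          then show ?thesis using y \<open>e = c\<close> by auto
        qed
      qed (use y in \<open>auto intro: set_plus_intro\<close>)
    qed
    have "card (X + D + insert c C) \<le> card ((X + D + C) \<union> (\<lambda>x. x + c) ` ((X + D) - (Z + D)))"
      by (rule card_mono[OF _ sub1]) (use fin in auto)
    also have "\<dots> \<le> card (X + D + C) + card ((\<lambda>x. x + c) ` ((X + D) - (Z + D)))"
      by (rule card_Un_le)
    also have "card ((\<lambda>x. x + c) ` ((X + D) - (Z + D))) = card ((X + D) - (Z + D))"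
      by (rule card_image) (auto simp: inj_on_def)
    also have "\<dots> = card (X + D) - card (Z + D)"
      by (rule card_Diff_subset) (use fin ZD in auto)
    finally have 1: "real (card (X + D + insert c C)) \<le> real (card (X + D + C)) + real (card (X + D)) - real (card (Z + D))"
      using card_mono[OF fin(2) ZD] by linarith
    have sub2: "(X + C) \<union> (\<lambda>x. x + c) ` (X - V) \<subseteq> X + insert c C"
      by (auto intro: set_plus_intro elim!: set_plus_elim)
    have "card (X + C) + card (X - V) = card ((X + C) \<union> (\<lambda>x. x + c) ` (X - V))"
    proof (subst card_Un_disjoint)
      show "(X + C) \<inter> (\<lambda>x. x + c) ` (X - V) = {}" by (auto simp: V_def)
      have "card ((\<lambda>x. x + c) ` (X - V)) = card (X - V)"
        by (rule card_image) (auto simp: inj_on_def)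
      then show "card (X + C) + card (X - V) = card (X + C) + card ((\<lambda>x. x + c) ` (X - V))" by simp
    qed (use fin fX in auto)
    also have "\<dots> \<le> card (X + insert c C)"
      by (rule card_mono[OF _ sub2]) (use fX insert in \<open>auto intro!: finite_set_plus\<close>)
    also have "card (X - V) = card X - card V"
      by (rule card_Diff_subset) (use finite_subset[OF _ fX] ZX VZ in auto)
    finally have "real (card (X + C)) + real (card X) - real (card V) \<le> real (card (X + insert c C))"
      using card_mono[OF fX, of V] ZX VZ by auto
    moreover have "card V \<le> card Z" by (rule card_mono[OF finite_subset[OF ZX fX] VZ])
    ultimately have "real (card (X + C)) + real (card X) - real (card Z) \<le> real (card (X + insert c C))"
      by linarith
    from mult_left_mono[OF this K0]
    have 2: "K * real (card (X + C)) + K * real (card X) - K * real (card Z) \<le> K * real (card (X + insert c C))"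
      by (simp add: algebra_simps)
    from 1 2 insert.IH KX KZ[OF ZX] show ?case by linarith
  qed
  show ?thesis
  proof (rule that[OF XA X0])
    fix C :: "'a set" assume "finite C"
    then have "real (card (X + D + C)) \<le> K * real (card (X + C))" by (rule main)
    also have "\<dots> \<le> real (card (A + D)) / real (card A) * real (card (X + C))"
      by (rule mult_right_mono[OF KA]) auto
    finally show "real (card (X + D + C)) \<le> real (card (A + D)) / real (card A) * real (card (X + C))" .
  qed
qed

section \<open>Sums of many copies of a set\<close>

primrec nfold_sum :: "nat \<Rightarrow> 'a::comm_monoid_add set \<Rightarrow> 'a set" where
  "nfold_sum 0 D = {0}"
| "nfold_sum (Suc j) D = D + nfold_sum j D"

lemma finite_nfold_sum: "finite D \<Longrightarrow> finite (nfold_sum j D)"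
  by (induction j) (auto intro: finite_set_plus)

lemma nfold_sum_mono: "0 \<in> D \<Longrightarrow> i \<le> j \<Longrightarrow> nfold_sum i D \<subseteq> nfold_sum j D"
proof (induction j)
  case (Suc j)
  then show ?case
    by (metis le_Suc_eq nfold_sum.simps(2) order.refl order.trans set_zero_plus2)
qed auto

lemma nfold_sum_add:
  "x \<in> nfold_sum i D \<Longrightarrow> y \<in> nfold_sum j D \<Longrightarrow> x + y \<in> nfold_sum (i + j) D"
proof (induction i arbitrary: x)
  case (Suc i)
  then obtain d z where "x = d + z" "d \<in> D" "z \<in> nfold_sum i D"
    by (auto elim: set_plus_elim)
  then show ?case using Suc by (auto simp: add.assoc intro: set_plus_intro)
qed auto

lemma sum_in_nfold_sum:
  assumes "finite I" "\<And>i. i \<in> I \<Longrightarrow> f i \<in> nfold_sum (k i) D"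
  shows "sum f I \<in> nfold_sum (sum k I) D"
  using assms by (induction I rule: finite_induct) (auto intro: nfold_sum_add)

lemma mult_in_nfold_sum:
  fixes x :: "'a::semiring_1"
  shows "x \<in> D \<Longrightarrow> of_nat j * x \<in> nfold_sum j D"
  by (induction j) (auto simp: distrib_right intro: set_plus_intro)

text \<open>Fix one representation \<open>p d - q d\<close> of every difference \<open>d\<close>.
  The map from \<open>(x, d)\<close> to \<open>(x + p d, x + q d)\<close> is injective: subtracting
  the coordinates recovers \<open>d\<close>, and then \<open>x\<close>.\<close>

lemma ruzsa_triangle:
  fixes X P Q :: "'a::ab_group_add set"
  assumes "finite X" "finite P" "finite Q"
  shows "card X * card {p - q |p q. p \<in> P \<and> q \<in> Q} \<le> card (X + P) * card (X + Q)"
proof -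
  let ?M = "{p - q |p q. p \<in> P \<and> q \<in> Q}"
  have "\<exists>f. \<forall>d\<in>?M. fst (f d) \<in> P \<and> snd (f d) \<in> Q \<and> d = fst (f d) - snd (f d)"
    by (intro bchoice) force
  then obtain f where f: "\<forall>d\<in>?M. fst (f d) \<in> P \<and> snd (f d) \<in> Q \<and> d = fst (f d) - snd (f d)" ..
  define p where "p = fst \<circ> f"
  define q where "q = snd \<circ> f"
  have pq: "\<And>d. d \<in> ?M \<Longrightarrow> p d \<in> P \<and> q d \<in> Q \<and> d = p d - q d"
    using f by (simp add: p_def q_def)
  have "card (X \<times> ?M) \<le> card ((X + P) \<times> (X + Q))"
  proof (rule card_inj_on_le[where f = "\<lambda>(x, d). (x + p d, x + q d)"])
    show "inj_on (\<lambda>(x, d). (x + p d, x + q d)) (X \<times> ?M)"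
    proof (rule inj_onI, clarify)
      fix x x' p1 q1 p2 q2
      assume h: "x \<in> X" "x' \<in> X" "p1 \<in> P" "q1 \<in> Q" "p2 \<in> P" "q2 \<in> Q"
        "x + p (p1 - q1) = x' + p (p2 - q2)" "x + q (p1 - q1) = x' + q (p2 - q2)"
      have a: "p1 - q1 = p (p1 - q1) - q (p1 - q1)" "p2 - q2 = p (p2 - q2) - q (p2 - q2)"
        using pq h by blast+
      have "p (p1 - q1) - q (p1 - q1) = p (p2 - q2) - q (p2 - q2)"
        using h(7,8) by (metis add_diff_cancel_left)
      then have "p1 - q1 = p2 - q2" using a by metis
      with h show "x = x' \<and> p1 - q1 = p2 - q2" by simp
    qed
    show "(\<lambda>(x, d). (x + p d, x + q d)) ` (X \<times> ?M) \<subseteq> (X + P) \<times> (X + Q)"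
    proof clarify
      fix x p1 q1 assume h: "x \<in> X" "p1 \<in> P" "q1 \<in> Q"
      then have "p (p1 - q1) \<in> P" "q (p1 - q1) \<in> Q" using pq[of "p1 - q1"] by blast+
      then show "x + p (p1 - q1) \<in> X + P \<and> x + q (p1 - q1) \<in> X + Q"
        using h(1) by (auto intro: set_plus_intro)
    qed
    show "finite ((X + P) \<times> (X + Q))" using assms by (auto intro: finite_set_plus)
  qed
  then show ?thesis by (simp add: card_cartesian_product)
qed

text \<open>Taking \<open>C = nfold_sum j D\<close> in \<open>petridis\<close> peels off one factor
  \<open>K\<close> per summand, because the same \<open>X\<close> serves for every \<open>C\<close>.
  \<open>ruzsa_triangle\<close> then passes from two such sums to their differences, and
  \<open>X \<subseteq> A\<close> brings back \<open>A\<close>.\<close>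

lemma plunnecke_ruzsa:
  fixes A D :: "'a::ab_group_add set"
  assumes "finite A" "A \<noteq> {}" "finite D" and K: "real (card (A + D)) \<le> K * real (card A)"
  shows "real (card {p - q |p q. p \<in> nfold_sum j D \<and> q \<in> nfold_sum j D}) \<le> K ^ (2 * j) * real (card A)"
proof -
  obtain X where X: "X \<subseteq> A" "X \<noteq> {}" and main: "\<And>C. finite C \<Longrightarrow>
      real (card (X + D + C)) \<le> real (card (A + D)) / real (card A) * real (card (X + C))"
    using petridis[OF assms(1-3)] by metis
  have cA: "real (card A) > 0" using assms by (simp add: card_gt_0_iff)
  have KK: "real (card (A + D)) / real (card A) \<le> K" using K cA by (simp add: field_simps)
  then have K0: "K \<ge> 0" by (smt (verit) divide_nonneg_nonneg of_nat_0_le_iff)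
  have fX: "finite X" using X assms finite_subset by auto
  have cX: "real (card X) > 0" using X fX by (simp add: card_gt_0_iff)
  have it: "real (card (X + nfold_sum j D)) \<le> K ^ j * real (card X)" for j
  proof (induction j)
    case (Suc j)
    have "real (card (X + nfold_sum (Suc j) D)) = real (card (X + D + nfold_sum j D))"
      by (simp add: add.assoc)
    also have "\<dots> \<le> real (card (A + D)) / real (card A) * real (card (X + nfold_sum j D))"
      by (rule main) (simp add: finite_nfold_sum assms)
    also have "\<dots> \<le> K * real (card (X + nfold_sum j D))"
      by (rule mult_right_mono[OF KK]) auto
    also have "\<dots> \<le> K * (K ^ j * real (card X))" by (rule mult_left_mono[OF Suc K0])
    finally show ?case by simp
  qed simp
  let ?M = "{p - q |p q. p \<in> nfold_sum j D \<and> q \<in> nfold_sum j D}"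
  have "real (card X) * real (card ?M) \<le> real (card (X + nfold_sum j D)) * real (card (X + nfold_sum j D))"
    using of_nat_mono[OF ruzsa_triangle[OF fX finite_nfold_sum[OF assms(3)] finite_nfold_sum[OF assms(3)], of j j], where 'a = real]
    by (simp only: of_nat_mult)
  also have "\<dots> \<le> (K ^ j * real (card X)) * (K ^ j * real (card X))"
    by (rule mult_mono[OF it it]) (use K0 in auto)
  also have "\<dots> = real (card X) * (K ^ (2 * j) * real (card X))"
    by (simp add: power_add mult_2)
  finally have "real (card ?M) \<le> K ^ (2 * j) * real (card X)" using cX by simp
  also have "\<dots> \<le> K ^ (2 * j) * real (card A)"
    by (rule mult_left_mono) (use card_mono[OF assms(1) X(1)] K0 in auto)
  finally show ?thesis .
qed

text \<open>The members of \<open>dyadic_intervals \<delta>\<close> are the fibres of \<lfloor>x /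
  \<delta>\<rfloor>, so a cover needs a separate interval for each value taken on
  \<open>E\<close>.\<close>

lemma card_floor_le_dyadic_covering_number:
  assumes "finite E" "\<delta> > 0"
  shows "card ((\<lambda>x. \<lfloor>x / \<delta>\<rfloor>) ` E) \<le> dyadic_covering_number E \<delta>"
proof -
  let ?P = "\<lambda>n. \<exists>\<I>. \<I> \<subseteq> dyadic_intervals \<delta> \<and> finite \<I> \<and> card \<I> = n \<and> E \<subseteq> \<Union>\<I>"
  define cell where "cell = (\<lambda>k::int. {of_int k * \<delta> ..< (of_int k + 1) * \<delta>})"
  have cell_iff: "x \<in> cell k \<longleftrightarrow> \<lfloor>x / \<delta>\<rfloor> = k" for x k
    using assms(2) by (auto simp: cell_def floor_eq_iff field_simps)
  \<comment> \<open>\<open>LEAST\<close> can be unfolded only once some finite cover is exhibited: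
    the cells that \<open>E\<close> meets.\<close>
  have "?P (card (cell ` (\<lambda>x. \<lfloor>x / \<delta>\<rfloor>) ` E))"
    using assms cell_iff by (intro exI[of _ "cell ` (\<lambda>x. \<lfloor>x / \<delta>\<rfloor>) ` E"]) (auto simp: dyadic_intervals_def cell_def)
  then have "?P (dyadic_covering_number E \<delta>)"
    unfolding dyadic_covering_number_def by (rule LeastI)
  then obtain I where I: "I \<subseteq> dyadic_intervals \<delta>" "finite I" "card I = dyadic_covering_number E \<delta>" "E \<subseteq> \<Union>I"
    by auto
  have Icell: "\<exists>k. J = cell k" if "J \<in> I" for J
    using I(1) that by (auto simp: dyadic_intervals_def cell_def)
  have "(\<lambda>x. \<lfloor>x / \<delta>\<rfloor>) ` E \<subseteq> (\<lambda>J. \<lfloor>(SOME x. x \<in> J) / \<delta>\<rfloor>) ` I"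
  proof clarify
    fix x assume "x \<in> E"
    then obtain J where J: "J \<in> I" "x \<in> J" using I by auto
    then obtain k where k: "J = cell k" using Icell by auto
    have "(SOME x. x \<in> J) \<in> J" using J(2) by (metis someI)
    then have "\<lfloor>x / \<delta>\<rfloor> = \<lfloor>(SOME x. x \<in> J) / \<delta>\<rfloor>" using J(2) by (simp add: cell_iff k)
    then show "\<lfloor>x / \<delta>\<rfloor> \<in> (\<lambda>J. \<lfloor>(SOME x. x \<in> J) / \<delta>\<rfloor>) ` I"
      by (rule image_eqI[OF _ J(1)])
  qed
  then have "card ((\<lambda>x. \<lfloor>x / \<delta>\<rfloor>) ` E) \<le> card ((\<lambda>J. \<lfloor>(SOME x. x \<in> J) / \<delta>\<rfloor>) ` I)"
    by (rule card_mono[rotated]) (simp add: I(2))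
  also have "\<dots> \<le> card I" by (rule card_image_le[OF I(2)])
  finally show ?thesis using I(3) by simp
qed

section \<open>Uniform binary subtrees\<close>

text \<open>The type of \<open>b\<close> records the branchings below its ancestor at height \<open>h\<close>. An ancestor branches
  if at least three of its children have the same type: the two extreme ones are then not adjacent,
  so that points below them are separated at the recorded scale.\<close>

primrec tree_type :: "nat set \<Rightarrow> nat \<Rightarrow> nat \<Rightarrow> nat \<Rightarrow> nat set" where
  "tree_type B L 0 = (\<lambda>b. {})"
| "tree_type B L (Suc h) = (\<lambda>b.
     let U = (\<lambda>b'. b' div 2 ^ (L * h)) `
       {b' \<in> B. b' div 2 ^ (L * Suc h) = b div 2 ^ (L * Suc h) \<and> tree_type B L h b' = tree_type B L h b}
     in if card U \<ge> 3 then insert (L * h + floor_log (Max U - Min U)) (tree_type B L h b)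
        else tree_type B L h b)"

definition siblings :: "nat set \<Rightarrow> nat \<Rightarrow> nat \<Rightarrow> nat \<Rightarrow> nat set" where
  "siblings B L h b = (\<lambda>b'. b' div 2 ^ (L * h)) `
     {b' \<in> B. b' div 2 ^ (L * Suc h) = b div 2 ^ (L * Suc h) \<and> tree_type B L h b' = tree_type B L h b}"

lemma tree_type_Suc:
  "tree_type B L (Suc h) b =
    (if card (siblings B L h b) \<ge> 3
     then insert (L * h + floor_log (Max (siblings B L h b) - Min (siblings B L h b))) (tree_type B L h b)
     else tree_type B L h b)"
  by (simp add: siblings_def Let_def)

declare tree_type.simps(2) [simp del]

lemma node_Suc: "(b::nat) div 2 ^ (L * h) div 2 ^ L = b div 2 ^ (L * Suc h)"
  by (simp add: div_mult2_eq[symmetric] power_add[symmetric] algebra_simps)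

lemma siblings_subset:
  "siblings B L h b \<subseteq> {b div 2 ^ (L * Suc h) * 2 ^ L ..< b div 2 ^ (L * Suc h) * 2 ^ L + 2 ^ L}"
proof
  fix u assume "u \<in> siblings B L h b"
  then have "u div 2 ^ L = b div 2 ^ (L * Suc h)"
    by (auto simp: siblings_def node_Suc simp del: mult_Suc_right)
  then have "b div 2 ^ (L * Suc h) * 2 ^ L + u mod 2 ^ L = u"
    using div_mult_mod_eq[of u "2 ^ L"] by (simp only:)
  moreover have "u mod 2 ^ L < 2 ^ L" by simp
  ultimately show "u \<in> {b div 2 ^ (L * Suc h) * 2 ^ L ..< b div 2 ^ (L * Suc h) * 2 ^ L + 2 ^ L}"
    unfolding atLeastLessThan_iff by linarith
qed

lemma finite_siblings: "finite (siblings B L h b)"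
  by (rule finite_subset[OF siblings_subset]) simp

lemma card_siblings: "card (siblings B L h b) \<le> 2 ^ L"
  using card_mono[OF _ siblings_subset[of B L h b]] by simp

lemma siblings_width:
  assumes "card (siblings B L h b) \<ge> 3"
  defines "U \<equiv> siblings B L h b"
  shows "2 \<le> Max U - Min U" "Max U - Min U < 2 ^ L" "Max U \<in> U" "Min U \<in> U" "Min U < Max U"
proof -
  have f: "finite U" "U \<noteq> {}" using assms finite_siblings by auto
  then show m: "Max U \<in> U" "Min U \<in> U" by auto
  have "U \<subseteq> {Min U .. Max U}" using f by auto
  then have "card U \<le> Suc (Max U) - Min U" using card_mono[of "{Min U .. Max U}" U] by simp
  then show "2 \<le> Max U - Min U" using assms by auto
  then show "Min U < Max U" by auto
  show "Max U - Min U < 2 ^ L"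
  proof -
    define c where "c = b div 2 ^ (L * Suc h) * 2 ^ L"
    have "U \<subseteq> {c..<c + 2 ^ L}" using siblings_subset[of B L h b] by (simp add: U_def c_def)
    then have "Max U < c + 2 ^ L" "c \<le> Min U" using m by (meson atLeastLessThan_iff subsetD)+
    moreover have "(0::nat) < 2 ^ L" by simp
    ultimately show ?thesis by linarith
  qed
qed

lemma floor_log_width:
  assumes "card (siblings B L h b) \<ge> 3"
  defines "U \<equiv> siblings B L h b"
  shows "1 \<le> floor_log (Max U - Min U)" "floor_log (Max U - Min U) < L"
proof -
  note w = siblings_width[OF assms(1), folded U_def]
  have "floor_log 2 \<le> floor_log (Max U - Min U)" by (rule floor_log_le_iff) (rule w(1))
  then show "1 \<le> floor_log (Max U - Min U)" using floor_log_power[of 1] by simp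
  have "2 ^ floor_log (Max U - Min U) \<le> Max U - Min U" using w(1) by (intro floor_log_exp2_le) auto
  then have "(2::nat) ^ floor_log (Max U - Min U) < 2 ^ L" using w(2) by linarith
  then show "floor_log (Max U - Min U) < L" by simp
qed

lemma tree_type_bound: "tree_type B L h b \<subseteq> {..<L * h}"
proof (induction h)
  case (Suc h)
  then show ?case using floor_log_width(2)[of B L h b] by (auto simp: tree_type_Suc intro: less_trans split: if_splits)
qed simp

lemma tree_type_Suc_Int: "tree_type B L (Suc h) b \<inter> {..<L * h} = tree_type B L h b"
  using tree_type_bound[of B L h b] by (auto simp: tree_type_Suc split: if_splits)

lemma tree_type_Int: "h \<le> h' \<Longrightarrow> tree_type B L h' b \<inter> {..<L * h} = tree_type B L h b"
proof (induction h' rule: dec_induct)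
  case base
  then show ?case using tree_type_bound[of B L h b] by auto
next
  case (step h')
  have "L * h \<le> L * h'" using step by simp
  then have lt: "x < L * h'" if "x < L * h" for x using that by (rule less_le_trans[rotated])
  then have "tree_type B L (Suc h') b \<inter> {..<L * h} = (tree_type B L (Suc h') b \<inter> {..<L * h'}) \<inter> {..<L * h}"
    using lt by blast
  then show ?case using step tree_type_Suc_Int by simp
qed

lemma siblings_cong:
  fixes b b' :: nat
  assumes "b' div 2 ^ (L * Suc h) = b div 2 ^ (L * Suc h)" "tree_type B L h b' = tree_type B L h b"
  shows "siblings B L h b' = siblings B L h b"
  by (simp only: siblings_def assms)

text \<open>\<open>X\<close> lists the branchings at which the path down to the leaf
  \<open>\<phi> X\<close> takes the upper child. Large exponents are coarse scales here, so
  \<open>a\<close> is the coarsest scale at which two paths part, and the leaves must then be at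
  distance about \<open>2 ^ a\<close>.\<close>

definition tree_embedding :: "nat set \<Rightarrow> (nat set \<Rightarrow> nat) \<Rightarrow> bool" where
  "tree_embedding S \<phi> \<longleftrightarrow> (\<forall>X Y a. X \<subseteq> S \<longrightarrow> Y \<subseteq> S \<longrightarrow> a \<in> X \<longrightarrow> a \<notin> Y \<longrightarrow> X \<inter> {a<..} = Y \<inter> {a<..} \<longrightarrow>
     2 ^ a \<le> 2 * (real (\<phi> X) - real (\<phi> Y)) \<and> real (\<phi> X) - real (\<phi> Y) \<le> 2 * 2 ^ a)"

text \<open>At a branching node, take points over the two extreme siblings. They have the same type
  \<open>s\<close> below, so both subtrees contain an embedded copy of the same tree, and the two
  copies are glued. The extra conclusions on ancestor and type are what keeps this induction
  going.\<close>

lemma tree_embedding_exists: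
  assumes "b \<in> B"
  shows "\<exists>\<phi>. tree_embedding (tree_type B L h b) \<phi> \<and>
    (\<forall>X\<subseteq>tree_type B L h b. \<phi> X \<in> B \<and> \<phi> X div 2 ^ (L * h) = b div 2 ^ (L * h) \<and>
        tree_type B L h (\<phi> X) = tree_type B L h b)"
  using assms
proof (induction h arbitrary: b)
  case 0
  then show ?case by (intro exI[of _ "\<lambda>X. b"]) (auto simp: tree_embedding_def)
next
  case (Suc h)
  define s where "s = tree_type B L h b"
  define U where "U = siblings B L h b"
  have up: "b' div 2 ^ (L * Suc h) = v div 2 ^ L" if "b' div 2 ^ (L * h) = v" for b' v :: nat
    using node_Suc[of b' L h] that by simp
  show ?case
  proof (cases "card U \<ge> 3")
    case False
    then have S: "tree_type B L (Suc h) b = s" by (simp add: tree_type_Suc U_def s_def)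
    obtain \<phi> where \<phi>: "tree_embedding s \<phi>"
      "\<And>X. X \<subseteq> s \<Longrightarrow> \<phi> X \<in> B \<and> \<phi> X div 2 ^ (L * h) = b div 2 ^ (L * h) \<and> tree_type B L h (\<phi> X) = s"
      using Suc.IH[OF Suc.prems] unfolding s_def by blast
    have "\<phi> X div 2 ^ (L * Suc h) = b div 2 ^ (L * Suc h) \<and> tree_type B L (Suc h) (\<phi> X) = s" if "X \<subseteq> s" for X
    proof -
      have 1: "\<phi> X div 2 ^ (L * Suc h) = b div 2 ^ (L * Suc h)"
        using \<phi>(2)[OF that] by (simp only: node_Suc[symmetric])
      then have "siblings B L h (\<phi> X) = U" unfolding U_def
        by (rule siblings_cong) (use \<phi>(2)[OF that] s_def in auto)
      then show ?thesis using 1 False \<phi>(2)[OF that] by (simp add: tree_type_Suc)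
    qed
    then show ?thesis using \<phi> S by (intro exI[of _ \<phi>]) (simp del: mult_Suc_right)
  next
    case True
    define k where "k = floor_log (Max U - Min U)"
    define g where "g = L * h + k"
    have S: "tree_type B L (Suc h) b = insert g s"
      using True by (simp add: tree_type_Suc U_def s_def g_def k_def)
    note w = siblings_width[OF True[unfolded U_def], folded U_def]
    have sg: "x < g" if "x \<in> s" for x
      using that tree_type_bound[of B L h b] by (auto simp: s_def g_def)
    have ex: "\<exists>b'\<in>B. b' div 2 ^ (L * h) = u \<and> b' div 2 ^ (L * Suc h) = b div 2 ^ (L * Suc h) \<and> tree_type B L h b' = s"
      if "u \<in> U" for u using that unfolding U_def siblings_def s_def by auto
    obtain b0 where b0: "b0 \<in> B" "b0 div 2 ^ (L * h) = Min U" "b0 div 2 ^ (L * Suc h) = b div 2 ^ (L * Suc h)"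
      "tree_type B L h b0 = s" using ex[OF w(4)] by blast
    obtain b1 where b1: "b1 \<in> B" "b1 div 2 ^ (L * h) = Max U" "b1 div 2 ^ (L * Suc h) = b div 2 ^ (L * Suc h)"
      "tree_type B L h b1 = s" using ex[OF w(3)] by blast
    obtain \<phi>0 where \<phi>0: "tree_embedding s \<phi>0"
      "\<And>X. X \<subseteq> s \<Longrightarrow> \<phi>0 X \<in> B \<and> \<phi>0 X div 2 ^ (L * h) = Min U \<and> tree_type B L h (\<phi>0 X) = s"
      using Suc.IH[OF b0(1)] unfolding b0(2,4) by blast
    obtain \<phi>1 where \<phi>1: "tree_embedding s \<phi>1"
      "\<And>X. X \<subseteq> s \<Longrightarrow> \<phi>1 X \<in> B \<and> \<phi>1 X div 2 ^ (L * h) = Max U \<and> tree_type B L h (\<phi>1 X) = s"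
      using Suc.IH[OF b1(1)] unfolding b1(2,4) by blast
    define \<phi> where "\<phi> = (\<lambda>X. if g \<in> X then \<phi>1 (X - {g}) else \<phi>0 X)"
    have sub: "X - {g} \<subseteq> s" "g \<notin> X \<Longrightarrow> X \<subseteq> s" if "X \<subseteq> insert g s" for X using that by auto
    have range: "\<phi> X \<in> B \<and> \<phi> X div 2 ^ (L * h) \<in> {Min U, Max U} \<and> tree_type B L h (\<phi> X) = s"
      if "X \<subseteq> insert g s" for X
      using \<phi>0(2)[of X] \<phi>1(2)[OF sub(1)[OF that]] sub(2)[OF that] unfolding \<phi>_def by auto
    have range2: "\<phi> X div 2 ^ (L * Suc h) = b div 2 ^ (L * Suc h) \<and> tree_type B L (Suc h) (\<phi> X) = insert g s"
      if "X \<subseteq> insert g s" for X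
    proof -
      have 1: "\<phi> X div 2 ^ (L * Suc h) = b div 2 ^ (L * Suc h)"
        using range[OF that] up b0(2,3) b1(2,3) by (metis insertE singletonD)
      then have "siblings B L h (\<phi> X) = U" unfolding U_def
        by (rule siblings_cong) (use range[OF that] s_def in auto)
      then show ?thesis using 1 True range[OF that] by (simp add: tree_type_Suc g_def k_def)
    qed
    have emb: "2 ^ a \<le> 2 * (real (\<phi> X) - real (\<phi> Y)) \<and> real (\<phi> X) - real (\<phi> Y) \<le> 2 * 2 ^ a"
      if XY: "X \<subseteq> insert g s" "Y \<subseteq> insert g s" "a \<in> X" "a \<notin> Y" "X \<inter> {a<..} = Y \<inter> {a<..}" for X Y a
    proof (cases "a = g")
      case True
      have Y: "\<phi> Y div 2 ^ (L * h) = Min U" using \<phi>0(2)[OF sub(2)[OF XY(2)]] XY(4) True by (simp add: \<phi>_def)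
      have X: "\<phi> X div 2 ^ (L * h) = Max U" using \<phi>1(2)[OF sub(1)[OF XY(1)]] XY(3) True by (simp add: \<phi>_def)
      define P :: nat where "P = 2 ^ (L * h)"
      have P: "P > 0" by (simp add: P_def)
      define e where "e = Max U - Min U"
      have e: "Max U = Min U + e" using w(5) by (simp add: e_def)
      have x: "P * Max U \<le> \<phi> X" "\<phi> X < P * Max U + P"
        using mult_div_mod_eq[of P "\<phi> X"] mod_less_divisor[OF P, of "\<phi> X"] unfolding X[folded P_def]
        by linarith+
      have y: "P * Min U \<le> \<phi> Y" "\<phi> Y < P * Min U + P"
        using mult_div_mod_eq[of P "\<phi> Y"] mod_less_divisor[OF P, of "\<phi> Y"] unfolding Y[folded P_def]
        by linarith+
      have k: "2 ^ k \<le> e" "e < 2 * 2 ^ k" using w(1) floor_log_exp2_le[of e] floor_log_exp2_gt[of e]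
        by (auto simp: k_def e_def)
      \<comment> \<open>Leaves below nodes \<open>e\<close> apart differ by at least
        \<open>P * (e - 1)\<close> and at most \<open>P * (e + 1)\<close>. This is where three
        siblings matter: \<open>e \<ge> 2\<close> makes \<open>e - 1\<close> at least half of
        \<open>e\<close>.\<close>
      have k2: "e + 1 \<le> 2 * 2 ^ k" "2 ^ k \<le> 2 * (e - 1)" using k w(1) by (auto simp: e_def)
      have "\<phi> X + P * Min U \<le> P * (Min U + e) + P + \<phi> Y" using x y unfolding e by linarith
      then have "\<phi> X \<le> P * (e + 1) + \<phi> Y" by (simp add: algebra_simps)
      also have "\<dots> \<le> P * (2 * 2 ^ k) + \<phi> Y" by (rule add_right_mono[OF mult_left_mono[OF k2(1)]]) simp
      finally have 1: "real (\<phi> X) \<le> real (P * (2 * 2 ^ k)) + real (\<phi> Y)" by linarith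
      have "P * e + \<phi> Y \<le> \<phi> X + P" using x y unfolding e by (simp add: algebra_simps)
      moreover have "P * e = P * (e - 1) + P" using w(1) by (cases e) (auto simp: e_def)
      ultimately have "P * (e - 1) + \<phi> Y \<le> \<phi> X" by linarith
      moreover have "P * 2 ^ k \<le> P * (2 * (e - 1))" by (rule mult_left_mono[OF k2(2)]) simp
      ultimately have "P * 2 ^ k + 2 * \<phi> Y \<le> 2 * \<phi> X" by linarith
      then have 2: "real (P * 2 ^ k) + 2 * real (\<phi> Y) \<le> 2 * real (\<phi> X)" by linarith
      show ?thesis using 1 2 by (simp add: True g_def P_def power_add)
    next
      case False
      then have as: "a \<in> s" using XY by auto
      then have ag: "a < g" using sg by simp
      then have gg: "g \<in> X \<longleftrightarrow> g \<in> Y" using XY(5) by auto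
      show ?thesis
      proof (cases "g \<in> X")
        case True
        have "(X - {g}) \<inter> {a<..} = (Y - {g}) \<inter> {a<..}" using XY(5) by auto
        then show ?thesis
          using \<phi>1(1) sub(1)[OF XY(1)] sub(1)[OF XY(2)] XY(3,4) False gg True unfolding tree_embedding_def \<phi>_def by auto
      next
        case F: False
        then show ?thesis
          using \<phi>0(1) sub(2)[OF XY(1)] sub(2)[OF XY(2)] XY(3,4,5) gg unfolding tree_embedding_def \<phi>_def by auto
      qed
    qed
    show ?thesis
      unfolding S by (intro exI[of _ \<phi>]) (use emb range range2 in \<open>auto simp: tree_embedding_def simp del: mult_Suc_right\<close>)
  qed
qed

section \<open>Counting nodes and types of the tree\<close>

lemma card_UN_fibres_le:
  assumes "finite A" "\<And>v. v \<in> f ` A \<Longrightarrow> card (g ` {x \<in> A. f x = v}) \<le> n"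
  shows "card (g ` A) \<le> card (f ` A) * n"
proof -
  have "g ` A = (\<Union>v\<in>f ` A. g ` {x \<in> A. f x = v})" by auto
  then have "card (g ` A) \<le> (\<Sum>v\<in>f ` A. card (g ` {x \<in> A. f x = v}))"
    using card_UN_le[of "f ` A" "\<lambda>v. g ` {x \<in> A. f x = v}"] assms(1) by simp
  also have "\<dots> \<le> (\<Sum>v\<in>f ` A. n)" by (rule sum_mono) (rule assms(2))
  finally show ?thesis by simp
qed

text \<open>Descend from the root. A level where \<open>S\<close> records a branching multiplies the
  number of nodes by at most \<open>2 ^ L\<close>; at any other level a node has at most two
  children of the given type, so the number at most doubles. Hence a large set forces many recorded
  branchings.\<close>

lemma card_nodes_of_type:
  assumes "finite B" "B \<subseteq> {..<2 ^ (L * M)}" "h \<le> M"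
  shows "card ((\<lambda>b. b div 2 ^ (L * h)) ` {b \<in> B. tree_type B L M b = S})
    \<le> 2 ^ (M - h) * 2 ^ (L * card (S \<inter> {L * h..<L * M}))"
  using assms(3)
proof (induction h rule: inc_induct)
  case base
  have "(\<lambda>b. b div 2 ^ (L * M)) ` {b \<in> B. tree_type B L M b = S} \<subseteq> {0}" using assms(2) by auto
  then have "card ((\<lambda>b. b div 2 ^ (L * M)) ` {b \<in> B. tree_type B L M b = S}) \<le> card {0::nat}"
    by (intro card_mono) auto
  then show ?case by simp
next
  case (step h)
  let ?A = "{b \<in> B. tree_type B L M b = S}"
  let ?N = "if S \<inter> {L * h..<L * Suc h} = {} then 2 else (2::nat) ^ L"
  have fin: "finite ?A" using assms(1) by auto
  have "card ((\<lambda>b. b div 2 ^ (L * h)) ` ?A) \<le> card ((\<lambda>b. b div 2 ^ (L * Suc h)) ` ?A) * ?N"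
  proof (rule card_UN_fibres_le[OF fin])
    fix v assume "v \<in> (\<lambda>b. b div 2 ^ (L * Suc h)) ` ?A"
    then obtain b where b: "b \<in> ?A" "v = b div 2 ^ (L * Suc h)" by blast
    have ty: "tree_type B L h b' = S \<inter> {..<L * h}" if "b' \<in> ?A" for b'
      using tree_type_Int[of h M B L b'] that step by auto
    have sub: "(\<lambda>b. b div 2 ^ (L * h)) ` {x \<in> ?A. x div 2 ^ (L * Suc h) = v} \<subseteq> siblings B L h b"
      unfolding siblings_def using ty b by (auto simp del: mult_Suc_right)
    have le: "card ((\<lambda>b. b div 2 ^ (L * h)) ` {x \<in> ?A. x div 2 ^ (L * Suc h) = v}) \<le> card (siblings B L h b)"
      by (rule card_mono[OF finite_siblings sub])
    show "card ((\<lambda>b. b div 2 ^ (L * h)) ` {x \<in> ?A. x div 2 ^ (L * Suc h) = v}) \<le> ?N"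
    proof (cases "S \<inter> {L * h..<L * Suc h} = {}")
      case True
      have "tree_type B L (Suc h) b = S \<inter> {..<L * Suc h}"
        using tree_type_Int[of "Suc h" M B L b] b step by auto
      then have "tree_type B L (Suc h) b \<subseteq> {..<L * h}" using True by fastforce
      then have "\<not> card (siblings B L h b) \<ge> 3" by (auto simp: tree_type_Suc split: if_splits)
      then show ?thesis using le True by simp
    next
      case False
      then show ?thesis using le card_siblings[of B L h b] by simp
    qed
  qed
  also have "\<dots> \<le> (2 ^ (M - Suc h) * 2 ^ (L * card (S \<inter> {L * Suc h..<L * M}))) * ?N"
    using step.IH by (rule mult_right_mono) simp
  also have "\<dots> \<le> 2 ^ (M - h) * 2 ^ (L * card (S \<inter> {L * h..<L * M}))"
  proof -
    have M: "M - h = Suc (M - Suc h)" using step by simp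
    have LM: "L * Suc h \<le> L * M" using step by (intro mult_le_mono2) simp
    have un: "S \<inter> {L * h..<L * M} = (S \<inter> {L * h..<L * Suc h}) \<union> (S \<inter> {L * Suc h..<L * M})"
      using LM by auto
    have c: "card (S \<inter> {L * h..<L * M}) = card (S \<inter> {L * h..<L * Suc h}) + card (S \<inter> {L * Suc h..<L * M})"
      unfolding un by (rule card_Un_disjoint) auto
    show ?thesis
    proof (cases "S \<inter> {L * h..<L * Suc h} = {}")
      case True
      then show ?thesis by (simp add: M un del: mult_Suc_right)
    next
      case False
      then have "card (S \<inter> {L * h..<L * Suc h}) \<ge> 1" by (simp add: Suc_le_eq card_gt_0_iff del: mult_Suc_right)
      then have "L + L * card (S \<inter> {L * Suc h..<L * M}) \<le> L * card (S \<inter> {L * h..<L * M})"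
        unfolding c add_mult_distrib2 by (simp del: mult_Suc_right)
      then have "(2::nat) ^ L * 2 ^ (L * card (S \<inter> {L * Suc h..<L * M})) \<le> 2 ^ (L * card (S \<inter> {L * h..<L * M}))"
        unfolding power_add[symmetric] by (rule power_increasing) simp
      moreover have "(2::nat) ^ (M - Suc h) \<le> 2 ^ (M - h)" by (rule power_increasing) auto
      ultimately have "(2::nat) ^ (M - Suc h) * (2 ^ L * 2 ^ (L * card (S \<inter> {L * Suc h..<L * M})))
          \<le> 2 ^ (M - h) * 2 ^ (L * card (S \<inter> {L * h..<L * M}))"
        by (intro mult_mono) auto
      then show ?thesis using False by (simp add: ac_simps del: mult_Suc_right)
    qed
  qed
  finally show ?case .
qed

lemma card_tree_types:
  assumes "finite B" "L \<ge> 1"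
  shows "card (tree_type B L h ` B) \<le> L ^ h"
proof (induction h)
  case 0
  have "tree_type B L 0 ` B \<subseteq> {{}}" by auto
  then show ?case using card_mono[of "{{}}" "tree_type B L 0 ` B"] by simp
next
  case (Suc h)
  \<comment> \<open>By \<open>floor_log_width\<close> a recorded exponent is at least 1, so
    \<open>e = 0\<close> is free to encode a level without branching, and \<open>L\<close> outcomes
    per level suffice.\<close>
  let ?F = "\<lambda>(s, e). if e = 0 then s else insert (L * h + e) s"
  have "tree_type B L (Suc h) ` B \<subseteq> ?F ` ((tree_type B L h ` B) \<times> {..<L})"
  proof clarify
    fix b assume b: "b \<in> B"
    show "tree_type B L (Suc h) b \<in> ?F ` ((tree_type B L h ` B) \<times> {..<L})"
    proof (cases "card (siblings B L h b) \<ge> 3")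
      case True
      show ?thesis
        by (rule image_eqI[of _ _ "(tree_type B L h b, floor_log (Max (siblings B L h b) - Min (siblings B L h b)))"])
          (use True b floor_log_width[OF True] in \<open>auto simp: tree_type_Suc\<close>)
    next
      case False
      show ?thesis
        by (rule image_eqI[of _ _ "(tree_type B L h b, 0)"]) (use False b assms in \<open>auto simp: tree_type_Suc\<close>)
    qed
  qed
  then have "card (tree_type B L (Suc h) ` B) \<le> card (?F ` ((tree_type B L h ` B) \<times> {..<L}))"
    by (rule card_mono[rotated]) (use assms in auto)
  also have "\<dots> \<le> card ((tree_type B L h ` B) \<times> {..<L})" by (rule card_image_le) (use assms in auto)
  also have "\<dots> \<le> L ^ Suc h" using Suc by (simp add: card_cartesian_product)
  finally show ?case .
qed

lemma card_tree_type_block: "card (tree_type B L h b \<inter> {L * j..<L * Suc j}) \<le> 1"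
proof (induction h)
  case (Suc h)
  show ?case
  proof (cases "j = h")
    case True
    have "tree_type B L (Suc h) b \<inter> {L * j..<L * Suc j}
      \<subseteq> {L * h + floor_log (Max (siblings B L h b) - Min (siblings B L h b))}"
      using tree_type_bound[of B L h b] True by (auto simp: tree_type_Suc split: if_splits)
    from card_mono[OF _ this] show ?thesis by simp
  next
    case False
    have "tree_type B L (Suc h) b \<inter> {L * j..<L * Suc j} \<subseteq> tree_type B L h b \<inter> {L * j..<L * Suc j}"
    proof
      fix x assume x: "x \<in> tree_type B L (Suc h) b \<inter> {L * j..<L * Suc j}"
      have "x < L * h"
      proof (cases "j < h")
        case True
        then have "L * Suc j \<le> L * h" by (intro mult_le_mono2) simp
        then show ?thesis using x by auto
      next
        case F: False
        then have "L * Suc h \<le> L * j" using False by (intro mult_le_mono2) simp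
        then show ?thesis using x tree_type_bound[of B L "Suc h" b] by fastforce
      qed
      then show "x \<in> tree_type B L h b \<inter> {L * j..<L * Suc j}" using x tree_type_Suc_Int[of B L h b] by auto
    qed
    from card_mono[OF _ this] Suc show ?thesis by simp
  qed
qed simp

text \<open>Pigeonhole over types: some type occurs for a proportion at least
  \<open>1 / L ^ M\<close> of \<open>B\<close>. The last clause has two uses: with
  \<open>h = 0\<close> and \<open>n = 1\<close> it compares \<open>|S|\<close> with
  \<open>|B|\<close>, and with larger \<open>h\<close> it turns a bound \<open>n\<close> on the
  points below one node into branchings among the coarse scales.\<close>

lemma uniform_subtree:
  assumes "finite B" "B \<noteq> {}" "B \<subseteq> {..<2 ^ (L * M)}" "L \<ge> 1"
  obtains S \<phi> where "S \<subseteq> {..<L * M}" "\<And>j. card (S \<inter> {L * j..<L * Suc j}) \<le> 1"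
    "tree_embedding S \<phi>" "\<And>X. X \<subseteq> S \<Longrightarrow> \<phi> X \<in> B"
    "\<And>h n. h \<le> M \<Longrightarrow> (\<And>v. card {b \<in> B. b div 2 ^ (L * h) = v} \<le> n) \<Longrightarrow>
       card B \<le> L ^ M * (2 ^ M * 2 ^ (L * card (S \<inter> {L * h..<L * M})) * n)"
proof -
  let ?T = "tree_type B L M"
  have "card B \<le> L ^ M * Max ((\<lambda>s. card {b \<in> B. ?T b = s}) ` ?T ` B)"
  proof -
    have "B = (\<Union>s\<in>?T ` B. {b \<in> B. ?T b = s})" by auto
    then have "card B \<le> (\<Sum>s\<in>?T ` B. card {b \<in> B. ?T b = s})"
      using card_UN_le[of "?T ` B" "\<lambda>s. {b \<in> B. ?T b = s}"] assms(1) by simp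
    also have "\<dots> \<le> (\<Sum>s\<in>?T ` B. Max ((\<lambda>s. card {b \<in> B. ?T b = s}) ` ?T ` B))"
      by (rule sum_mono) (use assms(1) in auto)
    also have "\<dots> \<le> L ^ M * Max ((\<lambda>s. card {b \<in> B. ?T b = s}) ` ?T ` B)"
      using card_tree_types[OF assms(1,4), of M] by simp
    finally show ?thesis .
  qed
  moreover have "Max ((\<lambda>s. card {b \<in> B. ?T b = s}) ` ?T ` B) \<in> (\<lambda>s. card {b \<in> B. ?T b = s}) ` ?T ` B"
    using assms(1,2) by (intro Max_in) auto
  ultimately obtain b where b: "b \<in> B" and le: "card B \<le> L ^ M * card {b' \<in> B. ?T b' = ?T b}" by auto
  define S where "S = ?T b"
  obtain \<phi> where \<phi>: "tree_embedding S \<phi>" "\<And>X. X \<subseteq> S \<Longrightarrow> \<phi> X \<in> B"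
    using tree_embedding_exists[OF b, of L M] unfolding S_def by blast
  show ?thesis
  proof (rule that[of S \<phi>])
    show "S \<subseteq> {..<L * M}" unfolding S_def by (rule tree_type_bound)
    show "card (S \<inter> {L * j..<L * Suc j}) \<le> 1" for j unfolding S_def by (rule card_tree_type_block)
    fix h n assume h: "h \<le> M" and n: "\<And>v. card {b \<in> B. b div 2 ^ (L * h) = v} \<le> n"
    let ?A = "{b' \<in> B. ?T b' = S}"
    have "card ((\<lambda>x. x) ` ?A) \<le> card ((\<lambda>b. b div 2 ^ (L * h)) ` ?A) * n"
    proof (rule card_UN_fibres_le)
      fix v
      have "card ((\<lambda>x. x) ` {x \<in> ?A. x div 2 ^ (L * h) = v}) \<le> card {b \<in> B. b div 2 ^ (L * h) = v}"
        by (rule card_mono) (use assms(1) in auto)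
      then show "card ((\<lambda>x. x) ` {x \<in> ?A. x div 2 ^ (L * h) = v}) \<le> n" using n[of v] by linarith
    qed (use assms in auto)
    also have "\<dots> \<le> (2 ^ (M - h) * 2 ^ (L * card (S \<inter> {L * h..<L * M}))) * n"
      by (rule mult_right_mono[OF card_nodes_of_type[OF assms(1,3) h]]) simp
    also have "\<dots> \<le> (2 ^ M * 2 ^ (L * card (S \<inter> {L * h..<L * M}))) * n"
      by (intro mult_right_mono power_increasing) auto
    finally have "card ?A \<le> 2 ^ M * 2 ^ (L * card (S \<inter> {L * h..<L * M})) * n" by simp
    then have "L ^ M * card ?A \<le> L ^ M * (2 ^ M * 2 ^ (L * card (S \<inter> {L * h..<L * M})) * n)"
      by (rule mult_left_mono) simp
    then show "card B \<le> L ^ M * (2 ^ M * 2 ^ (L * card (S \<inter> {L * h..<L * M})) * n)"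
      using le unfolding S_def by linarith
  qed (use \<phi> in auto)
qed

text \<open>Greedy choice in increasing order. Every skipped \<open>s\<close> lies within
  \<open>W\<close> above some kept \<open>a \<le> s\<close>, and since \<open>a\<close> is not
  larger than \<open>s\<close>, the loss is at most a factor \<open>k\<close> in every initial
  segment and not only in total.\<close>

lemma separated_subset:
  fixes S :: "nat set"
  assumes "finite S" "\<And>x. card (S \<inter> {x..<x + W}) \<le> k" "W \<ge> 1"
  obtains S' where "S' \<subseteq> S" "\<And>a b. a \<in> S' \<Longrightarrow> b \<in> S' \<Longrightarrow> a < b \<Longrightarrow> a + W \<le> b"
    "\<And>y. card (S \<inter> {..<y}) \<le> k * card (S' \<inter> {..<y})"
proof -
  have "\<exists>S'\<subseteq>S. (\<forall>a\<in>S'. \<forall>b\<in>S'. a < b \<longrightarrow> a + W \<le> b) \<and> (\<forall>s\<in>S. \<exists>a\<in>S'. a \<le> s \<and> s < a + W)"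
    using assms(1)
  proof (induction S rule: finite_linorder_max_induct)
    case empty
    then show ?case by auto
  next
    case (insert m S)
    then obtain S' where S': "S' \<subseteq> S" "\<forall>a\<in>S'. \<forall>b\<in>S'. a < b \<longrightarrow> a + W \<le> b" "\<forall>s\<in>S. \<exists>a\<in>S'. a \<le> s \<and> s < a + W"
      by blast
    have lt: "a < m" if "a \<in> S'" for a using that S' insert by auto
    show ?case
    proof (cases "\<exists>a\<in>S'. m < a + W")
      case True
      then show ?thesis using S' lt less_imp_le by (intro exI[of _ S']) blast
    next
      case False
      then have "\<forall>a\<in>S'. a + W \<le> m" by auto
      then have "\<forall>a\<in>insert m S'. \<forall>b\<in>insert m S'. a < b \<longrightarrow> a + W \<le> b"
        using S'(2) lt by (metis insert_iff less_asym less_irrefl)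
      moreover have "\<forall>s\<in>insert m S. \<exists>a\<in>insert m S'. a \<le> s \<and> s < a + W"
        using S'(3) assms(3) by auto
      moreover have "insert m S' \<subseteq> insert m S" using S'(1) by auto
      ultimately show ?thesis by blast
    qed
  qed
  then obtain S' where S': "S' \<subseteq> S" "\<forall>a\<in>S'. \<forall>b\<in>S'. a < b \<longrightarrow> a + W \<le> b" "\<forall>s\<in>S. \<exists>a\<in>S'. a \<le> s \<and> s < a + W"
    by blast
  show ?thesis
  proof (rule that[OF S'(1)])
    fix y
    have f: "finite (S' \<inter> {..<y})" by simp
    have "S \<inter> {..<y} \<subseteq> (\<Union>a\<in>S' \<inter> {..<y}. S \<inter> {a..<a + W})" using S'(3) by fastforce
    then have "card (S \<inter> {..<y}) \<le> card (\<Union>a\<in>S' \<inter> {..<y}. S \<inter> {a..<a + W})"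
      by (rule card_mono[rotated]) (use assms(1) in auto)
    also have "\<dots> \<le> (\<Sum>a\<in>S' \<inter> {..<y}. card (S \<inter> {a..<a + W}))" by (rule card_UN_le[OF f])
    also have "\<dots> \<le> (\<Sum>a\<in>S' \<inter> {..<y}. k)" by (rule sum_mono) (rule assms(2))
    finally show "card (S \<inter> {..<y}) \<le> k * card (S' \<inter> {..<y})" by (simp add: mult.commute)
  qed (use S'(2) in auto)
qed

section \<open>Entropy of functions on a finite set\<close>

lemma positive_weight_exists:
  fixes a :: "'i \<Rightarrow> real"
  assumes "\<And>i. i \<in> I \<Longrightarrow> a i \<ge> 0" "sum a I = 1"
  obtains j where "j \<in> I" "a j > 0"
proof -
  have "\<exists>i\<in>I. a i > 0"
  proof (rule ccontr)
    assume "\<not> ?thesis"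
    then have "sum a I = 0" using assms(1) by (intro sum.neutral) force
    then show False using assms(2) by simp
  qed
  then show ?thesis using that by auto
qed

text \<open>Jensen's inequality, from the tangent bound \<open>ln z \<le> z - 1\<close> applied to
  \<open>y i\<close> divided by the mean \<open>m\<close>.\<close>

lemma weighted_log_le:
  fixes a y :: "'i \<Rightarrow> real"
  assumes "finite I" "\<And>i. i \<in> I \<Longrightarrow> a i \<ge> 0" "sum a I = 1" "\<And>i. i \<in> I \<Longrightarrow> y i > 0"
  shows "(\<Sum>i\<in>I. a i * log 2 (y i)) \<le> log 2 (\<Sum>i\<in>I. a i * y i)"
proof -
  define m where "m = (\<Sum>i\<in>I. a i * y i)"
  obtain j where j: "j \<in> I" "a j > 0" by (rule positive_weight_exists[OF assms(2,3)])
  have m: "m > 0" unfolding m_def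
    by (rule sum_pos2[OF assms(1) j(1)]) (use j assms(2,4) in \<open>auto intro!: mult_nonneg_nonneg less_imp_le[OF assms(4)]\<close>)
  have "a i * log 2 (y i) \<le> a i * log 2 m + (a i * y i / m - a i) / ln 2" if i: "i \<in> I" for i
  proof -
    have "ln (y i / m) \<le> y i / m - 1" by (rule ln_le_minus_one) (use m assms(4)[OF i] in auto)
    then have "ln (y i) \<le> ln m + (y i / m - 1)" using m assms(4)[OF i] by (simp add: ln_div)
    then have "log 2 (y i) \<le> log 2 m + (y i / m - 1) / ln 2"
      by (simp add: log_def field_simps)
    then have "a i * log 2 (y i) \<le> a i * (log 2 m + (y i / m - 1) / ln 2)"
      by (rule mult_left_mono) (rule assms(2)[OF i])
    then show ?thesis by (simp add: algebra_simps)
  qed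
  then have "(\<Sum>i\<in>I. a i * log 2 (y i)) \<le> (\<Sum>i\<in>I. a i * log 2 m + (a i * y i / m - a i) / ln 2)"
    by (rule sum_mono)
  also have "\<dots> = (\<Sum>i\<in>I. a i) * log 2 m + ((\<Sum>i\<in>I. a i * y i) / m - (\<Sum>i\<in>I. a i)) / ln 2"
    by (simp add: sum.distrib sum_distrib_right sum_subtractf sum_divide_distrib diff_divide_distrib)
  also have "\<dots> = log 2 m" using m assms(3) by (simp add: m_def[symmetric])
  finally show ?thesis by (simp add: m_def)
qed

text \<open>Jensen for the reciprocals. Every entropy inequality below is reduced to this form, a
  bound on a mean of quotients of fibre sizes, which can be computed by plain counting.\<close>

lemma average_log_ge:
  fixes x :: "'i \<Rightarrow> real"
  assumes "finite I" "I \<noteq> {}" "\<And>i. i \<in> I \<Longrightarrow> x i > 0" "(\<Sum>i\<in>I. 1 / x i) \<le> c * real (card I)"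
  shows "(\<Sum>i\<in>I. log 2 (x i)) / real (card I) \<ge> - log 2 c"
proof -
  have n: "real (card I) > 0" using assms(1,2) by (simp add: card_gt_0_iff)
  have "(\<Sum>i\<in>I. 1 / real (card I) * log 2 (1 / x i)) \<le> log 2 (\<Sum>i\<in>I. 1 / real (card I) * (1 / x i))"
    by (rule weighted_log_le) (use assms n in auto)
  also have "(\<Sum>i\<in>I. 1 / real (card I) * (1 / x i)) = (\<Sum>i\<in>I. 1 / x i) / real (card I)"
    by (simp add: sum_divide_distrib mult.commute)
  also have "log 2 ((\<Sum>i\<in>I. 1 / x i) / real (card I)) \<le> log 2 c"
  proof (rule log_mono)
    show "0 < (\<Sum>i\<in>I. 1 / x i) / real (card I)"
      by (intro divide_pos_pos n sum_pos) (use assms in auto)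
    show "(\<Sum>i\<in>I. 1 / x i) / real (card I) \<le> c" using assms(4) n by (simp add: divide_le_eq)
  qed simp
  also have "(\<Sum>i\<in>I. 1 / real (card I) * log 2 (1 / x i)) = - (\<Sum>i\<in>I. log 2 (x i)) / real (card I)"
  proof -
    have "(\<Sum>i\<in>I. 1 / real (card I) * log 2 (1 / x i)) = (\<Sum>i\<in>I. - (log 2 (x i) / real (card I)))"
      by (rule sum.cong) (use assms(3) in \<open>force simp: log_divide\<close>)+
    then show ?thesis by (simp add: sum_negf sum_divide_distrib)
  qed
  finally show ?thesis by simp
qed

definition fibre_size :: "'w set \<Rightarrow> ('w \<Rightarrow> 'b) \<Rightarrow> 'w \<Rightarrow> real" where
  "fibre_size \<Omega> f w = real (card {w' \<in> \<Omega>. f w' = f w})"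

text \<open>Shannon entropy in bits of \<open>f\<close> under the uniform law on
  \<open>\<Omega>\<close>, since \<open>fibre_size \<Omega> f w / card \<Omega>\<close> is the
  probability of the value \<open>f w\<close>. Averaging over points rather than summing over values
  gives all entropies the same index set.\<close>

definition uniform_entropy :: "'w set \<Rightarrow> ('w \<Rightarrow> 'b) \<Rightarrow> real" where
  "uniform_entropy \<Omega> f = (\<Sum>w\<in>\<Omega>. log 2 (real (card \<Omega>) / fibre_size \<Omega> f w)) / real (card \<Omega>)"

lemma fibre_size_pos: "finite \<Omega> \<Longrightarrow> w \<in> \<Omega> \<Longrightarrow> fibre_size \<Omega> f w > 0"
  by (auto simp: fibre_size_def card_gt_0_iff)

text \<open>Dividing by the size of the fibre makes each value of \<open>f\<close> count exactly
  once.\<close>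

lemma sum_over_fibre_size:
  assumes "finite \<Omega>"
  shows "(\<Sum>w\<in>\<Omega>. F (f w) / fibre_size \<Omega> f w) = (\<Sum>y\<in>f ` \<Omega>. F y)"
proof -
  have "(\<Sum>w\<in>\<Omega>. F (f w) / fibre_size \<Omega> f w)
      = (\<Sum>y\<in>f ` \<Omega>. \<Sum>w\<in>{w \<in> \<Omega>. f w = y}. F (f w) / fibre_size \<Omega> f w)"
    by (rule sum.image_gen[OF assms])
  also have "\<dots> = (\<Sum>y\<in>f ` \<Omega>. F y)"
  proof (rule sum.cong[OF refl])
    fix y assume y: "y \<in> f ` \<Omega>"
    have c: "real (card {w \<in> \<Omega>. f w = y}) > 0" using y assms by (auto simp: card_gt_0_iff)
    have "(\<Sum>w\<in>{w \<in> \<Omega>. f w = y}. F (f w) / fibre_size \<Omega> f w)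
        = (\<Sum>w\<in>{w \<in> \<Omega>. f w = y}. F y / real (card {w \<in> \<Omega>. f w = y}))"
      by (rule sum.cong) (auto simp: fibre_size_def)
    then show "(\<Sum>w\<in>{w \<in> \<Omega>. f w = y}. F (f w) / fibre_size \<Omega> f w) = F y" using c by simp
  qed
  finally show ?thesis .
qed

lemma uniform_entropy_nonneg:
  assumes "finite \<Omega>"
  shows "uniform_entropy \<Omega> f \<ge> 0"
  unfolding uniform_entropy_def
proof (intro divide_nonneg_nonneg sum_nonneg)
  fix w assume w: "w \<in> \<Omega>"
  have "fibre_size \<Omega> f w \<le> real (card \<Omega>)"
    unfolding fibre_size_def by (simp add: card_mono assms)
  then show "0 \<le> log 2 (real (card \<Omega>) / fibre_size \<Omega> f w)"
    using fibre_size_pos[OF assms w, of f] by simp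
qed simp

lemma uniform_entropy_le_log_card:
  assumes "finite \<Omega>" "\<Omega> \<noteq> {}"
  shows "uniform_entropy \<Omega> f \<le> log 2 (real (card (f ` \<Omega>)))"
proof -
  have n: "real (card \<Omega>) > 0" using assms by (simp add: card_gt_0_iff)
  have "- log 2 (real (card (f ` \<Omega>)))
      \<le> (\<Sum>w\<in>\<Omega>. log 2 (fibre_size \<Omega> f w / real (card \<Omega>))) / real (card \<Omega>)"
  proof (rule average_log_ge[OF assms])
    have "(\<Sum>w\<in>\<Omega>. 1 / (fibre_size \<Omega> f w / real (card \<Omega>))) = (\<Sum>w\<in>\<Omega>. real (card \<Omega>) / fibre_size \<Omega> f w)"
      by simp
    also have "\<dots> = real (card (f ` \<Omega>)) * real (card \<Omega>)"
      using sum_over_fibre_size[OF assms(1), of "\<lambda>_. real (card \<Omega>)" f] by simp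
    finally show "(\<Sum>w\<in>\<Omega>. 1 / (fibre_size \<Omega> f w / real (card \<Omega>))) \<le> real (card (f ` \<Omega>)) * real (card \<Omega>)"
      by simp
  qed (use n fibre_size_pos[OF assms(1), of _ f] in auto)
  also have "(\<Sum>w\<in>\<Omega>. log 2 (fibre_size \<Omega> f w / real (card \<Omega>))) = (\<Sum>w\<in>\<Omega>. - log 2 (real (card \<Omega>) / fibre_size \<Omega> f w))"
    by (rule sum.cong) (use n fibre_size_pos[OF assms(1), of _ f] in \<open>auto simp: log_divide\<close>)
  finally show ?thesis unfolding uniform_entropy_def by (simp add: sum_negf)
qed

text \<open>Submodularity plus two Jensen estimates: conditionally on \<open>V\<close>, the coarse variable \<open>g\<close>
  takes at most \<open>c\<close> values, while \<open>f\<close> has collision probability at most \<open>e\<close>.\<close>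

lemma entropy_increment:
  assumes fin: "finite \<Omega>" "\<Omega> \<noteq> {}"
    and fg: "\<And>w w'. w \<in> \<Omega> \<Longrightarrow> w' \<in> \<Omega> \<Longrightarrow> f w = f w' \<Longrightarrow> g w = g w'"
    and c: "\<And>w. w \<in> \<Omega> \<Longrightarrow> real (card (g ` {w' \<in> \<Omega>. V w' = V w})) \<le> c"
    and e: "(\<Sum>w\<in>\<Omega>. fibre_size \<Omega> (\<lambda>w. (f w, V w)) w / fibre_size \<Omega> V w) \<le> e * real (card \<Omega>)"
  shows "uniform_entropy \<Omega> f \<ge> uniform_entropy \<Omega> g - log 2 e - log 2 c"
proof -
  let ?f = "fibre_size \<Omega> f" and ?g = "fibre_size \<Omega> g" and ?v = "fibre_size \<Omega> V"
  let ?fv = "fibre_size \<Omega> (\<lambda>w. (f w, V w))" and ?gv = "fibre_size \<Omega> (\<lambda>w. (g w, V w))"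
  have n: "real (card \<Omega>) > 0" using fin by (simp add: card_gt_0_iff)
  note pos = fibre_size_pos[OF fin(1)]
  \<comment> \<open>Data processing: \<open>f\<close> determines \<open>g\<close>, so
    \<open>f\<close> shares at least as much information with \<open>V\<close> as \<open>g\<close>
    does. In Jensen form this says that the mean of these quotients is at most 1.\<close>
  have A: "(\<Sum>w\<in>\<Omega>. 1 / (?g w * ?fv w / (?f w * ?gv w))) \<le> 1 * real (card \<Omega>)"
  proof -
    have "(\<Sum>w\<in>\<Omega>. 1 / (?g w * ?fv w / (?f w * ?gv w)))
        = (\<Sum>u\<in>f ` \<Omega>. \<Sum>w\<in>{w \<in> \<Omega>. f w = u}. 1 / (?g w * ?fv w / (?f w * ?gv w)))"
      by (rule sum.image_gen[OF fin(1)])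
    also have "\<dots> \<le> (\<Sum>u\<in>f ` \<Omega>. real (card {w \<in> \<Omega>. f w = u}))"
    proof (rule sum_mono)
      fix u assume "u \<in> f ` \<Omega>"
      then obtain w0 where w0: "w0 \<in> \<Omega>" "u = f w0" by auto
      let ?U = "{w \<in> \<Omega>. f w = u}"
      define G where "G = (\<lambda>v. real (card {w' \<in> \<Omega>. g w' = g w0 \<and> V w' = v}))"
      have finU: "finite ?U" using fin by auto
      have "(\<Sum>w\<in>?U. 1 / (?g w * ?fv w / (?f w * ?gv w))) = (\<Sum>w\<in>?U. (?f w0 / ?g w0) * (G (V w) / fibre_size ?U V w))"
      proof (rule sum.cong[OF refl])
        fix w assume w: "w \<in> ?U"
        have gw: "g w = g w0" using fg[of w w0] w w0 by auto
        have "?g w = ?g w0" "?f w = ?f w0" using gw w w0 by (auto simp: fibre_size_def)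
        moreover have "?gv w = G (V w)" unfolding fibre_size_def G_def by (simp add: gw)
        moreover have "?fv w = fibre_size ?U V w"
        proof -
          have "{w' \<in> \<Omega>. (f w', V w') = (f w, V w)} = {w' \<in> ?U. V w' = V w}" using w by auto
          then show ?thesis unfolding fibre_size_def by simp
        qed
        ultimately show "1 / (?g w * ?fv w / (?f w * ?gv w)) = (?f w0 / ?g w0) * (G (V w) / fibre_size ?U V w)"
          by simp
      qed
      also have "\<dots> = (?f w0 / ?g w0) * (\<Sum>v\<in>V ` ?U. G v)"
        unfolding sum_distrib_left[symmetric] sum_over_fibre_size[OF finU] ..
      also have "\<dots> \<le> (?f w0 / ?g w0) * ?g w0"
      proof (rule mult_left_mono)
        have "(\<Sum>v\<in>V ` ?U. card {w' \<in> \<Omega>. g w' = g w0 \<and> V w' = v})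
            = card (\<Union>v\<in>V ` ?U. {w' \<in> \<Omega>. g w' = g w0 \<and> V w' = v})"
          by (rule card_UN_disjoint[symmetric]) (use fin in auto)
        also have "\<dots> \<le> card {w' \<in> \<Omega>. g w' = g w0}"
          by (rule card_mono) (use fin in auto)
        finally have "real (\<Sum>v\<in>V ` ?U. card {w' \<in> \<Omega>. g w' = g w0 \<and> V w' = v}) \<le> real (card {w' \<in> \<Omega>. g w' = g w0})"
          by (rule of_nat_mono)
        then show "(\<Sum>v\<in>V ` ?U. G v) \<le> ?g w0" unfolding G_def fibre_size_def by simp
        show "0 \<le> ?f w0 / ?g w0" using pos[OF w0(1), of f] pos[OF w0(1), of g] by simp
      qed
      also have "\<dots> = ?f w0" using pos[OF w0(1), of g] by simp
      also have "\<dots> = real (card ?U)" by (simp add: fibre_size_def w0)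
      finally show "(\<Sum>w\<in>?U. 1 / (?g w * ?fv w / (?f w * ?gv w))) \<le> real (card ?U)" .
    qed
    also have "\<dots> = (\<Sum>u\<in>f ` \<Omega>. \<Sum>w\<in>{w \<in> \<Omega>. f w = u}. 1)" by simp
    also have "\<dots> = (\<Sum>w\<in>\<Omega>. 1)" by (rule sum.image_gen[OF fin(1), symmetric])
    finally show ?thesis by simp
  qed
  \<comment> \<open>The conditional entropy of \<open>g\<close> given \<open>V\<close> is at most
    \<open>log 2 c\<close>.\<close>
  have B: "(\<Sum>w\<in>\<Omega>. 1 / (?gv w / ?v w)) \<le> c * real (card \<Omega>)"
  proof -
    have "(\<Sum>w\<in>\<Omega>. 1 / (?gv w / ?v w))
        = (\<Sum>u\<in>V ` \<Omega>. \<Sum>w\<in>{w \<in> \<Omega>. V w = u}. 1 / (?gv w / ?v w))"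
      by (rule sum.image_gen[OF fin(1)])
    also have "\<dots> \<le> (\<Sum>u\<in>V ` \<Omega>. c * real (card {w \<in> \<Omega>. V w = u}))"
    proof (rule sum_mono)
      fix u assume "u \<in> V ` \<Omega>"
      then obtain w0 where w0: "w0 \<in> \<Omega>" "u = V w0" by auto
      let ?U = "{w \<in> \<Omega>. V w = u}"
      have finU: "finite ?U" using fin by auto
      have "(\<Sum>w\<in>?U. 1 / (?gv w / ?v w)) = (\<Sum>w\<in>?U. ?v w0 / fibre_size ?U g w)"
      proof (rule sum.cong[OF refl])
        fix w assume w: "w \<in> ?U"
        have "{w' \<in> \<Omega>. (g w', V w') = (g w, V w)} = {w' \<in> ?U. g w' = g w}" using w by auto
        then have "?gv w = fibre_size ?U g w" unfolding fibre_size_def by simp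
        moreover have "?v w = ?v w0" using w w0 by (simp add: fibre_size_def)
        ultimately show "1 / (?gv w / ?v w) = ?v w0 / fibre_size ?U g w" by simp
      qed
      also have "\<dots> = real (card (g ` ?U)) * ?v w0"
        using sum_over_fibre_size[OF finU, of "\<lambda>_. ?v w0" g] by simp
      also have "\<dots> \<le> c * ?v w0"
        by (rule mult_right_mono) (use c[OF w0(1)] w0 in \<open>auto simp: fibre_size_def\<close>)
      finally show "(\<Sum>w\<in>?U. 1 / (?gv w / ?v w)) \<le> c * real (card ?U)" by (simp add: fibre_size_def w0)
    qed
    also have "\<dots> = (\<Sum>u\<in>V ` \<Omega>. \<Sum>w\<in>{w \<in> \<Omega>. V w = u}. c)" by (simp add: mult.commute)
    also have "\<dots> = (\<Sum>w\<in>\<Omega>. c)" by (rule sum.image_gen[OF fin(1), symmetric])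
    finally show ?thesis by (simp add: mult.commute)
  qed
  \<comment> \<open>The three logarithms average to the gain in mutual information with
    \<open>V\<close>, to minus the conditional entropy of \<open>g\<close> given \<open>V\<close>,
    and to the conditional entropy of \<open>f\<close> given \<open>V\<close>.\<close>
  have "uniform_entropy \<Omega> f - uniform_entropy \<Omega> g
      = (\<Sum>w\<in>\<Omega>. log 2 (?g w * ?fv w / (?f w * ?gv w)) + log 2 (?gv w / ?v w) + log 2 (?v w / ?fv w)) / real (card \<Omega>)"
    unfolding uniform_entropy_def diff_divide_distrib[symmetric] sum_subtractf[symmetric]
  proof (intro arg_cong2[where f = "(/)"] sum.cong refl)
    fix w assume w: "w \<in> \<Omega>"
    show "log 2 (real (card \<Omega>) / ?f w) - log 2 (real (card \<Omega>) / ?g w)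
      = log 2 (?g w * ?fv w / (?f w * ?gv w)) + log 2 (?gv w / ?v w) + log 2 (?v w / ?fv w)"
      using n pos[OF w, of f] pos[OF w, of g] pos[OF w, of V] pos[OF w, of "\<lambda>w. (f w, V w)"] pos[OF w, of "\<lambda>w. (g w, V w)"]
      by (simp add: log_divide log_mult)
  qed
  also have "\<dots> = (\<Sum>w\<in>\<Omega>. log 2 (?g w * ?fv w / (?f w * ?gv w))) / real (card \<Omega>)
      + (\<Sum>w\<in>\<Omega>. log 2 (?gv w / ?v w)) / real (card \<Omega>) + (\<Sum>w\<in>\<Omega>. log 2 (?v w / ?fv w)) / real (card \<Omega>)"
    by (simp add: sum.distrib add_divide_distrib)
  also have "\<dots> \<ge> - log 2 1 + - log 2 c + - log 2 e"
  proof (intro add_mono average_log_ge fin A B)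
    show "(\<Sum>w\<in>\<Omega>. 1 / (?v w / ?fv w)) \<le> e * real (card \<Omega>)" using e by simp
  qed (auto intro!: divide_pos_pos mult_pos_pos pos)
  finally show ?thesis by simp
qed

section \<open>Entropy increments for random linear combinations\<close>

text \<open>The normalised form of \<open>tree_embedding\<close>. Scales are counted from coarse to
  fine, so \<open>a\<close> is now the first scale at which two leaves differ, and they part at
  distance about \<open>2 powr (- a)\<close>.\<close>

definition scale_tree :: "nat set \<Rightarrow> (nat set \<Rightarrow> real) \<Rightarrow> bool" where
  "scale_tree S \<phi> \<longleftrightarrow> (\<forall>X Y a. X \<subseteq> S \<longrightarrow> Y \<subseteq> S \<longrightarrow> (a \<in> X) \<noteq> (a \<in> Y) \<longrightarrow> X \<inter> {..<a} = Y \<inter> {..<a} \<longrightarrow>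
     (1/2) ^ a / 4 \<le> \<bar>\<phi> X - \<phi> Y\<bar> \<and> \<bar>\<phi> X - \<phi> Y\<bar> \<le> (1/2) ^ a)"

lemma first_difference:
  fixes X Y :: "nat set"
  assumes "X \<noteq> Y"
  obtains a where "(a \<in> X) \<noteq> (a \<in> Y)" "X \<inter> {..<a} = Y \<inter> {..<a}"
proof -
  have ex: "\<exists>a. (a \<in> X) \<noteq> (a \<in> Y)" using assms by auto
  define a where "a = (LEAST a. (a \<in> X) \<noteq> (a \<in> Y))"
  have 1: "(a \<in> X) \<noteq> (a \<in> Y)" unfolding a_def using ex by (rule LeastI_ex)
  have 2: "(x \<in> X) = (x \<in> Y)" if "x < a" for x
    using not_less_Least[of x "\<lambda>a. (a \<in> X) \<noteq> (a \<in> Y)"] that unfolding a_def by blast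
  show ?thesis by (rule that[OF 1]) (use 2 in auto)
qed

lemma scale_tree_close:
  assumes "scale_tree S \<phi>" "X \<subseteq> S" "Y \<subseteq> S" "X \<inter> {..<p} = Y \<inter> {..<p}"
  shows "\<bar>\<phi> X - \<phi> Y\<bar> \<le> (1/2) ^ p"
proof (cases "X = Y")
  case False
  then obtain a where a: "(a \<in> X) \<noteq> (a \<in> Y)" "X \<inter> {..<a} = Y \<inter> {..<a}" by (rule first_difference)
  have "p \<le> a" using a(1) assms(4) by (metis Int_iff lessThan_iff not_le)
  then have "(1/2::real) ^ a \<le> (1/2) ^ p" by (intro power_decreasing) auto
  moreover have "\<bar>\<phi> X - \<phi> Y\<bar> \<le> (1/2) ^ a" using assms(1-3) a unfolding scale_tree_def by blast
  ultimately show ?thesis by linarith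
qed simp

lemma card_subsets_with_prefix:
  fixes S :: "nat set"
  assumes "finite S" "X \<subseteq> S"
  shows "card {Y \<in> Pow S. Y \<inter> {..<p} = X \<inter> {..<p}} = 2 ^ card (S \<inter> {p..})"
proof -
  have "bij_betw (\<lambda>Y. Y \<inter> {p..}) {Y \<in> Pow S. Y \<inter> {..<p} = X \<inter> {..<p}} (Pow (S \<inter> {p..}))"
  proof (rule bij_betw_byWitness[where f' = "\<lambda>Z. (X \<inter> {..<p}) \<union> Z"])
    show "\<forall>Y\<in>{Y \<in> Pow S. Y \<inter> {..<p} = X \<inter> {..<p}}. X \<inter> {..<p} \<union> Y \<inter> {p..} = Y"
    proof clarify
      fix Y assume "Y \<inter> {..<p} = X \<inter> {..<p}"
      then have "X \<inter> {..<p} \<union> Y \<inter> {p..} = Y \<inter> ({..<p} \<union> {p..})" by auto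
      also have "{..<p} \<union> {p..} = UNIV" by auto
      finally show "X \<inter> {..<p} \<union> Y \<inter> {p..} = Y" by simp
    qed
  qed (use assms(2) in auto)
  then have "card {Y \<in> Pow S. Y \<inter> {..<p} = X \<inter> {..<p}} = card (Pow (S \<inter> {p..}))"
    by (rule bij_betw_same_card)
  also have "\<dots> = 2 ^ card (S \<inter> {p..})" using assms(1) by (intro card_Pow) simp
  finally show ?thesis .
qed

text \<open>A uniform element of \<open>configs S I\<close> encodes independent uniform leaves of the tree, one for each
  index; \<open>known\<close> is the variable on which the entropies are conditioned.\<close>

definition configs :: "nat set \<Rightarrow> 'i set \<Rightarrow> ('i \<Rightarrow> nat set) set" where
  "configs S I = PiE I (\<lambda>_. Pow S)"

definition known :: "'i set \<Rightarrow> nat \<Rightarrow> 'i set \<Rightarrow> ('i \<Rightarrow> nat set) \<Rightarrow> 'i \<Rightarrow> nat set" where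
  "known I p J w = restrict (\<lambda>k. if k \<in> J then w k \<inter> {..<p} else w k) I"

definition weighted_point :: "'i set \<Rightarrow> (nat set \<Rightarrow> real) \<Rightarrow> ('i \<Rightarrow> real) \<Rightarrow> ('i \<Rightarrow> nat set) \<Rightarrow> real" where
  "weighted_point I \<phi> m w = (\<Sum>k\<in>I. m k * \<phi> (w k))"

definition scale_cell :: "'i set \<Rightarrow> (nat set \<Rightarrow> real) \<Rightarrow> nat \<Rightarrow> ('i \<Rightarrow> real) \<Rightarrow> ('i \<Rightarrow> nat set) \<Rightarrow> int" where
  "scale_cell I \<phi> q m w = \<lfloor>2 ^ q * weighted_point I \<phi> m w\<rfloor>"

lemma finite_configs: "finite S \<Longrightarrow> finite I \<Longrightarrow> finite (configs S I)"
  unfolding configs_def by (intro finite_PiE) auto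

lemma configs_nonempty: "configs S I \<noteq> {}"
  unfolding configs_def by (auto simp: PiE_eq_empty_iff)

lemma known_eq_iff:
  "known I p J w' = known I p J w \<longleftrightarrow>
    (\<forall>k\<in>I. (k \<in> J \<longrightarrow> w' k \<inter> {..<p} = w k \<inter> {..<p}) \<and> (k \<notin> J \<longrightarrow> w' k = w k))"
  unfolding known_def fun_eq_iff restrict_def by (smt (verit))

definition config_class where
  "config_class S I p J w = {w' \<in> configs S I. known I p J w' = known I p J w}"

lemma card_config_class:
  assumes "finite S" "finite I" "J \<subseteq> I" "w \<in> configs S I"
  shows "card (config_class S I p J w) = 2 ^ (card J * card (S \<inter> {p..}))"
proof -
  have w: "w k \<subseteq> S" if "k \<in> I" for k using assms(4) that by (auto simp: configs_def PiE_iff)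
  have "config_class S I p J w =
      PiE I (\<lambda>k. if k \<in> J then {Y \<in> Pow S. Y \<inter> {..<p} = w k \<inter> {..<p}} else {w k})"
  proof (rule set_eqI)
    fix w'
    have "w' k \<in> Pow S \<and> (k \<in> J \<longrightarrow> w' k \<inter> {..<p} = w k \<inter> {..<p}) \<and> (k \<notin> J \<longrightarrow> w' k = w k)
      \<longleftrightarrow> w' k \<in> (if k \<in> J then {Y \<in> Pow S. Y \<inter> {..<p} = w k \<inter> {..<p}} else {w k})" if "k \<in> I" for k
      using w[OF that] by auto
    then show "w' \<in> config_class S I p J w \<longleftrightarrow>
      w' \<in> PiE I (\<lambda>k. if k \<in> J then {Y \<in> Pow S. Y \<inter> {..<p} = w k \<inter> {..<p}} else {w k})"
      unfolding config_class_def configs_def mem_Collect_eq known_eq_iff PiE_iff by blast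
  qed
  then have "card (config_class S I p J w) =
      (\<Prod>k\<in>I. card (if k \<in> J then {Y \<in> Pow S. Y \<inter> {..<p} = w k \<inter> {..<p}} else {w k}))"
    by (simp only: card_PiE[OF assms(2)])
  also have "\<dots> = (\<Prod>k\<in>I. if k \<in> J then 2 ^ card (S \<inter> {p..}) else 1)"
    by (rule prod.cong) (use card_subsets_with_prefix[OF assms(1) w] in auto)
  also have "\<dots> = (\<Prod>k\<in>J. 2 ^ card (S \<inter> {p..}))"
  proof -
    have "I \<inter> J = J" using assms(3) by auto
    then show ?thesis using prod.inter_restrict[OF assms(2), of "\<lambda>_. 2 ^ card (S \<inter> {p..}) :: nat" J] by simp
  qed
  finally show ?thesis by (simp add: power_mult[symmetric] mult.commute)
qed

lemma class_subset: "y \<ge> p \<Longrightarrow> config_class S I y J w \<subseteq> config_class S I p J w"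
proof -
  assume "y \<ge> p"
  then have "{..<p} = {..<y} \<inter> {..<p}" by auto
  then have "A \<inter> {..<p} = B \<inter> {..<p}" if "A \<inter> {..<y} = B \<inter> {..<y}" for A B :: "nat set"
    using that by (metis Int_assoc)
  then show ?thesis unfolding config_class_def known_eq_iff by blast
qed

text \<open>Resample \<open>n\<close> leaves below their common prefixes of length \<open>p\<close>.
  The first term is the probability that none of them changes before \<open>q\<close>. A summand is
  the probability that none changes before \<open>a\<close>, times the bound \<open>\<psi> a\<close>
  for a collision when the first change is at \<open>a\<close>.\<close>

definition collision_bound :: "nat set \<Rightarrow> nat \<Rightarrow> nat \<Rightarrow> nat \<Rightarrow> (nat \<Rightarrow> real) \<Rightarrow> real" where
  "collision_bound S n p q \<psi> = (1/2) ^ (n * card (S \<inter> {p..<q})) +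
     (\<Sum>a\<in>S \<inter> {p..<q}. (1/2) ^ (n * card (S \<inter> {p..<a})) * \<psi> a)"

text \<open>The class is split according to the first scale \<open>a\<close> at which some leaf of
  \<open>w'\<close> with index in \<open>J\<close> departs from \<open>w\<close>. Those
  \<open>w'\<close> lie in the class with prefix length \<open>a\<close>, whose relative size is a
  power of 1/2, and \<open>P\<close> is at most \<open>\<psi> a\<close> on them.\<close>

lemma class_collision_bound:
  fixes P :: "('i \<Rightarrow> nat set) \<Rightarrow> real"
  assumes fin: "finite S" "finite I" "J \<subseteq> I" and w: "w \<in> configs S I" and pq: "p \<le> q"
    and \<psi>0: "\<And>a. \<psi> a \<ge> 0" and P1: "\<And>w'. 0 \<le> P w' \<and> P w' \<le> 1"
    and P: "\<And>a k w'. a \<in> S \<Longrightarrow> a < q \<Longrightarrow> w' \<in> config_class S I a J w \<Longrightarrow> k \<in> J \<Longrightarrow> (a \<in> w k) \<noteq> (a \<in> w' k) \<Longrightarrow> P w' \<le> \<psi> a"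
  shows "(\<Sum>w'\<in>config_class S I p J w. P w')
    \<le> collision_bound S (card J) p q \<psi> * real (card (config_class S I p J w))"
proof -
  let ?C = "\<lambda>y. config_class S I y J w"
  have finC: "finite (?C y)" for y unfolding config_class_def using finite_configs[OF fin(1,2)] by auto
  have sz: "real (card (?C y)) = (1/2) ^ (card J * card (S \<inter> {p..<y})) * real (card (?C p))" if "p \<le> y" for y
  proof -
    have "S \<inter> {p..} = (S \<inter> {p..<y}) \<union> (S \<inter> {y..})" using that by auto
    moreover have "(S \<inter> {p..<y}) \<inter> (S \<inter> {y..}) = {}" by auto
    ultimately have "card (S \<inter> {p..}) = card (S \<inter> {p..<y}) + card (S \<inter> {y..})"
      using fin(1) by (simp add: card_Un_disjoint)
    then show ?thesis
      by (simp add: card_config_class[OF fin w] add_mult_distrib2 power_add power_one_over)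
  qed
  have pt: "P w' \<le> of_bool (w' \<in> ?C q) + (\<Sum>a\<in>S \<inter> {p..<q}. of_bool (w' \<in> ?C a) * \<psi> a)" if w': "w' \<in> ?C p" for w'
  proof (cases "w' \<in> ?C q")
    case True
    have "(\<Sum>a\<in>S \<inter> {p..<q}. of_bool (w' \<in> ?C a) * \<psi> a) \<ge> 0" by (intro sum_nonneg) (simp add: \<psi>0)
    then show ?thesis using P1[of w'] True by simp
  next
    case False
    have w'c: "w' \<in> configs S I" "\<And>k. k \<in> I \<Longrightarrow> k \<notin> J \<Longrightarrow> w' k = w k"
      "\<And>k. k \<in> J \<Longrightarrow> w' k \<inter> {..<p} = w k \<inter> {..<p}"
      using w' fin(3) unfolding config_class_def mem_Collect_eq known_eq_iff by auto
    let ?d = "\<lambda>a. \<exists>k\<in>J. (a \<in> w k) \<noteq> (a \<in> w' k)"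
    have ex: "\<exists>a<q. ?d a"
    proof (rule ccontr)
      assume "\<not> ?thesis"
      then have "\<And>k. k \<in> J \<Longrightarrow> w' k \<inter> {..<q} = w k \<inter> {..<q}" by auto
      then have "w' \<in> ?C q" using w'c unfolding config_class_def mem_Collect_eq known_eq_iff by auto
      then show False using False by simp
    qed
    define a where "a = (LEAST a. ?d a)"
    from ex obtain a0 where a0: "a0 < q" "?d a0" by auto
    have da: "?d a" unfolding a_def using a0(2) by (rule LeastI)
    have aq: "a < q" using Least_le[of ?d, OF a0(2)] a0(1) unfolding a_def by linarith
    have nd: "\<not> ?d x" if "x < a" for x using not_less_Least[of x ?d] that unfolding a_def by blast
    obtain k where k: "k \<in> J" "(a \<in> w k) \<noteq> (a \<in> w' k)" using da by auto
    have ap: "p \<le> a" using w'c(3)[OF k(1)] k(2) by (metis Int_iff lessThan_iff not_le)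
    have aS: "a \<in> S" using k w w'c(1) fin(3) unfolding configs_def PiE_iff by auto
    have "\<And>k. k \<in> J \<Longrightarrow> w' k \<inter> {..<a} = w k \<inter> {..<a}" using nd by auto
    then have wa: "w' \<in> ?C a" using w'c unfolding config_class_def mem_Collect_eq known_eq_iff by auto
    have "P w' \<le> of_bool (w' \<in> ?C a) * \<psi> a" using P[OF aS aq wa k] wa by simp
    also have "\<dots> \<le> (\<Sum>a\<in>S \<inter> {p..<q}. of_bool (w' \<in> ?C a) * \<psi> a)"
      by (rule member_le_sum[where f = "\<lambda>a. of_bool (w' \<in> ?C a) * \<psi> a"]) (use aS ap aq fin(1) \<psi>0 in auto)
    finally show ?thesis using False by simp
  qed
  have cnt: "(\<Sum>w'\<in>?C p. of_bool (w' \<in> ?C y)) = real (card (?C y))" if "p \<le> y" for y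
  proof -
    have "?C p \<inter> ?C y = ?C y" using class_subset[OF that, of S I J w] by auto
    then show ?thesis using finC by (simp add: of_bool_def sum.If_cases Int_def[symmetric])
  qed
  have "(\<Sum>w'\<in>?C p. P w') \<le> (\<Sum>w'\<in>?C p. of_bool (w' \<in> ?C q) + (\<Sum>a\<in>S \<inter> {p..<q}. of_bool (w' \<in> ?C a) * \<psi> a))"
    by (rule sum_mono) (rule pt)
  also have "\<dots> = real (card (?C q)) + (\<Sum>a\<in>S \<inter> {p..<q}. (\<Sum>w'\<in>?C p. of_bool (w' \<in> ?C a)) * \<psi> a)"
    unfolding sum.distrib cnt[OF pq] sum_distrib_right by (simp only: sum.swap[of _ "?C p" "S \<inter> {p..<q}"])
  also have "\<dots> = real (card (?C q)) + (\<Sum>a\<in>S \<inter> {p..<q}. real (card (?C a)) * \<psi> a)"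
    by (intro arg_cong2[where f = "(+)"] sum.cong refl) (use cnt in auto)
  also have "\<dots> = collision_bound S (card J) p q \<psi> * real (card (?C p))"
  proof -
    have "(\<Sum>a\<in>S \<inter> {p..<q}. real (card (?C a)) * \<psi> a) =
        (\<Sum>a\<in>S \<inter> {p..<q}. ((1/2) ^ (card J * card (S \<inter> {p..<a})) * \<psi> a) * real (card (?C p)))"
    proof (rule sum.cong[OF refl])
      fix a assume "a \<in> S \<inter> {p..<q}"
      then have "p \<le> a" by simp
      from sz[OF this] show "real (card (?C a)) * \<psi> a =
          ((1/2) ^ (card J * card (S \<inter> {p..<a})) * \<psi> a) * real (card (?C p))"
        by (simp only: ac_simps)
    qed
    then show ?thesis unfolding collision_bound_def sz[OF pq] distrib_right sum_distrib_right by (simp only:)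
  qed
  finally show ?thesis .
qed

section \<open>Cells of different sizes\<close>

lemma card_floor_image_le:
  fixes h :: "'a \<Rightarrow> real"
  assumes "\<And>x. x \<in> A \<Longrightarrow> \<bar>h x - c\<bar> \<le> real n"
  shows "real (card ((\<lambda>x. \<lfloor>h x\<rfloor>) ` A)) \<le> 2 * real n + 2"
proof -
  have "(\<lambda>x. \<lfloor>h x\<rfloor>) ` A \<subseteq> {\<lfloor>c\<rfloor> - int n .. \<lfloor>c\<rfloor> + int n + 1}"
  proof clarify
    fix x assume "x \<in> A"
    from assms[OF this] have "c - real n \<le> h x" "h x \<le> c + real n" by auto
    moreover have "real_of_int \<lfloor>c\<rfloor> \<le> c" "c < real_of_int \<lfloor>c\<rfloor> + 1" by linarith+
    ultimately have "real_of_int (\<lfloor>c\<rfloor> - int n) \<le> h x" "h x < real_of_int (\<lfloor>c\<rfloor> + int n + 1) + 1"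
      unfolding of_int_diff of_int_add of_int_of_nat_eq of_int_1 by linarith+
    then show "\<lfloor>h x\<rfloor> \<in> {\<lfloor>c\<rfloor> - int n .. \<lfloor>c\<rfloor> + int n + 1}"
      unfolding atLeastAtMost_iff le_floor_iff by (simp add: floor_le_iff)
  qed
  from card_mono[OF _ this] have "card ((\<lambda>x. \<lfloor>h x\<rfloor>) ` A) \<le> 2 * n + 2" by simp
  then show ?thesis by linarith
qed

lemma floor_scale_mono:
  fixes x y :: real
  assumes "s \<le> q" "\<lfloor>2 ^ q * x\<rfloor> = \<lfloor>2 ^ q * y\<rfloor>"
  shows "\<lfloor>2 ^ s * x\<rfloor> = \<lfloor>2 ^ s * y\<rfloor>"
proof -
  have "\<lfloor>2 ^ s * z\<rfloor> = \<lfloor>2 ^ q * z\<rfloor> div 2 ^ (q - s)" for z :: real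
  proof -
    have "(2::real) ^ q = 2 ^ (q - s) * 2 ^ s" using assms(1) by (simp flip: power_add)
    then have "2 ^ s * z = (2 ^ q * z) / real_of_int (2 ^ (q - s))" by simp
    then show ?thesis by (simp only: floor_divide_real_eq_div zero_le_power zero_le_numeral)
  qed
  then show ?thesis using assms(2) by simp
qed

text \<open>\<open>small\<close> is a small-ball estimate in which the differences \<open>x\<close>
  are fixed and the multipliers \<open>m\<close> are random; it says nothing about an individual
  \<open>m\<close>. So \<open>entropy_increment\<close> is applied to each \<open>m\<close> with its
  own collision probability, and concavity of the logarithm lets only the mean of these
  probabilities matter.\<close>

lemma average_entropy_increment:
  fixes W :: "('i \<Rightarrow> real) \<Rightarrow> real"
  assumes fin: "finite S" "finite I" "J \<subseteq> I" and tree: "scale_tree S \<phi>"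
    and M: "finite M" "\<And>m. m \<in> M \<Longrightarrow> W m \<ge> 0" "sum W M = 1"
    and sq: "s \<le> q" and pq: "p \<le> q'"
    and size: "\<And>m k. m \<in> M \<Longrightarrow> k \<in> J \<Longrightarrow> \<bar>m k\<bar> * 2 ^ s \<le> 2 ^ p"
    and \<psi>0: "\<And>a. \<psi> a \<ge> 0"
    and small: "\<And>x a k. a \<in> S \<Longrightarrow> a < q' \<Longrightarrow> k \<in> J \<Longrightarrow> (1/2) ^ a / 4 \<le> \<bar>x k\<bar> \<Longrightarrow>
      (\<Sum>m\<in>M. W m * of_bool (\<bar>\<Sum>k\<in>I. m k * x k\<bar> < (1/2) ^ q)) \<le> \<psi> a"
  shows "(\<Sum>m\<in>M. W m * uniform_entropy (configs S I) (scale_cell I \<phi> q m))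
    \<ge> (\<Sum>m\<in>M. W m * uniform_entropy (configs S I) (scale_cell I \<phi> s m))
      - log 2 (collision_bound S (card J) p q' \<psi>) - log 2 (2 * real (card J) + 2)"
proof -
  let ?\<Omega> = "configs S I" and ?V = "known I p J" and ?f = "scale_cell I \<phi>"
  define e where "e = collision_bound S (card J) p q' \<psi>"
  \<comment> \<open>\<open>r m\<close> is the conditional collision probability of the cell at scale
    \<open>q\<close>, given \<open>known\<close>, for the fixed multipliers
    \<open>m\<close>.\<close>
  define r where "r = (\<lambda>m. (\<Sum>w\<in>?\<Omega>. fibre_size ?\<Omega> (\<lambda>w. (?f q m w, ?V w)) w / fibre_size ?\<Omega> ?V w) / real (card ?\<Omega>))"
  have f\<Omega>: "finite ?\<Omega>" "?\<Omega> \<noteq> {}" by (rule finite_configs[OF fin(1,2)]) (rule configs_nonempty)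
  have n\<Omega>: "real (card ?\<Omega>) > 0" using f\<Omega> by (simp add: card_gt_0_iff)
  have rpos: "r m > 0" for m
    unfolding r_def by (intro divide_pos_pos sum_pos f\<Omega> n\<Omega>) (auto intro!: divide_pos_pos fibre_size_pos f\<Omega>)
  have wS: "w k \<subseteq> S" if "w \<in> ?\<Omega>" "k \<in> I" for w k using that by (auto simp: configs_def PiE_iff)
  have step: "uniform_entropy ?\<Omega> (?f q m) \<ge> uniform_entropy ?\<Omega> (?f s m) - log 2 (r m) - log 2 (2 * real (card J) + 2)"
    if m: "m \<in> M" for m
  proof (rule entropy_increment[OF f\<Omega>, where V = ?V])
    fix w w' assume "w \<in> ?\<Omega>" "w' \<in> ?\<Omega>" "?f q m w = ?f q m w'"
    then show "?f s m w = ?f s m w'" unfolding scale_cell_def by (intro floor_scale_mono[OF sq])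
  next
    fix w assume w: "w \<in> ?\<Omega>"
    \<comment> \<open>Given \<open>known\<close>, each leaf in \<open>J\<close> is located up to
      \<open>2 powr (- p)\<close>. By \<open>size\<close> it moves the point by at most one cell of
      scale \<open>s\<close>, and the leaves outside \<open>J\<close> do not move at all.\<close>
    show "real (card (?f s m ` {w' \<in> ?\<Omega>. ?V w' = ?V w})) \<le> 2 * real (card J) + 2"
      unfolding scale_cell_def
    proof (rule card_floor_image_le)
      fix w' assume w': "w' \<in> {w' \<in> ?\<Omega>. ?V w' = ?V w}"
      have "weighted_point I \<phi> m w' - weighted_point I \<phi> m w = (\<Sum>k\<in>I. m k * (\<phi> (w' k) - \<phi> (w k)))"
        by (simp add: weighted_point_def sum_subtractf right_diff_distrib)
      also have "\<dots> = (\<Sum>k\<in>J. m k * (\<phi> (w' k) - \<phi> (w k)))"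
        by (rule sum.mono_neutral_right) (use fin w' known_eq_iff[of I p J w' w] in auto)
      finally have eq: "2 ^ s * weighted_point I \<phi> m w' - 2 ^ s * weighted_point I \<phi> m w
          = (\<Sum>k\<in>J. (m k * 2 ^ s) * (\<phi> (w' k) - \<phi> (w k)))"
        unfolding right_diff_distrib[symmetric] by (simp only:) (simp add: sum_distrib_left ac_simps)
      have "\<bar>\<Sum>k\<in>J. (m k * 2 ^ s) * (\<phi> (w' k) - \<phi> (w k))\<bar> \<le> (\<Sum>k\<in>J. 1)"
      proof (rule order.trans[OF sum_abs sum_mono])
        fix k assume k: "k \<in> J"
        then have kI: "k \<in> I" using fin by auto
        have "\<bar>\<phi> (w' k) - \<phi> (w k)\<bar> \<le> (1/2) ^ p"
          by (rule scale_tree_close[OF tree]) (use wS[OF w kI] wS[of w' k] kI w' k known_eq_iff[of I p J w' w] in auto)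
        then have "\<bar>m k\<bar> * 2 ^ s * \<bar>\<phi> (w' k) - \<phi> (w k)\<bar> \<le> 2 ^ p * (1/2) ^ p"
          by (intro mult_mono size[OF m k]) auto
        also have "(2::real) ^ p * (1/2) ^ p = 1" by (simp flip: power_mult_distrib)
        finally show "\<bar>m k * 2 ^ s * (\<phi> (w' k) - \<phi> (w k))\<bar> \<le> 1" by (simp add: abs_mult)
      qed
      then show "\<bar>2 ^ s * weighted_point I \<phi> m w' - 2 ^ s * weighted_point I \<phi> m w\<bar> \<le> real (card J)"
        unfolding eq by simp
    qed
  next
    show "(\<Sum>w\<in>?\<Omega>. fibre_size ?\<Omega> (\<lambda>w. (?f q m w, ?V w)) w / fibre_size ?\<Omega> ?V w) \<le> r m * real (card ?\<Omega>)"
      unfolding r_def using n\<Omega> by simp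
  qed
  \<comment> \<open>Exchange the sums: for a fixed pair \<open>w\<close>, \<open>w'\<close> the only
    randomness is in \<open>m\<close>, and \<open>small\<close> applies to the difference of the two
    configurations.\<close>
  have mean: "(\<Sum>m\<in>M. W m * r m) \<le> e"
  proof -
    have "(\<Sum>m\<in>M. W m * fibre_size ?\<Omega> (\<lambda>w. (?f q m w, ?V w)) w) \<le> e * fibre_size ?\<Omega> ?V w" if w: "w \<in> ?\<Omega>" for w
    proof -
      define P where "P = (\<lambda>w'. \<Sum>m\<in>M. W m * of_bool (?f q m w' = ?f q m w))"
      have finC: "finite (config_class S I p J w)" unfolding config_class_def using f\<Omega> by auto
      have fs: "fibre_size ?\<Omega> (\<lambda>w. (?f q m w, ?V w)) w
          = (\<Sum>w'\<in>config_class S I p J w. of_bool (?f q m w' = ?f q m w))" for m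
      proof -
        have "{w' \<in> ?\<Omega>. (?f q m w', ?V w') = (?f q m w, ?V w)} =
            config_class S I p J w \<inter> {w'. ?f q m w' = ?f q m w}" unfolding config_class_def by auto
        then show ?thesis unfolding fibre_size_def using finC by (simp add: of_bool_def sum.If_cases)
      qed
      have "(\<Sum>m\<in>M. W m * fibre_size ?\<Omega> (\<lambda>w. (?f q m w, ?V w)) w) = (\<Sum>w'\<in>config_class S I p J w. P w')"
        unfolding fs P_def sum_distrib_left by (rule sum.swap)
      also have "\<dots> \<le> e * real (card (config_class S I p J w))"
        unfolding e_def
      proof (rule class_collision_bound[OF fin w pq \<psi>0])
        fix w'
        have "P w' \<le> (\<Sum>m\<in>M. W m)" unfolding P_def by (rule sum_mono) (auto simp: M(2))
        moreover have "0 \<le> P w'" unfolding P_def by (rule sum_nonneg) (auto simp: M(2))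
        ultimately show "0 \<le> P w' \<and> P w' \<le> 1" using M(3) by simp
      next
        fix a k w' assume a: "a \<in> S" "a < q'" and w': "w' \<in> config_class S I a J w" and k: "k \<in> J" "(a \<in> w k) \<noteq> (a \<in> w' k)"
        define x where "x = (\<lambda>k. \<phi> (w' k) - \<phi> (w k))"
        have w'c: "w' \<in> ?\<Omega>" "w' k \<inter> {..<a} = w k \<inter> {..<a}"
          using w' k fin(3) unfolding config_class_def mem_Collect_eq known_eq_iff by auto
        have kI: "k \<in> I" using k fin by auto
        have x: "(1/2) ^ a / 4 \<le> \<bar>x k\<bar>"
          using tree wS[OF w kI] wS[OF w'c(1) kI] k(2) w'c(2) unfolding scale_tree_def x_def by metis
        have "P w' \<le> (\<Sum>m\<in>M. W m * of_bool (\<bar>\<Sum>k\<in>I. m k * x k\<bar> < (1/2) ^ q))"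
          unfolding P_def
        proof (intro sum_mono mult_left_mono M(2))
          fix m
          have "\<bar>\<Sum>k\<in>I. m k * x k\<bar> < (1/2) ^ q" if eq: "?f q m w' = ?f q m w"
          proof -
            have "\<bar>2 ^ q * weighted_point I \<phi> m w' - 2 ^ q * weighted_point I \<phi> m w\<bar> < 1"
              using eq unfolding scale_cell_def by linarith
            then have "2 ^ q * \<bar>weighted_point I \<phi> m w' - weighted_point I \<phi> m w\<bar> < 1"
              by (simp add: right_diff_distrib[symmetric] abs_mult)
            moreover have "weighted_point I \<phi> m w' - weighted_point I \<phi> m w = (\<Sum>k\<in>I. m k * x k)"
              by (simp add: weighted_point_def x_def sum_subtractf right_diff_distrib)
            ultimately show ?thesis by (simp add: field_simps)
          qed
          then show "of_bool (?f q m w' = ?f q m w) \<le> (of_bool (\<bar>\<Sum>k\<in>I. m k * x k\<bar> < (1/2) ^ q) :: real)" by simp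
        qed
        also have "\<dots> \<le> \<psi> a" by (rule small[where x = x and k = k, OF a k(1) x])
        finally show "P w' \<le> \<psi> a" .
      qed
      also have "real (card (config_class S I p J w)) = fibre_size ?\<Omega> ?V w" by (simp add: fibre_size_def config_class_def)
      finally show ?thesis .
    qed
    then have b: "(\<Sum>m\<in>M. W m * fibre_size ?\<Omega> (\<lambda>w. (?f q m w, ?V w)) w) / fibre_size ?\<Omega> ?V w \<le> e" if "w \<in> ?\<Omega>" for w
      using fibre_size_pos[OF f\<Omega>(1) that, of ?V] that by (simp add: divide_le_eq)
    have "(\<Sum>m\<in>M. W m * r m) = (\<Sum>w\<in>?\<Omega>. (\<Sum>m\<in>M. W m * fibre_size ?\<Omega> (\<lambda>w. (?f q m w, ?V w)) w) / fibre_size ?\<Omega> ?V w) / real (card ?\<Omega>)"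
      unfolding r_def sum_divide_distrib sum_distrib_left by (subst sum.swap) simp
    also have "\<dots> \<le> (\<Sum>w\<in>?\<Omega>. e) / real (card ?\<Omega>)"
      by (intro divide_right_mono sum_mono b) auto
    also have "\<dots> = e" using n\<Omega> by simp
    finally show ?thesis .
  qed
  have "(\<Sum>m\<in>M. W m * log 2 (r m)) \<le> log 2 (\<Sum>m\<in>M. W m * r m)"
    by (rule weighted_log_le[OF M(1) _ M(3)]) (auto simp: M(2) rpos)
  also have "\<dots> \<le> log 2 e"
  proof (rule log_mono[OF _ _ mean])
    obtain m where m: "m \<in> M" "W m > 0" by (rule positive_weight_exists[OF M(2,3)])
    show "0 < (\<Sum>m\<in>M. W m * r m)"
      by (rule sum_pos2[OF M(1) m(1)]) (auto intro!: mult_nonneg_nonneg M(2) less_imp_le[OF rpos] mult_pos_pos rpos m)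
  qed simp
  finally have L: "(\<Sum>m\<in>M. W m * log 2 (r m)) \<le> log 2 e" .
  have "(\<Sum>m\<in>M. W m * (uniform_entropy ?\<Omega> (?f s m) - log 2 (r m) - log 2 (2 * real (card J) + 2)))
      \<le> (\<Sum>m\<in>M. W m * uniform_entropy ?\<Omega> (?f q m))"
    by (intro sum_mono mult_left_mono step M(2))
  also have "(\<Sum>m\<in>M. W m * (uniform_entropy ?\<Omega> (?f s m) - log 2 (r m) - log 2 (2 * real (card J) + 2)))
     = (\<Sum>m\<in>M. W m * uniform_entropy ?\<Omega> (?f s m)) - (\<Sum>m\<in>M. W m * log 2 (r m)) - (\<Sum>m\<in>M. W m) * log 2 (2 * real (card J) + 2)"
    by (simp only: right_diff_distrib sum_subtractf sum_distrib_right)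
  finally show ?thesis using L M(3) unfolding e_def by simp
qed

section \<open>Entropy of long sums\<close>

text \<open>The proof runs from fine to coarse scales. A gap window \<open>[p, q)\<close> uses the largest admissible
  \<open>p\<close>; by maximality every \<open>[p, y)\<close> is dense enough for the gap estimate, while \<open>(p, q)\<close> is so sparse
  that counting its elements as part of the gap costs little.\<close>

lemma chain_bound:
  fixes h :: "nat \<Rightarrow> real" and S :: "nat set"
  assumes fin: "finite S" and g: "0 < g" "g \<le> 1" and N: "N \<ge> 1" and D: "D \<ge> 1" and C: "C \<ge> 0" and y0: "y0 \<ge> 0"
    and h0: "\<And>q. h q \<ge> 0"
    and low: "\<And>a. a \<in> S \<Longrightarrow> D \<le> a" and sep: "\<And>a b. a \<in> S \<Longrightarrow> b \<in> S \<Longrightarrow> a < b \<Longrightarrow> a + D \<le> b"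
    and fill: "\<And>a. a \<in> S \<Longrightarrow> a \<le> T \<Longrightarrow> h a \<ge> h (a - D) + real D - C"
    and gap: "\<And>p q. p \<in> S \<Longrightarrow> p \<le> q \<Longrightarrow> q \<le> T \<Longrightarrow>
       (\<And>y. p < y \<Longrightarrow> y \<le> q \<Longrightarrow> real N * real (card (S \<inter> {p..<y})) \<ge> g * (real y - real p)) \<Longrightarrow>
       h q \<ge> h p + g * (real q - real p) - C"
    and dense: "\<And>q. y0 \<le> real q \<Longrightarrow> q \<le> T \<Longrightarrow> real N * real (card (S \<inter> {..<q})) \<ge> g * real q"
    and S: "S \<subseteq> {..<T}"
  shows "h T \<ge> (1 - g) * real D * real (card S) + g * real T - real T * real D / real N
     - 2 * C * real (card S) - C - y0"
proof -
  \<comment> \<open>Each element of \<open>S\<close> is charged \<open>2 * C\<close>: once for its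
    own filling step and once for a gap ending just above the stretch it fills. The term
    \<open>q * D / N\<close> pays for the elements of \<open>S\<close> lying strictly inside
    gaps.\<close>
  define F where "F = (\<lambda>q. (1 - g) * real D * real (card (S \<inter> {..q})) + g * real q - real q * real D / real N
     - 2 * C * real (card (S \<inter> {..q})) - y0)"
  have below: "x \<le> a - D" if "x \<in> S" "a \<in> S" "x \<le> a" "x \<noteq> a" for x a
    using sep[OF that(1,2)] that(3,4) by linarith
  have cnt: "real D * real (card (S \<inter> {..q})) \<le> real q" for q
  proof (induction q rule: less_induct)
    case (less q)
    show ?case
    proof (cases "S \<inter> {..q} = {}")
      case False
      define m where "m = Max (S \<inter> {..q})"
      have "m \<in> S \<inter> {..q}" unfolding m_def using fin False by (intro Max_in) auto
      then have m: "m \<in> S" "m \<le> q" by auto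
      have mx: "x \<le> m" if "x \<in> S" "x \<le> q" for x unfolding m_def using fin that by (intro Max_ge) auto
      have "S \<inter> {..q} \<subseteq> insert m (S \<inter> {..m - D})"
        using mx below[OF _ m(1)] by auto
      then have "card (S \<inter> {..q}) \<le> card (insert m (S \<inter> {..m - D}))" by (rule card_mono[rotated]) (use fin in auto)
      also have "\<dots> \<le> Suc (card (S \<inter> {..m - D}))" by (simp add: card_insert_if fin)
      finally have "real D * real (card (S \<inter> {..q})) \<le> real D * (1 + real (card (S \<inter> {..m - D})))"
        by (intro mult_left_mono) auto
      also have "\<dots> \<le> real D + real (m - D)"
      proof -
        have "m - D < q" using m D low[OF m(1)] by linarith
        from less[OF this] show ?thesis by (simp add: distrib_left)
      qed
      also have "\<dots> \<le> real q" using low[OF m(1)] m by simp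
      finally show ?thesis .
    qed simp
  qed
  \<comment> \<open>The deficit \<open>C\<close> at \<open>q \<notin> S\<close> is the cost of the
    last gap; the next element of \<open>S\<close> absorbs it in its charge of
    \<open>2 * C\<close>.\<close>
  have "q \<le> T \<Longrightarrow> h q \<ge> F q - (if q \<in> S then 0 else C)" for q
  proof (induction q rule: less_induct)
    case (less q)
    show ?case
    proof (cases "q \<in> S")
      case True
      have Dq: "D \<le> q" by (rule low[OF True])
      have "S \<inter> {..q} = insert q (S \<inter> {..q - D})"
        using True below[OF _ True] by auto
      moreover have "q \<notin> S \<inter> {..q - D}" using D Dq by auto
      ultimately have c: "real (card (S \<inter> {..q})) = 1 + real (card (S \<inter> {..q - D}))" using fin by simp
      have "h (q - D) \<ge> F (q - D) - C"
      proof -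
        have "q - D < q" "q - D \<le> T" using D Dq less.prems by linarith+
        from less.IH[OF this] C show ?thesis by (simp split: if_splits)
      qed
      moreover have "F q = F (q - D) + real D - real D * real D / real N - 2 * C"
        unfolding F_def c using Dq
        by (simp add: of_nat_diff algebra_simps add_divide_distrib[symmetric] diff_divide_distrib[symmetric])
      moreover have "real D * real D / real N \<ge> 0" by simp
      moreover have "h q \<ge> h (q - D) + real D - C" by (rule fill[OF True less.prems])
      ultimately have "h q \<ge> F q" by linarith
      then show ?thesis using True by simp
    next
      case nS: False
      show ?thesis
      proof (cases "real q < y0 \<or> q = 0")
        case True
        have "(1 - g) * real D * real (card (S \<inter> {..q})) \<le> (1 - g) * real q"
          using cnt[of q] g by (simp add: mult.assoc mult_left_mono)
        moreover have "real q * real D / real N \<ge> 0" "2 * C * real (card (S \<inter> {..q})) \<ge> 0" using C by auto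
        ultimately have "F q \<le> (1 - g) * real q + g * real q - y0" unfolding F_def by linarith
        also have "\<dots> \<le> 0" using True y0 by (auto simp: algebra_simps)
        finally show ?thesis using h0[of q] C nS by simp
      next
        case False
        then have q: "y0 \<le> real q" "q > 0" by auto
        have d: "real N * real (card (S \<inter> {..<q})) \<ge> g * real q" by (rule dense[OF q(1) less.prems])
        define G where "G = {p \<in> S. p < q \<and> real N * real (card (S \<inter> {p..<q})) \<ge> g * (real q - real p)}"
        have "S \<inter> {..<q} \<noteq> {}"
        proof
          assume "S \<inter> {..<q} = {}"
          then have "g * real q \<le> 0" using d by simp
          then show False using g q by (simp add: mult_le_0_iff)
        qed
        then have "Min (S \<inter> {..<q}) \<in> S \<inter> {..<q}" using fin by (intro Min_in) auto
        moreover have "S \<inter> {Min (S \<inter> {..<q})..<q} = S \<inter> {..<q}" using fin by auto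
        moreover have "g * (real q - real (Min (S \<inter> {..<q}))) \<le> g * real q" using g by simp
        ultimately have "Min (S \<inter> {..<q}) \<in> G" using d unfolding G_def by auto
        then have Gne: "G \<noteq> {}" by auto
        have finG: "finite G" unfolding G_def using fin by auto
        define p where "p = Max G"
        have pG: "p \<in> G" unfolding p_def using finG Gne by (rule Max_in)
        have mx: "x \<le> p" if "x \<in> G" for x unfolding p_def using finG that by (rule Max_ge)
        have p: "p \<in> S" "p < q" "real N * real (card (S \<inter> {p..<q})) \<ge> g * (real q - real p)"
          using pG unfolding G_def by auto
        \<comment> \<open>If \<open>[y, q)\<close> were denser than this, its least element of
          \<open>S\<close> would belong to \<open>G\<close> and exceed the maximum
          \<open>p\<close>.\<close>
        have later: "real N * real (card (S \<inter> {y..<q})) \<le> g * (real q - real y)" if y: "p < y" "y \<le> q" for y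
        proof (rule ccontr)
          assume a: "\<not> ?thesis"
          have "g * (real q - real y) \<ge> 0" using g y by simp
          then have ne: "S \<inter> {y..<q} \<noteq> {}" using a by auto
          define z where "z = Min (S \<inter> {y..<q})"
          have z: "z \<in> S \<inter> {y..<q}" unfolding z_def using fin ne by (intro Min_in) auto
          have "S \<inter> {z..<q} = S \<inter> {y..<q}" unfolding z_def using fin z[unfolded z_def] by auto
          moreover have "g * (real q - real z) \<le> g * (real q - real y)" using g z by simp
          ultimately have "z \<in> G" using a z unfolding G_def by auto
          from mx[OF this] z y show False by auto
        qed
        have split: "real (card (S \<inter> {p..<q})) = real (card (S \<inter> {p..<y})) + real (card (S \<inter> {y..<q}))"
          if "p < y" "y \<le> q" for y
        proof -
          have "S \<inter> {p..<q} = (S \<inter> {p..<y}) \<union> (S \<inter> {y..<q})" using that by auto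
          moreover have "(S \<inter> {p..<y}) \<inter> (S \<inter> {y..<q}) = {}" by auto
          ultimately show ?thesis using fin by (simp add: card_Un_disjoint)
        qed
        have "h q \<ge> h p + g * (real q - real p) - C"
        proof (rule gap[OF p(1) less_imp_le[OF p(2)] less.prems])
          fix y assume y: "p < y" "y \<le> q"
          have "real N * real (card (S \<inter> {p..<q})) = real N * real (card (S \<inter> {p..<y})) + real N * real (card (S \<inter> {y..<q}))"
            unfolding split[OF y] by (rule distrib_left)
          then have "real N * real (card (S \<inter> {p..<y})) \<ge> g * (real q - real p) - g * (real q - real y)"
            using later[OF y] p(3) by linarith
          then show "real N * real (card (S \<inter> {p..<y})) \<ge> g * (real y - real p)" by (simp add: algebra_simps)
        qed
        moreover have "h p \<ge> F p" using less.IH[OF p(2)] p less.prems by simp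
        moreover have "F q \<le> F p + g * (real q - real p)"
        proof -
          define x where "x = real (card (S \<inter> {Suc p..<q}))"
          have "S \<inter> {..q} = (S \<inter> {..p}) \<union> (S \<inter> {Suc p..<q})" using p nS by (auto simp: le_less)
          moreover have "(S \<inter> {..p}) \<inter> (S \<inter> {Suc p..<q}) = {}" by auto
          ultimately have c: "real (card (S \<inter> {..q})) = real (card (S \<inter> {..p})) + x"
            using fin by (simp add: card_Un_disjoint x_def)
          have "real N * x \<le> g * (real q - real (Suc p))" unfolding x_def by (rule later) (use p in auto)
          also have "\<dots> \<le> 1 * (real q - real p)" using g p by (intro mult_mono) auto
          finally have "x \<le> (real q - real p) / real N" using N by (simp add: field_simps)
          then have "((1 - g) * real D) * x \<le> (1 * real D) * ((real q - real p) / real N)"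
            using g p by (intro mult_mono) (auto simp: x_def)
          moreover have "2 * C * x \<ge> 0" using C by (simp add: x_def)
          moreover have "real D * ((real q - real p) / real N) = real q * real D / real N - real p * real D / real N"
            by (simp add: diff_divide_distrib algebra_simps)
          ultimately show ?thesis unfolding F_def c by (simp add: algebra_simps)
        qed
        ultimately show ?thesis using nS by simp
      qed
    qed
  qed
  from this[of T] have "h T \<ge> F T - (if T \<in> S then 0 else C)" by simp
  moreover have "T \<notin> S" "S \<inter> {..T} = S" using S by auto
  ultimately show ?thesis unfolding F_def by simp
qed

section \<open>Independent multipliers\<close>

lemma sum_PiE_coordinate:
  assumes "finite I" "k \<in> I"
  shows "(\<Sum>m\<in>PiE I A. f m) = (\<Sum>u\<in>A k. \<Sum>m\<in>PiE (I - {k}) A. f (m(k := u)))"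
proof -
  have I: "I = insert k (I - {k})" using assms by auto
  have "PiE I A = (\<lambda>(u, m). m(k := u)) ` (A k \<times> PiE (I - {k}) A)"
    by (subst I) (rule PiE_insert_eq)
  then have "(\<Sum>m\<in>PiE I A. f m) = (\<Sum>x\<in>A k \<times> PiE (I - {k}) A. f ((\<lambda>(u, m). m(k := u)) x))"
    using sum.reindex[OF inj_combinator[of k "I - {k}" A], of f] by (simp add: comp_def)
  also have "\<dots> = (\<Sum>u\<in>A k. \<Sum>m\<in>PiE (I - {k}) A. f (m(k := u)))"
    by (simp add: sum.cartesian_product case_prod_unfold)
  finally show ?thesis .
qed

lemma product_weight_total:
  fixes w :: "'i \<Rightarrow> 'a \<Rightarrow> real"
  assumes "finite I" "\<And>k. k \<in> I \<Longrightarrow> finite (A k)" "\<And>k. k \<in> I \<Longrightarrow> sum (w k) (A k) = 1"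
  shows "(\<Sum>m\<in>PiE I A. \<Prod>k\<in>I. w k (m k)) = 1"
  using prod_sum_PiE[of I A w] assms by simp

lemma product_weight_coordinate_bound:
  fixes w :: "'i \<Rightarrow> 'a \<Rightarrow> real"
  assumes fin: "finite I" "\<And>k. k \<in> I \<Longrightarrow> finite (A k)" and one: "\<And>k. k \<in> I \<Longrightarrow> sum (w k) (A k) = 1"
    and pos: "\<And>k u. k \<in> I \<Longrightarrow> u \<in> A k \<Longrightarrow> w k u \<ge> 0" and k: "k \<in> I"
    and le: "\<And>m. (\<Sum>u\<in>A k. w k u * of_bool (P (m(k := u)))) \<le> b"
  shows "(\<Sum>m\<in>PiE I A. (\<Prod>k\<in>I. w k (m k)) * of_bool (P m)) \<le> b"
proof -
  have pr: "(\<Prod>j\<in>I. w j ((m(k := u)) j)) = w k u * (\<Prod>j\<in>I - {k}. w j (m j))" for m u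
  proof -
    have "(\<Prod>j\<in>I. w j ((m(k := u)) j)) = w k u * (\<Prod>j\<in>I - {k}. w j ((m(k := u)) j))"
      using prod.remove[OF fin(1) k, of "\<lambda>j. w j ((m(k := u)) j)"] by simp
    also have "(\<Prod>j\<in>I - {k}. w j ((m(k := u)) j)) = (\<Prod>j\<in>I - {k}. w j (m j))" by (rule prod.cong) auto
    finally show ?thesis .
  qed
  have "(\<Sum>m\<in>PiE I A. (\<Prod>k\<in>I. w k (m k)) * of_bool (P m))
     = (\<Sum>m\<in>PiE (I - {k}) A. \<Sum>u\<in>A k. w k u * (\<Prod>j\<in>I - {k}. w j (m j)) * of_bool (P (m(k := u))))"
    unfolding sum_PiE_coordinate[OF fin(1) k] pr by (rule sum.swap)
  also have "\<dots> = (\<Sum>m\<in>PiE (I - {k}) A. (\<Prod>j\<in>I - {k}. w j (m j)) * (\<Sum>u\<in>A k. w k u * of_bool (P (m(k := u)))))"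
    by (simp add: sum_distrib_left ac_simps)
  also have "\<dots> \<le> (\<Sum>m\<in>PiE (I - {k}) A. (\<Prod>j\<in>I - {k}. w j (m j)) * b)"
    by (intro sum_mono mult_left_mono le prod_nonneg) (use pos in \<open>auto simp: PiE_iff\<close>)
  also have "\<dots> = (\<Sum>m\<in>PiE (I - {k}) A. \<Prod>j\<in>I - {k}. w j (m j)) * b" by (simp add: sum_distrib_right)
  also have "\<dots> = b" by (subst product_weight_total) (use fin one in auto)
  finally show ?thesis .
qed

text \<open>The exponents are pairwise distinct, since each element of \<open>S\<close> raises the
  count, so the sum is part of a geometric series.\<close>

lemma sum_halves_count_le:
  fixes S :: "nat set"
  assumes "finite S"
  shows "(\<Sum>a\<in>S \<inter> {p..<q}. (1/2::real) ^ card (S \<inter> {p..<a})) \<le> 2"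
proof -
  let ?c = "\<lambda>a. card (S \<inter> {p..<a})"
  have lt: "?c a < ?c b" if "a \<in> S \<inter> {p..<q}" "a < b" for a b
    by (rule psubset_card_mono) (use assms that in auto)
  have inj: "inj_on ?c (S \<inter> {p..<q})"
    by (rule inj_onI) (metis lt linorder_neqE_nat less_irrefl)
  have "(\<Sum>a\<in>S \<inter> {p..<q}. (1/2::real) ^ ?c a) = (\<Sum>j\<in>?c ` (S \<inter> {p..<q}). (1/2) ^ j)"
    using sum.reindex[OF inj, of "\<lambda>j. (1/2::real) ^ j"] by (simp add: comp_def)
  also have "\<dots> \<le> (\<Sum>j. (1/2::real) ^ j)"
    by (rule sum_le_suminf) (use assms in auto)
  also have "\<dots> = 2" using suminf_geometric[of "1/2::real"] by simp
  finally show ?thesis .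
qed


lemma card_naturals_near:
  "card {u \<in> real ` {..<M}. \<bar>u - c\<bar> < 4} \<le> 9"
proof -
  have "{u \<in> real ` {..<M}. \<bar>u - c\<bar> < 4} \<subseteq> real_of_int ` {\<lceil>c - 4\<rceil>..\<lfloor>c + 4\<rfloor>}"
  proof clarify
    fix i assume "\<bar>real i - c\<bar> < 4"
    then have "\<lceil>c - 4\<rceil> \<le> int i" "int i \<le> \<lfloor>c + 4\<rfloor>" unfolding ceiling_le_iff le_floor_iff by auto
    then have "int i \<in> {\<lceil>c - 4\<rceil>..\<lfloor>c + 4\<rfloor>}" by simp
    then show "real i \<in> real_of_int ` {\<lceil>c - 4\<rceil>..\<lfloor>c + 4\<rfloor>}" by (intro image_eqI[of _ _ "int i"]) auto
  qed
  then have "card {u \<in> real ` {..<M}. \<bar>u - c\<bar> < 4} \<le> card (real_of_int ` {\<lceil>c - 4\<rceil>..\<lfloor>c + 4\<rfloor>})"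
    by (rule card_mono[rotated]) simp
  also have "\<dots> \<le> card {\<lceil>c - 4\<rceil>..\<lfloor>c + 4\<rfloor>}" by (rule card_image_le) simp
  also have "\<dots> \<le> 9" by (simp, linarith)
  finally show ?thesis .
qed

text \<open>The first \<open>n\<close> multipliers are uniform integers below \<open>2 ^ D\<close>
  and drive the filling steps of \<open>chain_bound\<close>; the last \<open>n\<close> have law
  \<open>\<mu>\<close> and drive the gaps. In each step the leaves of the other kind are simply
  conditioned on.\<close>

lemma long_sum_entropy:
  fixes S :: "nat set" and \<mu> :: "real \<Rightarrow> real"
  assumes fin: "finite S" and tree: "scale_tree S \<phi>" and ST: "S \<subseteq> {..<T}"
    and D: "D \<ge> 1" and low: "\<And>a. a \<in> S \<Longrightarrow> D \<le> a"
    and sep: "\<And>a b. a \<in> S \<Longrightarrow> b \<in> S \<Longrightarrow> a < b \<Longrightarrow> a + D \<le> b"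
    and g: "0 < g" "g \<le> 1" and N: "N \<ge> 1" "N + 1 \<ge> D" and y0: "y0 \<ge> 0"
    and U: "finite U" "U \<subseteq> {0..1}" and \<mu>: "\<And>t. t \<in> U \<Longrightarrow> \<mu> t \<ge> 0" "sum \<mu> U = 1"
    and frostman: "\<And>v r. r \<ge> (1/2) ^ T \<Longrightarrow> (\<Sum>t\<in>U. \<mu> t * of_bool (\<bar>t - v\<bar> < r)) \<le> (2 * r) powr g"
    and dense: "\<And>q. y0 \<le> real q \<Longrightarrow> q \<le> T \<Longrightarrow> real N * real (card (S \<inter> {..<q})) \<ge> g * real q"
  defines "n \<equiv> N + 1"
  defines "C \<equiv> log 2 17 + log 2 (2 * real n + 2)"
  shows "\<exists>m. (\<forall>k<n. \<exists>i<2 ^ D. m k = real i) \<and> (\<forall>k\<in>{n..<2 * n}. m k \<in> U) \<and>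
    log 2 (real (card (scale_cell {..<2 * n} \<phi> T m ` configs S {..<2 * n})))
      \<ge> (1 - g) * real D * real (card S) + g * real T - real T * real D / real N
         - 2 * C * real (card S) - C - y0"
proof -
  define I where "I = {..<2 * n}"
  define A where "A = (\<lambda>k::nat. if k < n then real ` {..<2 ^ D} else U)"
  define w where "w = (\<lambda>(k::nat) u. if k < n then (1/2) ^ D else \<mu> u)"
  define M where "M = PiE I A"
  define W where "W = (\<lambda>m. \<Prod>k\<in>I. w k (m k))"
  define h where "h = (\<lambda>q. \<Sum>m\<in>M. W m * uniform_entropy (configs S I) (scale_cell I \<phi> q m))"
  have finI: "finite I" by (simp add: I_def)
  have finA: "finite (A k)" for k using U by (simp add: A_def)
  have one: "sum (w k) (A k) = 1" for k
    using \<mu>(2) by (simp add: A_def w_def card_image inj_on_def power_one_over)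
  have wpos: "w k u \<ge> 0" if "u \<in> A k" for k u using \<mu>(1) that by (auto simp: w_def A_def split: if_splits)
  have finM: "finite M" unfolding M_def by (rule finite_PiE[OF finI finA])
  have Wpos: "W m \<ge> 0" if "m \<in> M" for m
    unfolding W_def by (rule prod_nonneg) (use that wpos in \<open>auto simp: M_def PiE_iff\<close>)
  have W1: "sum W M = 1" unfolding W_def M_def by (rule product_weight_total) (use finI finA one in auto)
  have C0: "C \<ge> 0" unfolding C_def by simp
  have small: "(\<Sum>m\<in>M. W m * of_bool (\<bar>\<Sum>k\<in>I. m k * x k\<bar> < r)) \<le> b"
    if k: "k \<in> I" and b: "\<And>v. (\<Sum>u\<in>A k. w k u * of_bool (\<bar>u * x k + v\<bar> < r)) \<le> b" for x k r b
    unfolding M_def W_def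
  proof (rule product_weight_coordinate_bound[OF finI finA one wpos k])
    fix m
    have eq: "(\<Sum>j\<in>I. (m(k := u)) j * x j) = u * x k + (\<Sum>j\<in>I - {k}. m j * x j)" for u
    proof -
      have "(\<Sum>j\<in>I. (m(k := u)) j * x j) = u * x k + (\<Sum>j\<in>I - {k}. (m(k := u)) j * x j)"
        using sum.remove[OF finI k, of "\<lambda>j. (m(k := u)) j * x j"] by simp
      also have "(\<Sum>j\<in>I - {k}. (m(k := u)) j * x j) = (\<Sum>j\<in>I - {k}. m j * x j)" by (rule sum.cong) auto
      finally show ?thesis .
    qed
    show "(\<Sum>u\<in>A k. w k u * of_bool (\<bar>\<Sum>j\<in>I. (m(k := u)) j * x j\<bar> < r)) \<le> b"
      unfolding eq by (rule b)
  qed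
  have shift: "\<bar>u * y + v\<bar> < r \<longleftrightarrow> \<bar>u - (- v / y)\<bar> < r / \<bar>y\<bar>" if "y \<noteq> 0" for u y v r :: real
  proof -
    have "u - (- v / y) = (u * y + v) / y" using that by (simp add: field_simps)
    then show ?thesis using that by (simp add: abs_divide divide_less_cancel)
  qed
  \<comment> \<open>Only the scale \<open>a\<close> itself is resampled, so
    \<open>q' = a + 1\<close>. A difference at least \<open>2 powr (- a) / 4\<close> leaves at most
    9 of the \<open>2 ^ D\<close> values of its multiplier for which two sums share a cell at scale
    \<open>a\<close>; this yields the gain of \<open>D\<close> bits.\<close>
  have fill: "h a \<ge> h (a - D) + real D - C" if a: "a \<in> S" "a \<le> T" for a
  proof -
    have "h a \<ge> h (a - D) - log 2 (collision_bound S (card {..<n}) a (a + 1) (\<lambda>_. 9 / 2 ^ D))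
      - log 2 (2 * real (card {..<n}) + 2)"
      unfolding h_def
    proof (rule average_entropy_increment[OF fin finI _ tree finM Wpos W1])
      show "{..<n} \<subseteq> I" by (auto simp: I_def)
      fix m k assume m: "m \<in> M" and k: "k \<in> {..<n}"
      then have "m k \<in> A k" by (auto simp: M_def PiE_iff I_def)
      then obtain i where i: "m k = real i" "i < 2 ^ D" using k by (auto simp: A_def)
      then have "\<bar>m k\<bar> \<le> 2 ^ D" by (metis abs_of_nat less_imp_le of_nat_less_numeral_power_cancel_iff)
      then have "\<bar>m k\<bar> * 2 ^ (a - D) \<le> 2 ^ D * 2 ^ (a - D)" by (rule mult_right_mono) simp
      also have "\<dots> = (2::real) ^ a" using low[OF a(1)] by (simp flip: power_add)
      finally show "\<bar>m k\<bar> * 2 ^ (a - D) \<le> 2 ^ a" .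
    next
      fix x :: "nat \<Rightarrow> real" and a' k assume h: "a' < a + 1" "k \<in> {..<n}" "(1/2) ^ a' / 4 \<le> \<bar>x k\<bar>"
      have "(1/2::real) ^ a \<le> (1/2) ^ a'" using h by (intro power_decreasing) auto
      then have xk: "(1/2) ^ a / 4 \<le> \<bar>x k\<bar>" using h(3) by linarith
      moreover have "(0::real) < (1/2) ^ a" by simp
      ultimately have x0: "x k \<noteq> 0" by (auto simp del: zero_less_power)
      have r: "(1/2) ^ a / \<bar>x k\<bar> \<le> 4" using xk x0 by (simp add: divide_le_eq)
      show "(\<Sum>m\<in>M. W m * of_bool (\<bar>\<Sum>k\<in>I. m k * x k\<bar> < (1/2) ^ a)) \<le> 9 / 2 ^ D"
      proof (rule small[of k])
        show "k \<in> I" using h by (auto simp: I_def)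
        fix v
        have Ak: "A k = real ` {..<2 ^ D}" using h by (simp add: A_def)
        have "(\<Sum>u\<in>A k. w k u * of_bool (\<bar>u * x k + v\<bar> < (1/2) ^ a))
          \<le> (\<Sum>u\<in>A k. (1/2) ^ D * of_bool (\<bar>u - (- v / x k)\<bar> < 4))"
          unfolding shift[OF x0] using h r by (intro sum_mono) (auto simp: w_def)
        also have "\<dots> = (1/2) ^ D * real (card {u \<in> real ` {..<2 ^ D}. \<bar>u - (- v / x k)\<bar> < 4})"
          unfolding sum_distrib_left[symmetric] Ak by (simp add: of_bool_def sum.If_cases Int_def)
        also have "\<dots> \<le> (1/2) ^ D * 9"
          using card_naturals_near[of "2 ^ D" "- v / x k"] by (intro mult_left_mono) auto
        finally show "(\<Sum>u\<in>A k. w k u * of_bool (\<bar>u * x k + v\<bar> < (1/2) ^ a)) \<le> 9 / 2 ^ D"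
          by (simp add: power_one_over)
      qed
    qed auto
    moreover have "log 2 (collision_bound S (card {..<n}) a (a + 1) (\<lambda>_. 9 / 2 ^ D)) \<le> log 2 17 - real D"
    proof -
      have "S \<inter> {a..<a + 1} = {a}" using a by auto
      then have "collision_bound S (card {..<n}) a (a + 1) (\<lambda>_. 9 / 2 ^ D) = (1/2) ^ n + 9 / 2 ^ D"
        by (simp add: collision_bound_def)
      also have "\<dots> \<le> 1 / 2 ^ D + 9 / 2 ^ D"
      proof (intro add_right_mono)
        have "(1/2::real) ^ n \<le> (1/2) ^ D" unfolding n_def by (rule power_decreasing[OF N(2)]) auto
        then show "(1/2::real) ^ n \<le> 1 / 2 ^ D" by (simp add: power_one_over)
      qed
      \<comment> \<open>Here 10 would do; 17 = 1 + 2 * 8 is what the gap estimate gives, and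
        \<open>C\<close> serves both.\<close>
      also have "\<dots> \<le> 17 / 2 ^ D" by (simp add: field_simps)
      finally have "log 2 (collision_bound S (card {..<n}) a (a + 1) (\<lambda>_. 9 / 2 ^ D)) \<le> log 2 (17 / 2 ^ D)"
        by (intro log_mono) (auto intro!: add_pos_nonneg sum_nonneg simp: collision_bound_def)
      then show ?thesis by (simp add: log_divide log_nat_power)
    qed
    ultimately show ?thesis unfolding C_def by simp
  qed
  have gap: "h q \<ge> h p + g * (real q - real p) - C"
    if p: "p \<in> S" "p \<le> q" "q \<le> T"
      and dn: "\<And>y. p < y \<Longrightarrow> y \<le> q \<Longrightarrow> real N * real (card (S \<inter> {p..<y})) \<ge> g * (real y - real p)" for p q
  proof -
    define J where "J = {n..<2 * n}"
    \<comment> \<open>A difference at least \<open>2 powr (- a) / 4\<close> confines its multiplier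
      to an interval of radius \<open>4 * 2 powr (a - q)\<close>. \<open>frostman\<close> doubles
      the radius, and 8 powr g is at most 8.\<close>
    define \<psi> where "\<psi> = (\<lambda>a. 8 * 2 powr (g * (real a - real q)))"
    have cJ: "card J = n" by (simp add: J_def)
    have "h q \<ge> h p - log 2 (collision_bound S (card J) p q \<psi>)
      - log 2 (2 * real (card J) + 2)"
      unfolding h_def
    proof (rule average_entropy_increment[OF fin finI _ tree finM Wpos W1 p(2) p(2)])
      show "J \<subseteq> I" by (auto simp: I_def J_def)
      show "\<psi> a \<ge> 0" for a by (simp add: \<psi>_def)
      fix m k assume m: "m \<in> M" and k: "k \<in> J"
      then have "m k \<in> A k" by (auto simp: M_def PiE_iff I_def J_def)
      then have "m k \<in> {0..1}" using U k by (auto simp: A_def J_def)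
      then show "\<bar>m k\<bar> * 2 ^ p \<le> 2 ^ p" by simp
    next
      fix x :: "nat \<Rightarrow> real" and a k assume h: "a < q" "k \<in> J" "(1/2) ^ a / 4 \<le> \<bar>x k\<bar>"
      have "(0::real) < (1/2) ^ a" by simp
      then have x0: "x k \<noteq> 0" using h(3) by (auto simp del: zero_less_power)
      define r :: real where "r = 4 * (1/2) ^ (q - a)"
      have "(1/2) ^ q / \<bar>x k\<bar> \<le> (1/2) ^ q / ((1/2) ^ a / 4)" using h(3) x0 by (intro divide_left_mono) (auto intro!: mult_pos_pos)
      also have "\<dots> = r" using h(1) by (simp add: r_def power_diff)
      finally have r: "(1/2) ^ q / \<bar>x k\<bar> \<le> r" .
      have "(1/2::real) ^ T \<le> (1/2) ^ (q - a)" using p(3) by (intro power_decreasing) auto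
      then have rT: "r \<ge> (1/2) ^ T" unfolding r_def using zero_le_power[of "1/2::real" "q - a"] by linarith
      show "(\<Sum>m\<in>M. W m * of_bool (\<bar>\<Sum>k\<in>I. m k * x k\<bar> < (1/2) ^ q)) \<le> \<psi> a"
      proof (rule small[of k])
        show "k \<in> I" using h by (auto simp: I_def J_def)
        fix v
        have Ak: "A k = U" and wk: "w k = \<mu>" using h by (auto simp: A_def w_def J_def)
        have "(\<Sum>u\<in>A k. w k u * of_bool (\<bar>u * x k + v\<bar> < (1/2) ^ q))
          \<le> (\<Sum>u\<in>U. \<mu> u * of_bool (\<bar>u - (- v / x k)\<bar> < r))"
          unfolding shift[OF x0] Ak wk using r \<mu>(1) by (intro sum_mono mult_left_mono) auto
        also have "\<dots> \<le> (2 * r) powr g" by (rule frostman[OF rT])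
        also have "2 * r = 8 * 2 powr (real a - real q)"
          using h(1) by (simp add: r_def powr_realpow[symmetric] powr_diff power_one_over of_nat_diff powr_minus field_simps)
        also have "(8 * 2 powr (real a - real q)) powr g = 8 powr g * 2 powr (g * (real a - real q))"
          by (simp add: powr_mult powr_powr mult.commute)
        also have "\<dots> \<le> 8 powr 1 * 2 powr (g * (real a - real q))"
          using g by (intro mult_right_mono powr_mono) auto
        finally show "(\<Sum>u\<in>A k. w k u * of_bool (\<bar>u * x k + v\<bar> < (1/2) ^ q)) \<le> \<psi> a"
          by (simp add: \<psi>_def)
      qed
    qed
    moreover have "log 2 (collision_bound S (card J) p q \<psi>) \<le> log 2 17 - g * (real q - real p)"
    proof -
      have half: "(1/2::real) ^ k = 2 powr (- real k)" for k :: nat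
        by (simp add: powr_minus powr_realpow power_one_over inverse_eq_divide)
      \<comment> \<open>Of the \<open>n = N + 1\<close> leaves, \<open>N\<close> pay for the decay
        \<open>2 powr (- g * (y - p))\<close>. The remaining one leaves a factor that makes the sum
        over \<open>a\<close> geometric.\<close>
      have key: "(1/2::real) ^ (card J * card (S \<inter> {p..<y})) \<le> (1/2) ^ card (S \<inter> {p..<y}) * 2 powr (- g * (real y - real p))"
        if y: "p \<le> y" "y \<le> q" for y
      proof -
        have "real N * real (card (S \<inter> {p..<y})) \<ge> g * (real y - real p)"
          using dn[of y] y by (cases "p = y") auto
        then have "2 powr (- (real N * real (card (S \<inter> {p..<y})))) \<le> 2 powr (- g * (real y - real p))"
          by (intro powr_mono) auto
        then have "(1/2) ^ card (S \<inter> {p..<y}) * 2 powr (- (real N * real (card (S \<inter> {p..<y}))))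
            \<le> (1/2) ^ card (S \<inter> {p..<y}) * 2 powr (- g * (real y - real p))"
          by (rule mult_left_mono) simp
        moreover have "(1/2::real) ^ (card J * card (S \<inter> {p..<y})) =
            (1/2) ^ card (S \<inter> {p..<y}) * 2 powr (- (real N * real (card (S \<inter> {p..<y}))))"
          by (simp add: cJ n_def power_add half[of "N * _"] del: power_one_over)
        ultimately show ?thesis by simp
      qed
      have "(1/2::real) ^ (card J * card (S \<inter> {p..<q})) \<le> 1 * 2 powr (- g * (real q - real p))"
        by (rule order.trans[OF key[OF p(2) order.refl]]) (intro mult_right_mono power_le_one, auto)
      moreover have "(\<Sum>a\<in>S \<inter> {p..<q}. (1/2) ^ (card J * card (S \<inter> {p..<a})) * \<psi> a)
         \<le> (\<Sum>a\<in>S \<inter> {p..<q}. (1/2) ^ card (S \<inter> {p..<a}) * (8 * 2 powr (- g * (real q - real p))))"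
      proof (rule sum_mono)
        fix a assume a: "a \<in> S \<inter> {p..<q}"
        have "(1/2) ^ (card J * card (S \<inter> {p..<a})) * \<psi> a
           \<le> ((1/2) ^ card (S \<inter> {p..<a}) * 2 powr (- g * (real a - real p))) * \<psi> a"
          by (intro mult_right_mono key) (use a in \<open>auto simp: \<psi>_def\<close>)
        also have "\<dots> = (1/2) ^ card (S \<inter> {p..<a}) * (8 * (2 powr (- g * (real a - real p)) * 2 powr (g * (real a - real q))))"
          by (simp add: \<psi>_def)
        also have "2 powr (- g * (real a - real p)) * 2 powr (g * (real a - real q)) = 2 powr (- g * (real q - real p))"
          unfolding powr_add[symmetric] by (simp add: algebra_simps)
        finally show "(1/2) ^ (card J * card (S \<inter> {p..<a})) * \<psi> a
           \<le> (1/2) ^ card (S \<inter> {p..<a}) * (8 * 2 powr (- g * (real q - real p)))" .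
      qed
      moreover have "\<dots> \<le> 2 * (8 * 2 powr (- g * (real q - real p)))"
        unfolding sum_distrib_right[symmetric] by (intro mult_right_mono sum_halves_count_le fin) auto
      ultimately have le: "collision_bound S (card J) p q \<psi> \<le> 17 * 2 powr (- g * (real q - real p))"
        unfolding collision_bound_def by linarith
      have "log 2 (collision_bound S (card J) p q \<psi>) \<le> log 2 (17 * 2 powr (- g * (real q - real p)))"
        by (rule log_mono[OF _ _ le]) (auto intro!: add_pos_nonneg sum_nonneg simp: \<psi>_def collision_bound_def)
      then show ?thesis by (simp add: log_mult)
    qed
    ultimately show ?thesis unfolding C_def cJ by simp
  qed
  have hT: "h T \<ge> (1 - g) * real D * real (card S) + g * real T - real T * real D / real N
         - 2 * C * real (card S) - C - y0"
  proof (rule chain_bound[OF fin g N(1) D C0 y0 _ low sep fill gap dense ST])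
    show "h q \<ge> 0" for q unfolding h_def
      by (intro sum_nonneg mult_nonneg_nonneg Wpos uniform_entropy_nonneg finite_configs fin finI)
  qed
  \<comment> \<open>Only now are the multipliers fixed: some \<open>m\<close> does at least as well
    as the average.\<close>
  have "\<exists>m\<in>M. uniform_entropy (configs S I) (scale_cell I \<phi> T m) \<ge> h T"
  proof (rule ccontr)
    assume "\<not> ?thesis"
    then have lt: "\<And>m. m \<in> M \<Longrightarrow> uniform_entropy (configs S I) (scale_cell I \<phi> T m) < h T" by auto
    obtain m0 where m0: "m0 \<in> M" "W m0 > 0" by (rule positive_weight_exists[OF Wpos W1])
    have "h T = (\<Sum>m\<in>M. W m * uniform_entropy (configs S I) (scale_cell I \<phi> T m))" by (simp add: h_def)
    also have "\<dots> < sum W M * h T"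
      unfolding sum_distrib_right
    proof (rule sum_strict_mono_ex1[OF finM])
      show "\<forall>m\<in>M. W m * uniform_entropy (configs S I) (scale_cell I \<phi> T m) \<le> W m * h T"
        by (intro ballI mult_left_mono Wpos less_imp_le[OF lt])
      show "\<exists>m\<in>M. W m * uniform_entropy (configs S I) (scale_cell I \<phi> T m) < W m * h T"
        using m0 lt[OF m0(1)] by (auto intro!: bexI[of _ m0])
    qed
    finally show False using W1 by simp
  qed
  then obtain m where m: "m \<in> M" "uniform_entropy (configs S I) (scale_cell I \<phi> T m) \<ge> h T" by auto
  have mA: "m k \<in> A k" if "k \<in> I" for k using m(1) that by (auto simp: M_def PiE_iff)
  have "h T \<le> log 2 (real (card (scale_cell I \<phi> T m ` configs S I)))"
    using m(2) uniform_entropy_le_log_card[OF finite_configs[OF fin finI] configs_nonempty, of "scale_cell I \<phi> T m"]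
    by linarith
  moreover have "\<exists>i<2 ^ D. m k = real i" if "k < n" for k using mA[of k] that by (auto simp: A_def I_def)
  moreover have "m k \<in> U" if "k \<in> {n..<2 * n}" for k using mA[of k] that by (auto simp: A_def I_def)
  ultimately show ?thesis using hT unfolding I_def by (intro exI[of _ m]) auto
qed

section \<open>Supports and Frostman measures\<close>

text \<open>The complement of the support is a union of open null sets, and by Lindelof countably
  many of them suffice.\<close>

lemma measure_compl_spt:
  fixes \<nu> :: "real measure"
  assumes "sets \<nu> = sets borel"
  shows "emeasure \<nu> (- spt \<nu>) = 0" "- spt \<nu> \<in> sets \<nu>"
proof -
  define F where "F = {U :: real set. open U \<and> emeasure \<nu> U = 0}"
  have U: "- spt \<nu> = \<Union>F" by (auto simp: spt_def F_def zero_less_iff_neq_zero)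
  obtain F' where F': "F' \<subseteq> F" "countable F'" "\<Union>F' = \<Union>F"
    using Lindelof[of F] by (auto simp: F_def)
  have "U \<in> null_sets \<nu>" if "U \<in> F'" for U
    using that F'(1) by (auto simp: F_def null_sets_def assms)
  from null_sets_UN'[where N = "\<lambda>U. U", OF F'(2) this] have "\<Union>F' \<in> null_sets \<nu>" by simp
  then show "emeasure \<nu> (- spt \<nu>) = 0" "- spt \<nu> \<in> sets \<nu>" using U F'(3) by (auto simp: null_sets_def)
qed

text \<open>Rescaling the pair \<open>c0 < c1\<close> which maximises \<open>\<nu> [c0, c1] / (c1 - c0) powr g\<close> to the unit interval
  turns the Frostman condition, known below \<open>\<delta> powr \<epsilon>0\<close> only, into one (with the smaller exponent
  \<open>g\<close>) at all scales above the resolution.\<close>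

lemma frostman_rescaling:
  fixes \<nu> :: "real measure"
  assumes \<nu>: "prob_space \<nu>" "sets \<nu> = sets borel" "spt \<nu> \<subseteq> {1/2..1}"
    and \<delta>: "0 < \<delta>" "3/2 * \<delta> \<le> R" "2 * \<delta> \<le> 1" and R: "R powr (\<gamma> - g) < 2/3" and g: "0 < g" "g < \<gamma>" "\<gamma> \<le> 1"
    and frostman: "\<And>x r. \<delta> \<le> r \<Longrightarrow> r \<le> R \<Longrightarrow> measure \<nu> (ball x r) \<le> r powr \<gamma>"
  obtains c0 \<tau> U \<mu> where "2/3 * R < \<tau>" "\<tau> \<le> 1" "c0 \<in> spt \<nu>" "c0 + \<tau> \<in> spt \<nu>"
    "finite U" "U \<subseteq> {0..1}" "\<And>t. t \<in> U \<Longrightarrow> c0 + \<tau> * t \<in> spt \<nu>" "\<And>t. t \<in> U \<Longrightarrow> \<mu> t \<ge> 0" "sum \<mu> U = 1"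
    "\<And>v r. \<delta> / \<tau> \<le> r \<Longrightarrow> (\<Sum>t\<in>U. \<mu> t * of_bool (\<bar>t - v\<bar> < r)) \<le> (2 * r) powr g"
proof -
  interpret prob_space \<nu> by fact
  have sp: "space \<nu> = UNIV" using sets_eq_imp_space_eq[OF \<nu>(2)] by simp
  define cell where "cell = (\<lambda>k::int. {of_int k * \<delta> ..< (of_int k + 1) * \<delta>})"
  have cell_iff: "x \<in> cell k \<longleftrightarrow> \<lfloor>x / \<delta>\<rfloor> = k" for x k
    using \<delta>(1) by (auto simp: cell_def floor_eq_iff field_simps)
  have cell_sets[simp]: "cell k \<in> sets \<nu>" for k unfolding \<nu>(2) cell_def by simp
  have close: "\<bar>x - y\<bar> < \<delta>" if "x \<in> cell k" "y \<in> cell k" for x y k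
    using that by (auto simp: cell_def algebra_simps)
  \<comment> \<open>Discretisation: each \<delta>-cell of positive mass meets the support by
    \<open>measure_compl_spt\<close>, and one of its support points carries the mass of the whole
    cell. Only finitely many points remain, so a maximising pair exists.\<close>
  define K where "K = {k. k \<in> {0..\<lfloor>1 / \<delta>\<rfloor>} \<and> measure \<nu> (cell k) > 0}"
  have finK: "finite K" by (rule finite_subset[of _ "{0..\<lfloor>1 / \<delta>\<rfloor>}"]) (auto simp: K_def)
  have "\<exists>x. x \<in> cell k \<inter> spt \<nu>" if "k \<in> K" for k
  proof (rule ccontr)
    assume "\<not> ?thesis"
    then have "cell k \<subseteq> - spt \<nu>" by auto
    then have "measure \<nu> (cell k) \<le> measure \<nu> (- spt \<nu>)" by (intro finite_measure_mono measure_compl_spt \<nu>)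
    also have "\<dots> = 0" using measure_compl_spt[OF \<nu>(2)] by (simp add: measure_def)
    finally show False using that by (simp add: K_def)
  qed
  then obtain c where c: "\<And>k. k \<in> K \<Longrightarrow> c k \<in> cell k" "\<And>k. k \<in> K \<Longrightarrow> c k \<in> spt \<nu>" by (metis IntE)
  define P where "P = c ` K"
  define w where "w = (\<lambda>x. measure \<nu> (cell \<lfloor>x / \<delta>\<rfloor>))"
  have finP: "finite P" using finK by (simp add: P_def)
  have Pspt: "P \<subseteq> spt \<nu>" using c(2) by (auto simp: P_def)
  have P01: "x \<in> {1/2..1}" if "x \<in> P" for x using Pspt \<nu>(3) that by blast
  have disj: "disjoint_family_on (\<lambda>x. cell \<lfloor>x / \<delta>\<rfloor>) P"
    unfolding disjoint_family_on_def
  proof (intro ballI impI)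
    fix x y assume "x \<in> P" "y \<in> P" "x \<noteq> y"
    then obtain i j where ij: "x = c i" "y = c j" "i \<in> K" "j \<in> K" "i \<noteq> j" by (auto simp: P_def)
    then have "\<lfloor>x / \<delta>\<rfloor> = i" "\<lfloor>y / \<delta>\<rfloor> = j" using c(1) cell_iff by auto
    then show "cell \<lfloor>x / \<delta>\<rfloor> \<inter> cell \<lfloor>y / \<delta>\<rfloor> = {}" using ij(5) cell_iff by auto
  qed
  have total: "sum w P = 1"
  proof -
    have "inj_on c K" using c(1) cell_iff by (metis inj_onI)
    then have "sum w P = (\<Sum>k\<in>K. measure \<nu> (cell k))"
      unfolding P_def using c(1) cell_iff by (simp add: sum.reindex w_def)
    also have "\<dots> = (\<Sum>k\<in>{0..\<lfloor>1 / \<delta>\<rfloor>}. measure \<nu> (cell k))"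
      by (rule sum.mono_neutral_left) (auto simp: K_def zero_less_measure_iff)
    also have "\<dots> = measure \<nu> (\<Union>k\<in>{0..\<lfloor>1 / \<delta>\<rfloor>}. cell k)"
      by (rule finite_measure_finite_Union[symmetric]) (auto simp: disjoint_family_on_def cell_iff)
    also have "\<dots> = 1"
    proof -
      let ?V = "\<Union>k\<in>{0..\<lfloor>1 / \<delta>\<rfloor>}. cell k"
      have "spt \<nu> \<subseteq> ?V"
      proof
        fix x assume "x \<in> spt \<nu>"
        then have "0 \<le> x" "x \<le> 1" using \<nu>(3) by fastforce+
        then have "\<lfloor>x / \<delta>\<rfloor> \<in> {0..\<lfloor>1 / \<delta>\<rfloor>}" using \<delta>(1) by (auto intro!: floor_mono divide_right_mono)
        then show "x \<in> ?V" using cell_iff by blast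
      qed
      then have sub: "UNIV - ?V \<subseteq> - spt \<nu>" by auto
      have V: "?V \<in> sets \<nu>" by auto
      have "measure \<nu> (space \<nu> - ?V) \<le> measure \<nu> (- spt \<nu>)"
        using sub unfolding sp by (intro finite_measure_mono measure_compl_spt \<nu>)
      also have "\<dots> = 0" using measure_compl_spt[OF \<nu>(2)] by (simp add: measure_def)
      finally have "1 - measure \<nu> ?V \<le> 0" using prob_compl[OF V] by simp
      then show ?thesis using prob_le_1[of ?V] by linarith
    qed
    finally show ?thesis .
  qed
  define mass where "mass = (\<lambda>a b. sum w {x \<in> P. a \<le> x \<and> x \<le> b})"
  have w0: "w x \<ge> 0" for x by (simp add: w_def)
  have mass_le: "mass a b \<le> ((b - a) / 2 + \<delta>) powr \<gamma>" if ab: "a \<le> b" "(b - a) / 2 + \<delta> \<le> R" for a b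
  proof -
    have "mass a b = measure \<nu> (\<Union>x\<in>{x \<in> P. a \<le> x \<and> x \<le> b}. cell \<lfloor>x / \<delta>\<rfloor>)"
      unfolding mass_def w_def
      by (rule finite_measure_finite_Union[symmetric]) (use finP disj in \<open>auto simp: disjoint_family_on_def\<close>)
    also have "\<dots> \<le> measure \<nu> (ball ((a + b) / 2) ((b - a) / 2 + \<delta>))"
    proof (rule finite_measure_mono)
      show "(\<Union>x\<in>{x \<in> P. a \<le> x \<and> x \<le> b}. cell \<lfloor>x / \<delta>\<rfloor>) \<subseteq> ball ((a + b) / 2) ((b - a) / 2 + \<delta>)"
      proof clarify
        fix x y assume x: "x \<in> P" "a \<le> x" "x \<le> b" and y: "y \<in> cell \<lfloor>x / \<delta>\<rfloor>"
        have "\<bar>x - y\<bar> < \<delta>" using close[OF _ y, of x] cell_iff by auto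
        then show "y \<in> ball ((a + b) / 2) ((b - a) / 2 + \<delta>)"
          using x by (auto simp: dist_real_def abs_less_iff field_simps)
      qed
    qed (simp add: \<nu>(2))
    also have "\<dots> \<le> ((b - a) / 2 + \<delta>) powr \<gamma>" by (rule frostman) (use ab in auto)
    finally show ?thesis .
  qed
  have Pne: "P \<noteq> {}" using total by auto
  have mass_P: "mass (Min P) (Max P) = 1"
  proof -
    have "{x \<in> P. Min P \<le> x \<and> x \<le> Max P} = P" using finP by auto
    then show ?thesis using total by (simp add: mass_def)
  qed
  have PM: "Min P \<in> P" "Max P \<in> P" using finP Pne by auto
  have MM: "Min P \<le> Max P" using finP Pne by auto
  \<comment> \<open>If all points were within \<delta>, a ball of radius below 1 and at most
    \<open>R\<close> would carry the full mass 1, against the Frostman bound.\<close>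
  have wide: "Max P - Min P \<ge> \<delta>"
  proof (rule ccontr)
    assume a: "\<not> ?thesis"
    define d where "d = Max P - Min P"
    have "d < \<delta>" using a by (simp add: d_def)
    then have "d / 2 + \<delta> \<le> R" and d1: "d / 2 + \<delta> < 1" using \<delta> by linarith+
    then have "(Max P - Min P) / 2 + \<delta> \<le> R" by (simp only: d_def)
    from mass_le[OF MM this] have "1 \<le> ((Max P - Min P) / 2 + \<delta>) powr \<gamma>" by (simp only: mass_P)
    also have "\<dots> < 1 powr \<gamma>" by (rule powr_less_mono2) (use d1 \<delta> g MM in \<open>auto simp: d_def\<close>)
    finally show False by simp
  qed
  define Q where "Q = {(a, b). a \<in> P \<and> b \<in> P \<and> b - a \<ge> \<delta>}"
  define f where "f = (\<lambda>(a, b). mass a b / (b - a) powr g)"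
  have finQ: "finite Q" by (rule finite_subset[of _ "P \<times> P"]) (use finP in \<open>auto simp: Q_def\<close>)
  have Qne: "(Min P, Max P) \<in> Q" using PM wide by (auto simp: Q_def)
  have "Max (f ` Q) \<in> f ` Q" using finQ Qne by (intro Max_in) auto
  then obtain c0 c1 where cc: "(c0, c1) \<in> Q" "f (c0, c1) = Max (f ` Q)" by auto
  have fmax: "f (a, b) \<le> f (c0, c1)" if "(a, b) \<in> Q" for a b
    unfolding cc(2) using finQ that by (intro Max_ge) auto
  define \<tau> where "\<tau> = c1 - c0"
  define m where "m = mass c0 c1"
  have c01: "c0 \<in> P" "c1 \<in> P" "\<delta> \<le> \<tau>" using cc(1) by (auto simp: Q_def \<tau>_def)
  have \<tau>0: "\<tau> > 0" using c01 \<delta> by linarith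
  have \<tau>1: "\<tau> \<le> 1" using P01[OF c01(1)] P01[OF c01(2)] by (auto simp: \<tau>_def)
  have fc: "f (c0, c1) = m / \<tau> powr g" by (simp add: f_def m_def \<tau>_def)
  \<comment> \<open>The extreme pair carries the full mass and is at distance at most 1, so the
    maximum of \<open>f\<close> is at least 1.\<close>
  have "1 \<le> f (Min P, Max P)"
  proof -
    have "(Max P - Min P) powr g \<le> 1 powr g"
      by (rule powr_mono2) (use g MM P01[OF PM(1)] P01[OF PM(2)] in auto)
    then show ?thesis using wide \<delta> by (simp add: f_def mass_P le_divide_eq)
  qed
  also have "\<dots> \<le> m / \<tau> powr g" using fmax[OF Qne] fc by simp
  finally have m: "\<tau> powr g \<le> m" using \<tau>0 by (simp add: le_divide_eq)
  then have m0: "m > 0" using \<tau>0 by (smt (verit) powr_gt_zero)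
  \<comment> \<open>A short maximising pair would lie in the range of the Frostman bound with the
    larger exponent \<gamma>. This is the purpose of \<open>g < \<gamma>\<close>: the surplus
    \<open>R powr (\<gamma> - g)\<close> then beats the constant 3/2.\<close>
  have \<tau>R: "2/3 * R < \<tau>"
  proof (rule ccontr)
    assume "\<not> ?thesis"
    then have le: "3/2 * \<tau> \<le> R" by simp
    have "\<tau> powr g \<le> m" by (rule m)
    also have "\<dots> \<le> (\<tau> / 2 + \<delta>) powr \<gamma>"
      unfolding m_def \<tau>_def by (rule mass_le) (use \<tau>0 le c01(3) in \<open>auto simp: \<tau>_def diff_divide_distrib\<close>)
    also have "\<dots> \<le> (3/2 * \<tau>) powr \<gamma>" by (rule powr_mono2) (use g \<delta> \<tau>0 c01(3) in auto)
    also have "\<dots> = (3/2) powr \<gamma> * \<tau> powr \<gamma>" by (rule powr_mult)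
    also have "\<dots> \<le> (3/2) powr 1 * \<tau> powr \<gamma>" by (intro mult_right_mono powr_mono) (use g in auto)
    also have "\<tau> powr \<gamma> = \<tau> powr (\<gamma> - g) * \<tau> powr g" by (simp flip: powr_add)
    finally have "1 * \<tau> powr g \<le> (3/2 * \<tau> powr (\<gamma> - g)) * \<tau> powr g" by simp
    then have "1 \<le> 3/2 * \<tau> powr (\<gamma> - g)" using \<tau>0 by (simp only: mult_le_cancel_right) auto
    also have "\<tau> powr (\<gamma> - g) \<le> R powr (\<gamma> - g)" by (rule powr_mono2) (use g \<tau>0 le in auto)
    finally show False using R by simp
  qed
  define X where "X = {x \<in> P. c0 \<le> x \<and> x \<le> c1}"
  have finX: "finite X" using finP by (simp add: X_def)
  define U where "U = (\<lambda>x. (x - c0) / \<tau>) ` X"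
  define \<mu> where "\<mu> = (\<lambda>t. w (c0 + \<tau> * t) / m)"
  have inj: "inj_on (\<lambda>x. (x - c0) / \<tau>) X" using \<tau>0 by (auto simp: inj_on_def)
  have sumU: "(\<Sum>t\<in>U. \<mu> t * F t) = (\<Sum>x\<in>X. w x * F ((x - c0) / \<tau>)) / m" for F :: "real \<Rightarrow> real"
    unfolding U_def sum.reindex[OF inj] using \<tau>0 by (simp add: \<mu>_def comp_def sum_divide_distrib)
  show ?thesis
  proof (rule that[of \<tau> c0 U \<mu>])
    show "c0 \<in> spt \<nu>" "c0 + \<tau> \<in> spt \<nu>" using c01 Pspt by (auto simp: \<tau>_def)
    show "finite U" using finX by (simp add: U_def)
    show "U \<subseteq> {0..1}" using \<tau>0 by (auto simp: U_def X_def \<tau>_def)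
    show "c0 + \<tau> * t \<in> spt \<nu>" if "t \<in> U" for t using that Pspt \<tau>0 unfolding U_def by (auto simp: X_def)
    show "\<mu> t \<ge> 0" for t using w0 m0 by (simp add: \<mu>_def)
    show "sum \<mu> U = 1" using sumU[of "\<lambda>_. 1"] m0 by (simp add: X_def m_def mass_def)
    fix v r assume r: "\<delta> / \<tau> \<le> r"
    have r0: "r > 0" using r \<delta>(1) \<tau>0 by (smt (verit) divide_pos_pos)
    define Y where "Y = {x \<in> X. \<bar>(x - c0) / \<tau> - v\<bar> < r}"
    have finY: "finite Y" using finX by (simp add: Y_def)
    have s: "(\<Sum>t\<in>U. \<mu> t * of_bool (\<bar>t - v\<bar> < r)) = sum w Y / m"
      unfolding sumU Y_def using finX by (simp add: of_bool_def sum.If_cases Int_def if_distrib cong: if_cong)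
    show "(\<Sum>t\<in>U. \<mu> t * of_bool (\<bar>t - v\<bar> < r)) \<le> (2 * r) powr g"
    proof (cases "Y = {}")
      case True
      then show ?thesis using s by simp
    next
      case False
      define a where "a = Min Y"
      define b where "b = Max Y"
      have ab: "a \<in> Y" "b \<in> Y" "a \<le> b" using finY False by (auto simp: a_def b_def)
      have "b - a < 2 * r * \<tau>"
      proof -
        have "(b - c0) / \<tau> - (a - c0) / \<tau> < 2 * r" using ab(1,2) by (auto simp: Y_def)
        then have "(b - a) / \<tau> < 2 * r" by (simp add: diff_divide_distrib)
        then show ?thesis using \<tau>0 by (simp add: divide_less_eq)
      qed
      then have ba: "(b - a) / \<tau> \<le> 2 * r" using \<tau>0 by (simp add: divide_le_eq)
      have "sum w Y \<le> mass a b"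
        unfolding mass_def by (rule sum_mono2) (use finP finY w0 in \<open>auto simp: Y_def X_def a_def b_def\<close>)
      then have le: "sum w Y / m \<le> mass a b / m" using m0 by (simp add: divide_right_mono)
      show ?thesis
      proof (cases "b - a \<ge> \<delta>")
        case True
        then have "(a, b) \<in> Q" using ab by (auto simp: Q_def Y_def X_def)
        from fmax[OF this] have "mass a b / (b - a) powr g \<le> m / \<tau> powr g" by (simp add: f_def m_def \<tau>_def)
        then have "mass a b / m \<le> (b - a) powr g / \<tau> powr g"
          using True \<delta>(1) \<tau>0 m0 by (simp add: field_simps)
        also have "\<dots> = ((b - a) / \<tau>) powr g" using True \<delta>(1) \<tau>0 by (simp add: powr_divide)
        also have "\<dots> \<le> (2 * r) powr g" by (rule powr_mono2) (use g ba True \<delta>(1) \<tau>0 in auto)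
        finally show ?thesis using s le by simp
      next
        case False
        \<comment> \<open>Pairs closer than \<delta> do not compete in \<open>Q\<close>. For them
          the Frostman bound at radius at most \<open>3/2 * \<delta>\<close>, together with
          \<open>\<tau> powr g \<le> m\<close>, replaces maximality.\<close>
        then have "mass a b \<le> ((b - a) / 2 + \<delta>) powr \<gamma>"
          using ab \<delta> by (intro mass_le) (auto simp: diff_divide_distrib)
        also have "\<dots> \<le> (2 * \<delta>) powr \<gamma>"
          by (rule powr_mono2) (use g False ab \<delta> in \<open>auto simp: diff_divide_distrib\<close>)
        also have "\<dots> \<le> (2 * \<delta>) powr g" by (rule powr_mono') (use g \<delta> in auto)
        finally have "mass a b / m \<le> (2 * \<delta>) powr g / \<tau> powr g"
          using m m0 \<tau>0 by (intro frac_le) auto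
        also have "\<dots> = (2 * \<delta> / \<tau>) powr g" using \<delta>(1) \<tau>0 by (simp add: powr_divide)
        also have "\<dots> \<le> (2 * r) powr g" by (rule powr_mono2) (use g r \<delta>(1) \<tau>0 in auto)
        finally show ?thesis using s le by simp
      qed
    qed
  qed (use \<tau>R \<tau>1 in auto)
qed

section \<open>Trees inside Frostman sets\<close>

text \<open>Reflecting the scales and dividing by \<open>2 ^ E\<close> turns the bounds
  \<open>2 ^ (E - 1 - a) / 2\<close> and \<open>2 * 2 ^ (E - 1 - a)\<close> into a quarter of
  \<open>2 powr (- a)\<close> and \<open>2 powr (- a)\<close>.\<close>

lemma scale_tree_of_tree_embedding:
  assumes S: "S \<subseteq> {..<E}" and emb: "tree_embedding S \<phi>"
  defines "flip \<equiv> \<lambda>a. E - 1 - a"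
  shows "scale_tree (flip ` S) (\<lambda>X. real (\<phi> (flip ` X)) / 2 ^ E)"
proof -
  have ff: "flip (flip a) = a" if "a < E" for a using that by (simp add: flip_def)
  have img: "flip ` flip ` X = X" if "X \<subseteq> {..<E}" for X
    using that ff by (force simp: image_image)
  have fE: "flip a < E" if "a < E" for a using that by (simp add: flip_def)
  have one: "(1/2) ^ a / 4 \<le> real (\<phi> (flip ` X)) / 2 ^ E - real (\<phi> (flip ` Y)) / 2 ^ E \<and>
      real (\<phi> (flip ` X)) / 2 ^ E - real (\<phi> (flip ` Y)) / 2 ^ E \<le> (1/2) ^ a"
    if X: "X \<subseteq> flip ` S" and Y: "Y \<subseteq> flip ` S" and a: "a \<in> X" "a \<notin> Y" and XY: "X \<inter> {..<a} = Y \<inter> {..<a}" for X Y a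
  proof -
    have sE: "X \<subseteq> {..<E}" "Y \<subseteq> {..<E}" using X Y S fE by fastforce+
    have aE: "a < E" using a sE by auto
    have sS: "flip ` X \<subseteq> S" "flip ` Y \<subseteq> S" using X Y img[OF S] by blast+
    have mem: "flip x \<in> flip ` Z \<longleftrightarrow> x \<in> Z" if "x < E" "Z \<subseteq> {..<E}" for x Z
      using that ff by (metis image_iff lessThan_iff subsetD)
    have "flip ` X \<inter> {flip a<..} = flip ` Y \<inter> {flip a<..}"
    proof (rule set_eqI)
      fix y
      show "y \<in> flip ` X \<inter> {flip a<..} \<longleftrightarrow> y \<in> flip ` Y \<inter> {flip a<..}"
      proof (cases "y < E \<and> flip a < y")
        case True
        then have y: "y = flip (flip y)" "flip y < a" "flip y < E" using aE by (auto simp: flip_def)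
        have "flip y \<in> X \<longleftrightarrow> flip y \<in> Y" using XY y(2) by auto
        then have "flip (flip y) \<in> flip ` X \<longleftrightarrow> flip (flip y) \<in> flip ` Y" using mem[OF y(3)] sE by simp
        then show ?thesis using y(1) by simp
      next
        case False
        then show ?thesis using sE fE by auto
      qed
    qed
    then have "2 ^ flip a \<le> 2 * (real (\<phi> (flip ` X)) - real (\<phi> (flip ` Y)))"
      "real (\<phi> (flip ` X)) - real (\<phi> (flip ` Y)) \<le> 2 * 2 ^ flip a"
      using emb[unfolded tree_embedding_def, rule_format, OF sS, of "flip a"]
        mem[OF aE sE(1)] mem[OF aE sE(2)] a by simp_all
    moreover have "(2::real) ^ E = 2 ^ flip a * 2 * 2 ^ a"
    proof -
      have "E = flip a + 1 + a" using aE by (simp add: flip_def)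
      then have "(2::real) ^ E = 2 ^ (flip a + 1 + a)" by simp
      then show ?thesis by (simp only: power_add power_one_right)
    qed
    moreover have gen: "(1/2) ^ a / 4 \<le> x / (F * 2 * 2 ^ a) \<and> x / (F * 2 * 2 ^ a) \<le> (1/2) ^ a"
      if "F \<le> 2 * x" "x \<le> 2 * F" "F > 0" for x F :: real
    proof -
      have "x / (F * 2 * 2 ^ a) = x / (2 * F) * (1/2) ^ a" by (simp add: power_one_over)
      moreover have "1/4 * (1/2) ^ a \<le> x / (2 * F) * (1/2) ^ a" "x / (2 * F) * (1/2) ^ a \<le> 1 * (1/2) ^ a"
        using that by (intro mult_right_mono; simp add: field_simps)+
      ultimately show ?thesis by simp
    qed
    ultimately show ?thesis
      unfolding diff_divide_distrib[symmetric] by (metis gen zero_less_numeral zero_less_power)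
  qed
  show ?thesis
    unfolding scale_tree_def
  proof (intro allI impI)
    fix X Y a
    assume h: "X \<subseteq> flip ` S" "Y \<subseteq> flip ` S" "(a \<in> X) \<noteq> (a \<in> Y)" "X \<inter> {..<a} = Y \<inter> {..<a}"
    have p: "(0::real) \<le> (1/2) ^ a / 4" by simp
    show "(1/2) ^ a / 4 \<le> \<bar>real (\<phi> (flip ` X)) / 2 ^ E - real (\<phi> (flip ` Y)) / 2 ^ E\<bar> \<and>
      \<bar>real (\<phi> (flip ` X)) / 2 ^ E - real (\<phi> (flip ` Y)) / 2 ^ E\<bar> \<le> (1/2) ^ a"
    proof (cases "a \<in> X")
      case True
      then have "a \<notin> Y" using h(3) by simp
      from one[OF h(1,2) True this h(4)] p show ?thesis by (intro conjI; linarith)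
    next
      case False
      then have "a \<in> Y" using h(3) by simp
      from one[OF h(2,1) this False h(4)[symmetric]] p show ?thesis by (intro conjI; linarith)
    qed
  qed
qed

text \<open>The summand 2 accounts for blocks that the window meets only partly at its ends.\<close>

lemma card_window_le:
  fixes S :: "nat set"
  assumes L: "L \<ge> 1" and blk: "\<And>j. card (S \<inter> {L * j..<L * Suc j}) \<le> 1"
  shows "card (S \<inter> {x..<z}) \<le> (z - x) div L + 2"
proof (cases "x \<le> z")
  case True
  let ?J = "{x div L..z div L}"
  have "S \<inter> {x..<z} \<subseteq> (\<Union>j\<in>?J. S \<inter> {L * j..<L * Suc j})"
  proof
    fix s assume s: "s \<in> S \<inter> {x..<z}"
    have "s mod L < L" using L by simp
    then have 1: "L * (s div L) \<le> s" "s < L * Suc (s div L)"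
      using mult_div_mod_eq[of L s] by (simp_all, linarith)
    have 2: "s div L \<in> ?J" using s by (auto intro: div_le_mono)
    have "s \<in> S \<inter> {L * (s div L)..<L * Suc (s div L)}" using s 1 by (simp del: mult_Suc_right)
    then show "s \<in> (\<Union>j\<in>?J. S \<inter> {L * j..<L * Suc j})" by (rule UN_I[OF 2])
  qed
  then have "card (S \<inter> {x..<z}) \<le> card (\<Union>j\<in>?J. S \<inter> {L * j..<L * Suc j})"
    by (rule card_mono[rotated]) auto
  also have "\<dots> \<le> (\<Sum>j\<in>?J. card (S \<inter> {L * j..<L * Suc j}))" by (rule card_UN_le) simp
  also have "\<dots> \<le> (\<Sum>j\<in>?J. 1)" by (rule sum_mono) (rule blk)
  also have "\<dots> = Suc (z div L) - x div L" by simp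
  also have "\<dots> \<le> (z - x) div L + 2"
  proof -
    have "x mod L < L" "(z - x) mod L < L" using L by simp_all
    then have "x + (z - x) < L * (x div L) + L + (L * ((z - x) div L) + L)"
      using mult_div_mod_eq[of L x] mult_div_mod_eq[of L "z - x"] by linarith
    also have "x + (z - x) = z" using True by simp
    finally have "z < (x div L + (z - x) div L + 2) * L" by (simp add: algebra_simps)
    then have "z div L < x div L + (z - x) div L + 2" by (rule less_mult_imp_div_less)
    then show ?thesis by linarith
  qed
  finally show ?thesis .
qed simp

text \<open>\<open>B\<close> is read as a set of integers; \<open>M\<close> is such that
  \<open>L * M > T\<close>, which keeps the endpoint 1, with index \<open>2 ^ T\<close>, inside the
  tree. \<open>ell\<close> is the cost of one level in bits: a factor \<open>L\<close> from the
  choice of type and a factor 2 from levels without branching.\<close>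

lemma set_contains_scale_tree:
  fixes B :: "real set" and T L :: nat and \<beta> \<kappa> \<epsilon> :: real
  defines "\<delta> \<equiv> (1/2) ^ T" and "M \<equiv> T div L + 1"
  defines "ell \<equiv> log 2 (2 * real L)"
  assumes L: "L \<ge> 1" and \<kappa>: "\<kappa> \<ge> 0" and B: "B \<subseteq> scaled_grid \<delta> \<inter> {0..1}" and card: "real (card B) \<ge> \<delta> powr (- \<beta>)"
    and frostman: "\<And>x r. \<delta> \<le> r \<Longrightarrow> r \<le> \<delta> powr \<epsilon> \<Longrightarrow> real (card (B \<inter> ball x r)) \<le> r powr \<kappa> * real (card B)"
  obtains S \<psi> where "S \<subseteq> {..<L * M}" "scale_tree S \<psi>" "\<And>X. X \<subseteq> S \<Longrightarrow> \<psi> X * 2 ^ (L * M) * \<delta> \<in> B"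
    "\<And>j. card (S \<inter> {L * j..<L * Suc j}) \<le> 1"
    "real L * real (card S) \<ge> \<beta> * real T - real M * ell"
    "\<And>j. j \<le> M \<Longrightarrow> real (L * j) \<ge> \<epsilon> * real T + real L \<Longrightarrow>
       real L * real (card (S \<inter> {..<L * j})) \<ge> \<kappa> * (real (L * j) - real L) - real M * ell"
proof -
  define E where "E = L * M"
  have \<delta>0: "\<delta> > 0" by (simp add: \<delta>_def)
  have \<delta>i: "1 / \<delta> = 2 ^ T" by (simp add: \<delta>_def power_one_over)
  have TE: "T < E" "E \<le> T + L"
  proof -
    have "T mod L < L" using L by simp
    then show "T < E" "E \<le> T + L" using mult_div_mod_eq[of L T] by (simp_all add: E_def M_def, linarith)
  qed
  define Bn where "Bn = {k::nat. real k * \<delta> \<in> B}"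
  have Bimg: "B = (\<lambda>k. real k * \<delta>) ` Bn"
  proof
    show "B \<subseteq> (\<lambda>k. real k * \<delta>) ` Bn"
    proof
      fix b assume b: "b \<in> B"
      then have "b \<in> scaled_grid \<delta>" "0 \<le> b" using B by auto
      then obtain k :: int where k: "b = \<delta> * of_int k" "0 \<le> b" unfolding scaled_grid_def by blast
      then have "k \<ge> 0" using \<delta>0 by (simp add: zero_le_mult_iff)
      then have "b = real (nat k) * \<delta>" using k by simp
      then show "b \<in> (\<lambda>k. real k * \<delta>) ` Bn" using b by (auto simp: Bn_def)
    qed
  qed (auto simp: Bn_def)
  have injB: "inj_on (\<lambda>k. real k * \<delta>) X" for X using \<delta>0 by (auto simp: inj_on_def)
  have cB: "card B = card Bn" unfolding Bimg by (rule card_image[OF injB])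
  have Bsub: "Bn \<subseteq> {..<2 ^ E}"
  proof
    fix k assume "k \<in> Bn"
    then have "real k * \<delta> \<le> 1" using B by (auto simp: Bn_def)
    then have "real k \<le> 1 / \<delta>" using \<delta>0 by (simp add: le_divide_eq)
    then have "real k \<le> real (2 ^ T)" unfolding \<delta>i by simp
    then have "k \<le> 2 ^ T" by (simp only: of_nat_le_iff)
    also have "(2::nat) ^ T < 2 ^ E" using TE by simp
    finally show "k \<in> {..<2 ^ E}" by simp
  qed
  have finB: "finite Bn" by (rule finite_subset[OF Bsub]) simp
  have "\<delta> powr (- \<beta>) > 0" using \<delta>0 by simp
  then have Bpos: "real (card Bn) > 0" using card unfolding cB by linarith
  then have Bne: "Bn \<noteq> {}" by auto
  obtain S0 \<phi> where S0: "S0 \<subseteq> {..<L * M}" "\<And>j. card (S0 \<inter> {L * j..<L * Suc j}) \<le> 1"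
    "tree_embedding S0 \<phi>" "\<And>X. X \<subseteq> S0 \<Longrightarrow> \<phi> X \<in> Bn"
    and cnt: "\<And>h n. h \<le> M \<Longrightarrow> (\<And>v. card {b \<in> Bn. b div 2 ^ (L * h) = v} \<le> n) \<Longrightarrow>
       card Bn \<le> L ^ M * (2 ^ M * 2 ^ (L * card (S0 \<inter> {L * h..<L * M})) * n)"
    using uniform_subtree[OF finB Bne Bsub[unfolded E_def] L] by blast
  define flip where "flip = (\<lambda>a. E - 1 - a)"
  define S where "S = flip ` S0"
  have S0E: "S0 \<subseteq> {..<E}" using S0(1) by (simp add: E_def)
  have ff: "flip (flip a) = a" if "a < E" for a using that by (simp add: flip_def)
  have fE: "flip a < E" if "a < E" for a using that by (simp add: flip_def)
  have injf: "inj_on flip X" if "X \<subseteq> {..<E}" for X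
    by (rule inj_on_inverseI[where g = flip]) (use that ff in auto)
  have SE: "S \<subseteq> {..<E}" using S0E fE by (auto simp: S_def)
  have fS: "flip ` X \<subseteq> S0" if "X \<subseteq> S" for X using that S0E ff unfolding S_def by force
  have flip_card: "card (S \<inter> flip ` Y) = card (S0 \<inter> Y)" if "Y \<subseteq> {..<E}" for Y
  proof -
    have "S \<inter> flip ` Y = flip ` (S0 \<inter> Y)"
      unfolding S_def using inj_on_image_Int[OF injf[OF order.refl] S0E that] by simp
    then show ?thesis using card_image[OF injf, of "S0 \<inter> Y"] S0E by auto
  qed
  have flip_ivl: "flip ` {x..<z} = {E - z..<E - x}" if "z \<le> E" for x z
  proof -
    have "i \<in> flip ` {x..<z}" if i: "i \<in> {E - z..<E - x}" for i
      by (rule image_eqI[of _ _ "flip i"]) (use i \<open>z \<le> E\<close> in \<open>auto simp: flip_def\<close>)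
    then show ?thesis using that by (auto simp: flip_def)
  qed
  have low: "flip ` {L * h..<L * M} = {..<L * (M - h)}" if "h \<le> M" for h
    using flip_ivl[of "L * M" "L * h"] by (auto simp: E_def diff_mult_distrib2)
  \<comment> \<open>The general count in logarithmic form: \<open>y\<close> bounds the points of
    \<open>B\<close> below one node at height \<open>M - j\<close>. It is used with
    \<open>y = 1\<close> at the leaves and with the non-concentration bound at coarser
    levels.\<close>
  have key: "real L * real (card (S \<inter> {..<L * j})) \<ge> log 2 (real (card Bn)) - log 2 y - real M * ell"
    if j: "j \<le> M" and y: "y > 0" "\<And>v. real (card {b \<in> Bn. b div 2 ^ (L * (M - j)) = v}) \<le> y" for j y
  proof -
    define n where "n = nat \<lfloor>y\<rfloor>"
    have n: "real n \<le> y" using y(1) by (simp add: n_def)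
    have "card {b \<in> Bn. b div 2 ^ (L * (M - j)) = v} \<le> n" for v
      using y(2)[of v] by (simp add: n_def le_nat_floor)
    then have "card Bn \<le> L ^ M * (2 ^ M * 2 ^ (L * card (S0 \<inter> {L * (M - j)..<L * M})) * n)"
      by (intro cnt) auto
    also have "card (S0 \<inter> {L * (M - j)..<L * M}) = card (S \<inter> {..<L * j})"
    proof -
      have "{L * (M - j)..<L * M} \<subseteq> {..<E}" by (auto simp: E_def)
      from flip_card[OF this] show ?thesis using low[of "M - j"] j by simp
    qed
    finally have "real (card Bn) \<le> real (L ^ M * (2 ^ M * 2 ^ (L * card (S \<inter> {..<L * j})) * n))" by linarith
    also have "\<dots> = (2 * real L) ^ M * 2 ^ (L * card (S \<inter> {..<L * j})) * real n"
      by (simp add: power_mult_distrib)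
    also have "\<dots> \<le> (2 * real L) ^ M * 2 ^ (L * card (S \<inter> {..<L * j})) * y"
      by (rule mult_left_mono[OF n]) simp
    finally have "log 2 (real (card Bn)) \<le> log 2 ((2 * real L) ^ M * 2 ^ (L * card (S \<inter> {..<L * j})) * y)"
      using Bpos by (intro log_mono) auto
    also have "\<dots> = real M * ell + real L * real (card (S \<inter> {..<L * j})) + log 2 y"
      using L y(1) by (simp add: log_mult log_nat_power ell_def algebra_simps)
    finally show ?thesis by linarith
  qed
  show ?thesis
  proof (rule that[of S "\<lambda>X. real (\<phi> (flip ` X)) / 2 ^ E"])
    show "S \<subseteq> {..<L * M}" using SE by (simp add: E_def)
    show "scale_tree S (\<lambda>X. real (\<phi> (flip ` X)) / 2 ^ E)"
      unfolding S_def flip_def by (rule scale_tree_of_tree_embedding[OF S0E S0(3)])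
    show "real (\<phi> (flip ` X)) / 2 ^ E * 2 ^ (L * M) * \<delta> \<in> B" if "X \<subseteq> S" for X
      using S0(4)[OF fS[OF that]] by (simp add: E_def Bn_def)
    show "card (S \<inter> {L * j..<L * Suc j}) \<le> 1" for j
    proof (cases "j < M")
      case True
      then have le: "L * Suc j \<le> E" unfolding E_def by (intro mult_le_mono2) simp
      have "flip ` {L * (M - Suc j)..<L * Suc (M - Suc j)} = {L * j..<L * Suc j}"
      proof -
        have "L * (M - Suc j) = E - L * Suc j" "L * Suc (M - Suc j) = E - L * j"
          using True by (simp_all add: E_def diff_mult_distrib2 Suc_diff_Suc del: mult_Suc_right)
        moreover have "L * j \<le> E" using le by simp
        ultimately show ?thesis using flip_ivl[of "E - L * j" "E - L * Suc j"] le by simp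
      qed
      moreover have "{L * (M - Suc j)..<L * Suc (M - Suc j)} \<subseteq> {..<E}"
      proof -
        have "L * Suc (M - Suc j) \<le> E" using True unfolding E_def by (intro mult_le_mono2) simp
        then show ?thesis by (auto simp del: mult_Suc_right)
      qed
      ultimately show ?thesis using flip_card S0(2)[of "M - Suc j"] by metis
    next
      case False
      then have "E \<le> L * j" unfolding E_def by (intro mult_le_mono2) simp
      then have "S \<inter> {L * j..<L * Suc j} = {}" using SE by fastforce
      then show ?thesis by (simp only: card.empty)
    qed
    have "card {b \<in> Bn. b div 2 ^ (L * (M - M)) = v} \<le> 1" for v
    proof -
      have "{b \<in> Bn. b div 2 ^ (L * (M - M)) = v} \<subseteq> {v}" by auto
      from card_mono[OF _ this] show ?thesis by simp
    qed
    then have "real L * real (card (S \<inter> {..<L * M})) \<ge> log 2 (real (card Bn)) - log 2 1 - real M * ell"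
      by (intro key) auto
    moreover have "S \<inter> {..<L * M} = S" using SE by (auto simp: E_def)
    moreover have "log 2 (real (card Bn)) \<ge> \<beta> * real T"
    proof -
      have "\<delta> = 2 powr (- real T)" by (simp add: \<delta>_def powr_minus powr_realpow power_one_over inverse_eq_divide)
      then have "\<delta> powr (- \<beta>) = 2 powr (\<beta> * real T)" by (simp add: powr_powr mult.commute)
      then have "log 2 (2 powr (\<beta> * real T)) \<le> log 2 (real (card Bn))"
        using card cB by (intro log_mono) auto
      then show ?thesis by simp
    qed
    ultimately show "real L * real (card S) \<ge> \<beta> * real T - real M * ell" by simp
    fix j assume j: "j \<le> M" "real (L * j) \<ge> \<epsilon> * real T + real L"
    \<comment> \<open>The real length of a node at height \<open>M - j\<close>, so the points below
      it lie in a ball of radius \<open>r\<close>. The condition on \<open>j\<close> is what gives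
      \<open>r \<le> \<delta> powr \<epsilon>\<close>.\<close>
    define r where "r = 2 ^ (L * (M - j)) * \<delta>"
    have r0: "r > 0" using \<delta>0 by (simp add: r_def)
    have rp: "r = 2 powr (- (real T - real (L * (M - j))))"
      by (simp add: r_def \<delta>_def powr_diff powr_realpow[symmetric] power_one_over powr_minus field_simps)
    have TEr: "real E - real L \<le> real T" using TE by linarith
    have LM: "real (L * (M - j)) = real E - real (L * j)" using j by (simp add: E_def of_nat_diff algebra_simps)
    have lr: "real T - real (L * (M - j)) \<ge> real (L * j) - real L" using TEr LM by linarith
    have "r \<le> \<delta> powr \<epsilon>"
    proof -
      have "\<delta> = 2 powr (- real T)" by (simp add: \<delta>_def powr_minus powr_realpow power_one_over inverse_eq_divide)
      then have "\<delta> powr \<epsilon> = 2 powr (- (\<epsilon> * real T))" by (simp add: powr_powr mult.commute)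
      then show ?thesis unfolding rp using lr j(2) by (simp add: powr_mono)
    qed
    moreover have "\<delta> \<le> r" unfolding r_def using \<delta>0 by (simp add: mult_le_cancel_right1)
    ultimately have fr: "real (card (B \<inter> ball x r)) \<le> r powr \<kappa> * real (card B)" for x by (intro frostman)
    have "real L * real (card (S \<inter> {..<L * j})) \<ge> log 2 (real (card Bn)) - log 2 (r powr \<kappa> * real (card Bn)) - real M * ell"
    proof (rule key[OF j(1)])
      show "0 < r powr \<kappa> * real (card Bn)" using r0 Bpos by simp
      fix v
      let ?N = "{b \<in> Bn. b div 2 ^ (L * (M - j)) = v}"
      have "(\<lambda>k. real k * \<delta>) ` ?N \<subseteq> B \<inter> ball (real v * r) r"
      proof clarify
        fix b assume b: "b \<in> Bn" "v = b div 2 ^ (L * (M - j))"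
        let ?P = "2 ^ (L * (M - j)) :: nat"
        have "b = ?P * v + b mod ?P" "b mod ?P < ?P" using b(2) by auto
        then have "real ?P * real v \<le> real b" "real b < real ?P * real v + real ?P"
          by (metis le_add1 of_nat_le_iff of_nat_mult, metis add_less_cancel_left of_nat_add of_nat_less_iff of_nat_mult)
        then have "real ?P * real v * \<delta> \<le> real b * \<delta>" "real b * \<delta> < (real ?P * real v + real ?P) * \<delta>"
          using \<delta>0 by auto
        then show "real b * \<delta> \<in> B \<inter> ball (real (b div ?P) * r) r"
          using b by (auto simp: Bn_def r_def dist_real_def algebra_simps abs_less_iff)
      qed
      then have "card ((\<lambda>k. real k * \<delta>) ` ?N) \<le> card (B \<inter> ball (real v * r) r)"
        by (rule card_mono[rotated]) (use finB Bimg in auto)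
      then have "real (card ?N) \<le> real (card (B \<inter> ball (real v * r) r))"
        by (simp add: card_image[OF injB])
      also have "\<dots> \<le> r powr \<kappa> * real (card Bn)" using fr cB by simp
      finally show "real (card ?N) \<le> r powr \<kappa> * real (card Bn)" .
    qed
    also have "log 2 (r powr \<kappa> * real (card Bn)) = \<kappa> * log 2 r + log 2 (real (card Bn))"
      using r0 Bpos by (simp add: log_mult log_powr)
    also have "log 2 r = - (real T - real (L * (M - j)))" unfolding rp by simp
    finally have "real L * real (card (S \<inter> {..<L * j})) \<ge> \<kappa> * (real T - real (L * (M - j))) - real M * ell"
      by (simp add: algebra_simps)
    moreover have "\<kappa> * (real T - real (L * (M - j))) \<ge> \<kappa> * (real (L * j) - real L)"
      using lr \<kappa> by (rule mult_left_mono)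
    ultimately show "real L * real (card (S \<inter> {..<L * j})) \<ge> \<kappa> * (real (L * j) - real L) - real M * ell"
      by linarith
  qed
qed

section \<open>From long sums to difference sets\<close>

text \<open>\<open>cB\<close> rounded to the grid and expressed in units of \<delta>. The dilates
  thereby become finite subsets of one group, and cardinalities can stand in for covering
  numbers.\<close>

definition dilate_floors :: "real \<Rightarrow> real \<Rightarrow> real set \<Rightarrow> int set" where
  "dilate_floors \<delta> c B = (\<lambda>b. \<lfloor>c * b / \<delta>\<rfloor>) ` B"

text \<open>Both kinds of multipliers are differences of elements of \<open>C\<close>:
  \<open>\<tau> * m k = i k * (c k - c0)\<close>, with \<open>c k = c0 + \<tau>\<close> for an
  integer multiplier and with \<open>i k = 1\<close> for the others. So the rescaled point is a
  difference of two sums of at most \<open>Q\<close> dilates. Rounding moves it by at most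
  \<open>Q\<close>, whence the factor \<open>2 * Q + 2\<close>.\<close>

lemma card_scale_cells_le:
  fixes B C :: "real set"
  assumes fin: "finite S" "finite B" "finite C" and \<delta>: "\<delta> > 0" and \<tau>: "\<tau> > 0" "2 ^ T \<le> \<tau> * 2 ^ E"
    and \<psi>: "\<And>X. X \<subseteq> S \<Longrightarrow> \<psi> X * 2 ^ E * \<delta> \<in> B"
    and c0: "c0 \<in> C" "c0 + \<tau> \<in> C"
    and m1: "\<And>k. k < n \<Longrightarrow> \<exists>i<2 ^ D. m k = real i" and m2: "\<And>k. k \<in> {n..<2 * n} \<Longrightarrow> c0 + \<tau> * m k \<in> C"
  defines "Q \<equiv> n * 2 ^ D" and "F \<equiv> insert 0 (\<Union>c\<in>C. dilate_floors \<delta> c B)"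
  shows "real (card (scale_cell {..<2 * n} \<psi> T m ` configs S {..<2 * n}))
    \<le> (2 * real Q + 2) * real (card {p - q |p q. p \<in> nfold_sum Q F \<and> q \<in> nfold_sum Q F})"
proof -
  define i where "i = (\<lambda>k. if k < n then SOME j. j < 2 ^ D \<and> m k = real j else 1)"
  have i: "i k < 2 ^ D" "m k = real (i k)" if "k < n" for k
  proof -
    have "\<exists>j. j < 2 ^ D \<and> m k = real j" using m1[OF that] by blast
    from someI_ex[OF this] show "i k < 2 ^ D" "m k = real (i k)" using that by (simp_all add: i_def)
  qed
  define c where "c = (\<lambda>k. if k < n then c0 + \<tau> else c0 + \<tau> * m k)"
  have cC: "c k \<in> C" if "k < 2 * n" for k using that c0 m2 by (auto simp: c_def)
  define x where "x = (\<lambda>(w :: nat \<Rightarrow> nat set) k. \<psi> (w k) * 2 ^ E :: real)"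
  define p where "p = (\<lambda>w. \<Sum>k<2 * n. of_nat (i k) * \<lfloor>c k * x w k\<rfloor>)"
  define q where "q = (\<lambda>w. \<Sum>k<2 * n. of_nat (i k) * \<lfloor>c0 * x w k\<rfloor>)"
  \<comment> \<open>At most \<open>2 ^ D - 1\<close> from each of the first \<open>n\<close> indices
    and 1 from each of the others. The element 0 of \<open>F\<close> pads shorter sums to length
    \<open>Q\<close>.\<close>
  have sumi: "sum i {..<2 * n} \<le> Q"
  proof -
    have "sum i {..<2 * n} = sum i {..<n} + sum i {n..<2 * n}"
    proof -
      have "{..<2 * n} = {..<n} \<union> {n..<2 * n}" by auto
      then show ?thesis by (metis finite_atLeastLessThan finite_lessThan ivl_disj_int_one(2) sum.union_disjoint)
    qed
    also have "sum i {n..<2 * n} = n" by (simp add: i_def)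
    also have "sum i {..<n} \<le> (\<Sum>k<n. 2 ^ D - 1)"
      by (rule sum_mono) (use i(1) in \<open>fastforce simp: less_eq_Suc_le\<close>)
    finally have "sum i {..<2 * n} \<le> n * (2 ^ D - 1) + n" by simp
    also have "\<dots> = n * 2 ^ D" by (simp add: diff_mult_distrib2)
    finally show ?thesis by (simp add: Q_def)
  qed
  have fl: "\<lfloor>c' * x w k\<rfloor> \<in> F" if "w \<in> configs S {..<2 * n}" "k < 2 * n" "c' \<in> C" for w k c'
  proof -
    have "w k \<subseteq> S" using that(1,2) by (auto simp: configs_def PiE_iff)
    from \<psi>[OF this] have "x w k * \<delta> \<in> B" by (simp add: x_def)
    moreover have "c' * x w k = c' * (x w k * \<delta>) / \<delta>" using \<delta> by simp
    ultimately have "\<lfloor>c' * x w k\<rfloor> \<in> dilate_floors \<delta> c' B"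
      unfolding dilate_floors_def by (metis image_eqI)
    then show ?thesis using that(3) by (auto simp: F_def)
  qed
  have mem: "(\<Sum>k<2 * n. of_nat (i k) * \<lfloor>d k * x w k\<rfloor>) \<in> nfold_sum Q F"
    if "w \<in> configs S {..<2 * n}" "\<And>k. k < 2 * n \<Longrightarrow> d k \<in> C" for w d
  proof -
    have "(\<Sum>k<2 * n. of_nat (i k) * \<lfloor>d k * x w k\<rfloor>) \<in> nfold_sum (sum i {..<2 * n}) F"
      by (rule sum_in_nfold_sum) (use fl that in \<open>auto intro!: mult_in_nfold_sum\<close>)
    then show ?thesis using nfold_sum_mono[of F, OF _ sumi] by (auto simp: F_def)
  qed
  \<comment> \<open>The factor between the unit of rounding and cells of scale \<open>T\<close>. It
    is at most 1, so the rounding error does not grow.\<close>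
  define s where "s = 2 ^ T / (\<tau> * 2 ^ E)"
  have s: "0 \<le> s" "s \<le> 1" using \<tau> by (auto simp: s_def divide_le_eq)
  have close: "\<bar>2 ^ T * weighted_point {..<2 * n} \<psi> m w - s * real_of_int (p w - q w)\<bar> \<le> real Q" for w
  proof -
    have "\<tau> * 2 ^ E * weighted_point {..<2 * n} \<psi> m w = (\<Sum>k<2 * n. real (i k) * (c k * x w k - c0 * x w k))"
      unfolding weighted_point_def sum_distrib_left
    proof (rule sum.cong[OF refl])
      fix k
      have "\<tau> * m k = real (i k) * (c k - c0)" using i(2)[of k] by (auto simp: c_def i_def)
      then have "\<tau> * m k * x w k = real (i k) * (c k - c0) * x w k" by simp
      then show "\<tau> * 2 ^ E * (m k * \<psi> (w k)) = real (i k) * (c k * x w k - c0 * x w k)"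
        by (simp add: x_def algebra_simps)
    qed
    then have "\<tau> * 2 ^ E * weighted_point {..<2 * n} \<psi> m w - real_of_int (p w - q w)
       = (\<Sum>k<2 * n. real (i k) * ((c k * x w k - c0 * x w k) - (real_of_int \<lfloor>c k * x w k\<rfloor> - real_of_int \<lfloor>c0 * x w k\<rfloor>)))"
      unfolding p_def q_def by (simp add: sum_subtractf right_diff_distrib)
    also have "\<bar>\<dots>\<bar> \<le> (\<Sum>k<2 * n. real (i k))"
    proof (rule order.trans[OF sum_abs sum_mono])
      fix k
      have "\<bar>(u - v) - (real_of_int \<lfloor>u\<rfloor> - real_of_int \<lfloor>v\<rfloor>)\<bar> \<le> 1" for u v :: real by linarith
      then have "real (i k) * \<bar>(c k * x w k - c0 * x w k) - (real_of_int \<lfloor>c k * x w k\<rfloor> - real_of_int \<lfloor>c0 * x w k\<rfloor>)\<bar>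
        \<le> real (i k) * 1" by (intro mult_left_mono) auto
      then show "\<bar>real (i k) * ((c k * x w k - c0 * x w k) - (real_of_int \<lfloor>c k * x w k\<rfloor> - real_of_int \<lfloor>c0 * x w k\<rfloor>))\<bar>
        \<le> real (i k)" by (simp add: abs_mult)
    qed
    also have "\<dots> \<le> real Q" using sumi by (metis of_nat_mono of_nat_sum)
    finally have 1: "\<bar>\<tau> * 2 ^ E * weighted_point {..<2 * n} \<psi> m w - real_of_int (p w - q w)\<bar> \<le> real Q" .
    have "2 ^ T * weighted_point {..<2 * n} \<psi> m w - s * real_of_int (p w - q w)
       = s * (\<tau> * 2 ^ E * weighted_point {..<2 * n} \<psi> m w - real_of_int (p w - q w))"
      using \<tau>(1) by (simp add: s_def right_diff_distrib)
    then have "\<bar>2 ^ T * weighted_point {..<2 * n} \<psi> m w - s * real_of_int (p w - q w)\<bar>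
       \<le> 1 * \<bar>\<tau> * 2 ^ E * weighted_point {..<2 * n} \<psi> m w - real_of_int (p w - q w)\<bar>"
      using s by (simp only: abs_mult) (intro mult_right_mono, auto)
    then show ?thesis unfolding mult_1_left by (rule order.trans[OF _ 1])
  qed
  let ?\<Omega> = "configs S {..<2 * n}"
  have fin\<Omega>: "finite ?\<Omega>" by (rule finite_configs) (use fin in auto)
  have "card (scale_cell {..<2 * n} \<psi> T m ` ?\<Omega>) \<le> card ((\<lambda>w. p w - q w) ` ?\<Omega>) * (2 * Q + 2)"
  proof (rule card_UN_fibres_le[OF fin\<Omega>])
    fix v
    have "real (card ((\<lambda>w. \<lfloor>2 ^ T * weighted_point {..<2 * n} \<psi> m w\<rfloor>) ` {w \<in> ?\<Omega>. p w - q w = v})) \<le> 2 * real Q + 2"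
      by (rule card_floor_image_le[where c = "s * real_of_int v"]) (use close in auto)
    then have "real (card (scale_cell {..<2 * n} \<psi> T m ` {w \<in> ?\<Omega>. p w - q w = v})) \<le> real (2 * Q + 2)"
      by (simp add: scale_cell_def)
    then show "card (scale_cell {..<2 * n} \<psi> T m ` {w \<in> ?\<Omega>. p w - q w = v}) \<le> 2 * Q + 2"
      by (simp only: of_nat_le_iff)
  qed
  also have "\<dots> \<le> card {p - q |p q. p \<in> nfold_sum Q F \<and> q \<in> nfold_sum Q F} * (2 * Q + 2)"
  proof (intro mult_right_mono card_mono)
    have "finite F" using fin by (simp add: F_def dilate_floors_def)
    then have "finite ((\<lambda>(p, q). p - q) ` (nfold_sum Q F \<times> nfold_sum Q F))"
      by (intro finite_imageI finite_cartesian_product finite_nfold_sum)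
    moreover have "{p - q |p q. p \<in> nfold_sum Q F \<and> q \<in> nfold_sum Q F} \<subseteq> (\<lambda>(p, q). p - q) ` (nfold_sum Q F \<times> nfold_sum Q F)"
      by auto
    ultimately show "finite {p - q |p q. p \<in> nfold_sum Q F \<and> q \<in> nfold_sum Q F}" by (rule finite_subset[rotated])
    show "(\<lambda>w. p w - q w) ` ?\<Omega> \<subseteq> {p - q |p q. p \<in> nfold_sum Q F \<and> q \<in> nfold_sum Q F}"
    proof clarify
      fix w assume w: "w \<in> ?\<Omega>"
      have "p w \<in> nfold_sum Q F" unfolding p_def by (rule mem[OF w cC])
      moreover have "q w \<in> nfold_sum Q F" unfolding q_def by (rule mem[OF w c0(1)])
      ultimately show "\<exists>p' q'. p w - q w = p' - q' \<and> p' \<in> nfold_sum Q F \<and> q' \<in> nfold_sum Q F" by blast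
    qed
  qed simp
  finally have "real (card (scale_cell {..<2 * n} \<psi> T m ` ?\<Omega>))
     \<le> real (card {p - q |p q. p \<in> nfold_sum Q F \<and> q \<in> nfold_sum Q F} * (2 * Q + 2))"
    by (rule of_nat_mono)
  then show ?thesis by (simp add: algebra_simps)
qed

text \<open>Elements of the grid are integers in units of \<delta>, so adding them commutes with
  taking the floor.\<close>

lemma card_sum_dilate_floors:
  fixes A' :: "int set" and B :: "real set"
  assumes "finite A'" "finite B" "\<delta> > 0"
  shows "card (A' + dilate_floors \<delta> c B) \<le> dyadic_covering_number (sum_dilate ((\<lambda>k. \<delta> * of_int k) ` A') c B) \<delta>"
proof -
  let ?E = "sum_dilate ((\<lambda>k. \<delta> * of_int k) ` A') c B"
  have "?E = (\<lambda>(a, b). \<delta> * of_int a + c * b) ` (A' \<times> B)" by (auto simp: sum_dilate_def)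
  then have fin: "finite ?E" using assms by simp
  have "A' + dilate_floors \<delta> c B \<subseteq> (\<lambda>x. \<lfloor>x / \<delta>\<rfloor>) ` ?E"
  proof
    fix y assume "y \<in> A' + dilate_floors \<delta> c B"
    then obtain a b where ab: "a \<in> A'" "b \<in> B" "y = a + \<lfloor>c * b / \<delta>\<rfloor>"
      by (auto simp: dilate_floors_def elim!: set_plus_elim)
    have "y = \<lfloor>(\<delta> * of_int a + c * b) / \<delta>\<rfloor>" using assms(3) ab(3) by (simp add: add_divide_distrib)
    moreover have "\<delta> * of_int a + c * b \<in> ?E" using ab by (auto simp: sum_dilate_def)
    ultimately show "y \<in> (\<lambda>x. \<lfloor>x / \<delta>\<rfloor>) ` ?E" by (rule image_eqI)
  qed
  then have "card (A' + dilate_floors \<delta> c B) \<le> card ((\<lambda>x. \<lfloor>x / \<delta>\<rfloor>) ` ?E)"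
    by (rule card_mono[rotated]) (use fin in auto)
  also have "\<dots> \<le> dyadic_covering_number ?E \<delta>" by (rule card_floor_le_dyadic_covering_number[OF fin assms(3)])
  finally show ?thesis .
qed

text \<open>\<open>plunnecke_ruzsa\<close> wants one set containing all dilates in use, together
  with 0. The sumset splits into \<open>|C| + 1\<close> pieces, so this costs a bounded factor only;
  that is why just finitely many points of the support may be used.\<close>

lemma card_sum_all_floors_le:
  fixes A' :: "int set" and B C :: "real set"
  assumes fin: "finite A'" "finite B" "finite C" and A': "A' \<noteq> {}" and \<delta>: "\<delta> > 0" and K: "K \<ge> 1" and C: "card C \<le> N"
    and le: "\<And>c. c \<in> C \<Longrightarrow>
      real (dyadic_covering_number (sum_dilate ((\<lambda>k. \<delta> * of_int k) ` A') c B) \<delta>) \<le> K * real (card A')"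
  shows "real (card (A' + insert 0 (\<Union>c\<in>C. dilate_floors \<delta> c B))) \<le> (real N + 1) * K * real (card A')"
proof -
  let ?G = "\<lambda>c. A' + dilate_floors \<delta> c B"
  have "A' + insert 0 (\<Union>c\<in>C. dilate_floors \<delta> c B) \<subseteq> A' \<union> (\<Union>c\<in>C. ?G c)"
    by (auto elim!: set_plus_elim intro: set_plus_intro)
  then have "card (A' + insert 0 (\<Union>c\<in>C. dilate_floors \<delta> c B)) \<le> card (A' \<union> (\<Union>c\<in>C. ?G c))"
    by (rule card_mono[rotated]) (use fin in \<open>auto intro!: finite_set_plus simp: dilate_floors_def\<close>)
  also have "\<dots> \<le> card A' + card (\<Union>c\<in>C. ?G c)" by (rule card_Un_le)
  also have "\<dots> \<le> card A' + (\<Sum>c\<in>C. card (?G c))" using card_UN_le[OF fin(3), of ?G] by simp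
  finally have "real (card (A' + insert 0 (\<Union>c\<in>C. dilate_floors \<delta> c B)))
      \<le> real (card A') + (\<Sum>c\<in>C. real (card (?G c)))"
    by (metis of_nat_add of_nat_mono of_nat_sum)
  also have "\<dots> \<le> K * real (card A') + (\<Sum>c\<in>C. K * real (card A'))"
  proof (rule add_mono)
    show "real (card A') \<le> K * real (card A')" using K by (simp add: mult_le_cancel_right1)
    show "(\<Sum>c\<in>C. real (card (?G c))) \<le> (\<Sum>c\<in>C. K * real (card A'))"
    proof (rule sum_mono)
      fix c assume c: "c \<in> C"
      have "real (card (?G c)) \<le> real (dyadic_covering_number (sum_dilate ((\<lambda>k. \<delta> * of_int k) ` A') c B) \<delta>)"
        by (rule of_nat_mono[OF card_sum_dilate_floors[OF fin(1,2) \<delta>]])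
      also have "\<dots> \<le> K * real (card A')" by (rule le[OF c])
      finally show "real (card (?G c)) \<le> K * real (card A')" .
    qed
  qed
  also have "\<dots> = (real (card C) + 1) * (K * real (card A'))" by (simp add: algebra_simps)
  also have "\<dots> \<le> (real N + 1) * (K * real (card A'))"
    using C K by (intro mult_right_mono) auto
  finally show ?thesis by (simp add: mult.assoc)
qed

section \<open>Comparing entropy and growth\<close>

lemma scale_tree_subset: "scale_tree S \<phi> \<Longrightarrow> S' \<subseteq> S \<Longrightarrow> scale_tree S' \<phi>"
  unfolding scale_tree_def by (meson order.trans)

text \<open>Lower and upper bound for the logarithm of one number of cells, from
  \<open>long_sum_entropy\<close> and from \<open>plunnecke_ruzsa\<close>. For fixed
  \<open>L\<close> both sides are affine in \<open>T\<close>; on the left the coefficient approaches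
  (1 - g) \<beta> + g as \<open>L\<close> grows and \<epsilon>0 shrinks.\<close>

lemma entropy_gain_le_growth:
  fixes \<alpha> \<beta> \<kappa> \<gamma> g \<epsilon> \<epsilon>0 :: real and L T :: nat and A B :: "real set" and \<nu> :: "real measure"
  defines "\<delta> \<equiv> (1/2) ^ T" and "ell \<equiv> log 2 (2 * real L)" and "n \<equiv> L ^ 4 + 1"
  defines "Q \<equiv> n * 2 ^ (L * L)" and "C \<equiv> log 2 17 + log 2 (2 * real n + 2)"
  defines "y0 \<equiv> (2 * ell / (\<kappa> * real L) + \<epsilon>0) * real T + (6 * real L + 2 / \<kappa> * (ell + real L * (real L + 2)))"
  defines "c1 \<equiv> ell + real L * (real L + 2) + 3 * real L + 2"
  assumes \<beta>: "\<beta> \<le> 1" and \<kappa>: "\<kappa> > 0" and g: "0 < g" "g < \<gamma>" "\<gamma> \<le> 1" and \<epsilon>: "\<epsilon> \<ge> 0" "\<epsilon>0 \<ge> 0"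
    and L: "L \<ge> 2" "2 * real L * (real L + 2) \<le> \<kappa> * real (L ^ 4)"
    and T: "3/2 * \<delta> \<le> \<delta> powr \<epsilon>0" "2 * \<delta> \<le> 1" "(\<delta> powr \<epsilon>0) powr (\<gamma> - g) < 2/3"
    and A: "A \<subseteq> scaled_grid \<delta> \<inter> {0..1}" "real (card A) \<le> \<delta> powr (- \<alpha>)"
    and B: "B \<subseteq> scaled_grid \<delta> \<inter> {0..1}" "real (card B) \<ge> \<delta> powr (- \<beta>)"
    and frostmanB: "\<And>x r. \<delta> \<le> r \<Longrightarrow> r \<le> \<delta> powr \<epsilon>0 \<Longrightarrow> real (card (B \<inter> ball x r)) \<le> r powr \<kappa> * real (card B)"
    and \<nu>: "prob_space \<nu>" "sets \<nu> = sets borel" "spt \<nu> \<subseteq> {1/2..1}"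
    and frostman: "\<And>x r. \<delta> \<le> r \<Longrightarrow> r \<le> \<delta> powr \<epsilon>0 \<Longrightarrow> measure \<nu> (ball x r) \<le> r powr \<gamma>"
    and small: "\<And>c. c \<in> spt \<nu> \<Longrightarrow>
      real (dyadic_covering_number (sum_dilate A c B) \<delta>) < \<delta> powr (- \<epsilon>) * real (card A)"
  shows "(1 - g) * ((\<beta> - ell / real L - \<epsilon>0 - 2 / real L) * real T - c1) + g * ((1 - \<epsilon>0) * real T - 2)
      - real T / (real L)\<^sup>2 - 2 * C * (real T / real L + 3) - C - y0
    \<le> log 2 (2 * real Q + 2) + 2 * real Q * (log 2 (real n + 3) + \<epsilon> * real T) + \<alpha> * real T"
proof -
  define M where "M = T div L + 1"
  define E where "E = L * M"
  define D where "D = L * L"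
  have \<delta>0: "\<delta> > 0" by (simp add: \<delta>_def)
  have \<delta>p: "\<delta> = 2 powr (- real T)" by (simp add: \<delta>_def powr_minus powr_realpow power_one_over inverse_eq_divide)
  have \<delta>pow: "\<delta> powr (- x) = 2 powr (x * real T)" for x unfolding \<delta>p by (simp add: powr_powr mult.commute)
  have ell: "ell \<ge> 0" using L(1) by (simp add: ell_def)
  have Lp: "real L > 0" using L by simp
  have ME: "real M \<le> real T / real L + 1" unfolding M_def using Lp by (simp add: of_nat_div_le_of_nat)
  have TE: "T < E" "E \<le> T + L"
  proof -
    have "T mod L < L" using L by simp
    then show "T < E" "E \<le> T + L" using mult_div_mod_eq[of L T] by (simp_all add: E_def M_def, linarith)
  qed

  obtain c0 \<tau> U \<mu> where \<tau>: "2/3 * (\<delta> powr \<epsilon>0) < \<tau>" "\<tau> \<le> 1" and c0: "c0 \<in> spt \<nu>" "c0 + \<tau> \<in> spt \<nu>"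
    and U: "finite U" "U \<subseteq> {0..1}" "\<And>t. t \<in> U \<Longrightarrow> c0 + \<tau> * t \<in> spt \<nu>"
    and \<mu>: "\<And>t. t \<in> U \<Longrightarrow> \<mu> t \<ge> 0" "sum \<mu> U = 1"
    and fr: "\<And>v r. \<delta> / \<tau> \<le> r \<Longrightarrow> (\<Sum>t\<in>U. \<mu> t * of_bool (\<bar>t - v\<bar> < r)) \<le> (2 * r) powr g"
    by (rule frostman_rescaling[OF \<nu> \<delta>0 T g]) ((rule frostman; assumption), (rule that; assumption))
  have "\<delta> powr \<epsilon>0 > 0" using \<delta>0 by simp
  then have \<tau>0: "\<tau> > 0" using \<tau>(1) by linarith

  \<comment> \<open>\<open>y\<close> is \<tau> / \<delta>. The rescaled Frostman bound reaches down
    to \<delta> / \<tau> only, which limits the resolution to \<open>T'\<close>; by the lower bound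
    on \<tau> at most \<open>\<epsilon>0 * T + 2\<close> scales are lost.\<close>
  define y where "y = \<tau> * 2 ^ T"
  have "\<delta> < \<tau>" using \<tau>(1) T(1) by linarith
  then have y1: "y > 1" by (simp add: y_def \<delta>_def power_one_over field_simps)
  define T' where "T' = nat \<lfloor>log 2 y\<rfloor>"
  have "log 2 y > 0" using y1 by simp
  then have T'r: "real T' = real_of_int \<lfloor>log 2 y\<rfloor>" by (simp add: T'_def)
  have T'le: "real T' \<le> log 2 y" "log 2 y < real T' + 1" unfolding T'r by linarith+
  have yT: "2 ^ T' \<le> y"
  proof -
    have "2 powr real T' \<le> 2 powr log 2 y" using T'le by (intro powr_mono) auto
    then show ?thesis using y1 by (simp add: powr_realpow)
  qed
  have ly: "log 2 y = log 2 \<tau> + real T" using \<tau>0 by (simp add: y_def log_mult log_nat_power)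
  have T'T: "T' \<le> T"
  proof -
    have "log 2 \<tau> \<le> 0" using \<tau>0 \<tau>(2) by simp
    then have "real T' \<le> real T" using T'le ly by linarith
    then show ?thesis by simp
  qed
  have T'low: "real T' \<ge> (1 - \<epsilon>0) * real T - 2"
  proof -
    have "2 powr (- 1 - \<epsilon>0 * real T) \<le> 2/3 * (\<delta> powr \<epsilon>0)"
    proof -
      have "2 powr (- 1 - \<epsilon>0 * real T) = 1/2 * (\<delta> powr \<epsilon>0)"
        using \<delta>pow[of "- \<epsilon>0"] powr_add[of 2 "- 1" "- \<epsilon>0 * real T"] by (simp add: powr_minus)
      moreover have "1/2 * (\<delta> powr \<epsilon>0) \<le> 2/3 * (\<delta> powr \<epsilon>0)" by (rule mult_right_mono) auto
      ultimately show ?thesis by linarith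
    qed
    also have "\<dots> \<le> \<tau>" using \<tau>(1) by simp
    finally have "log 2 (2 powr (- 1 - \<epsilon>0 * real T)) \<le> log 2 \<tau>" by (intro log_mono) auto
    then have "- 1 - \<epsilon>0 * real T \<le> log 2 \<tau>" by simp
    then show ?thesis using T'le(2) ly by (simp add: algebra_simps)
  qed
  have res: "\<delta> / \<tau> \<le> r" if "(1/2) ^ T' \<le> r" for r
  proof -
    have "\<delta> / \<tau> = 1 / y" using \<tau>0 by (simp add: y_def \<delta>_def power_one_over)
    also have "\<dots> \<le> 1 / 2 ^ T'" using yT y1 by (intro divide_left_mono) auto
    finally show ?thesis using that by (simp add: power_one_over)
  qed

  have L1: "L \<ge> 1" using L by simp
  obtain S \<psi> where S: "S \<subseteq> {..<L * M}" "scale_tree S \<psi>" "\<And>X. X \<subseteq> S \<Longrightarrow> \<psi> X * 2 ^ (L * M) * \<delta> \<in> B"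
    "\<And>j. card (S \<inter> {L * j..<L * Suc j}) \<le> 1"
    "real L * real (card S) \<ge> \<beta> * real T - real M * ell"
    "\<And>j. j \<le> M \<Longrightarrow> real (L * j) \<ge> \<epsilon>0 * real T + real L \<Longrightarrow>
       real L * real (card (S \<inter> {..<L * j})) \<ge> \<kappa> * (real (L * j) - real L) - real M * ell"
    by (rule set_contains_scale_tree[of L \<kappa> B T \<beta> \<epsilon>0, folded \<delta>_def ell_def M_def, OF L1 less_imp_le[OF \<kappa>] B])
      ((rule frostmanB; assumption), (rule that; assumption))
  have win: "card (S \<inter> {x..<z}) \<le> (z - x) div L + 2" for x z
    by (rule card_window_le[OF _ S(4)]) (use L in auto)
  have finS: "finite S" by (rule finite_subset[OF S(1)]) simp
  \<comment> \<open>A filling step at \<open>a\<close> needs \<open>D\<close> coarser scales to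
    fill, hence \<open>D \<le> a\<close>.\<close>
  define S1 where "S1 = S \<inter> {D..<T'}"
  have finS1: "finite S1" using finS by (simp add: S1_def)
  have D1: "D \<ge> 1" using L by (simp add: D_def)
  have w1: "card (S1 \<inter> {x..<x + D}) \<le> L + 2" for x
  proof -
    have "card (S1 \<inter> {x..<x + D}) \<le> card (S \<inter> {x..<x + D})" by (rule card_mono) (use finS in \<open>auto simp: S1_def\<close>)
    also have "\<dots> \<le> (x + D - x) div L + 2" by (rule win)
    also have "(x + D - x) div L = L" using L by (simp add: D_def)
    finally show ?thesis .
  qed
  obtain S' where S': "S' \<subseteq> S1" "\<And>a b. a \<in> S' \<Longrightarrow> b \<in> S' \<Longrightarrow> a < b \<Longrightarrow> a + D \<le> b"
    "\<And>y. card (S1 \<inter> {..<y}) \<le> (L + 2) * card (S' \<inter> {..<y})"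
    by (rule separated_subset[OF finS1 w1 D1]) (rule that; assumption)
  have S'S: "S' \<subseteq> S" and S'D: "\<And>a. a \<in> S' \<Longrightarrow> D \<le> a" and S'T: "S' \<subseteq> {..<T'}"
    using S'(1) by (auto simp: S1_def)
  have finS': "finite S'" using S'(1) finS1 by (rule finite_subset)
  have head: "card (S \<inter> {0..<D}) \<le> L + 2" using win[of 0 D] L by (simp add: D_def)

  have Mell: "real M * ell \<le> (real T / real L + 1) * ell" by (rule mult_right_mono[OF ME ell])
  have y00: "y0 \<ge> 0"
    unfolding y0_def using ell \<kappa> Lp \<epsilon> by (intro add_nonneg_nonneg mult_nonneg_nonneg divide_nonneg_nonneg) auto
  \<comment> \<open>The origin of \<open>y0\<close>: by the first bound, scales beyond it are in the
    range of the branching count \<open>S(6)\<close>; by the second, the losses there are at most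
    half of \<open>\<kappa> * q\<close>.\<close>
  have y0b: "y0 \<ge> \<epsilon>0 * real T + 2 * real L" "y0 \<ge> 4 * real L + 2 / \<kappa> * (real M * ell + real L * (real L + 2))"
  proof -
    have a: "2 * ell / (\<kappa> * real L) * real T \<ge> 0" "2 / \<kappa> * (ell + real L * (real L + 2)) \<ge> 0" "\<epsilon>0 * real T \<ge> 0"
      using ell \<kappa> Lp \<epsilon> by auto
    show "y0 \<ge> \<epsilon>0 * real T + 2 * real L" unfolding y0_def distrib_right using a Lp by linarith
    have "2 / \<kappa> * (real M * ell + real L * (real L + 2)) \<le> 2 / \<kappa> * ((real T / real L + 1) * ell + real L * (real L + 2))"
      using Mell \<kappa> by (intro mult_left_mono) auto
    also have "\<dots> = 2 * ell / (\<kappa> * real L) * real T + 2 / \<kappa> * (ell + real L * (real L + 2))"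
      using Lp \<kappa> by (simp add: field_simps)
    finally show "y0 \<ge> 4 * real L + 2 / \<kappa> * (real M * ell + real L * (real L + 2))"
      unfolding y0_def distrib_right using a Lp by linarith
  qed
  have dense: "real (L ^ 4) * real (card (S' \<inter> {..<q})) \<ge> g * real q" if q: "y0 \<le> real q" "q \<le> T'" for q
  proof -
    define j where "j = q div L"
    define x where "x = real (card (S' \<inter> {..<q}))"
    have jq: "L * j \<le> q" "real q < real (L * j) + real L"
    proof -
      have "q mod L < L" using L by simp
      then have "L * j \<le> q" "q < L * j + L" using mult_div_mod_eq[of L q] by (simp_all add: j_def, linarith)
      then show "L * j \<le> q" "real q < real (L * j) + real L" by linarith+
    qed
    have jM: "j \<le> M" unfolding j_def M_def using q(2) T'T by (meson div_le_mono le_add1 order.trans)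
    have "real (L * j) \<ge> \<epsilon>0 * real T + real L" using jq(2) q(1) y0b(1) by linarith
    from S(6)[OF jM this] have 1: "real L * real (card (S \<inter> {..<L * j})) \<ge> \<kappa> * (real (L * j) - real L) - real M * ell" .
    have "\<kappa> * (real (L * j) - real L) \<ge> \<kappa> * (real q - 2 * real L)" using jq(2) \<kappa> by (intro mult_left_mono) auto
    moreover have "real (card (S \<inter> {..<L * j})) \<le> (real L + 2) * x + (real L + 2)"
    proof -
      have "S \<inter> {..<L * j} \<subseteq> (S1 \<inter> {..<q}) \<union> (S \<inter> {0..<D})" using jq(1) q(2) by (auto simp: S1_def)
      then have "card (S \<inter> {..<L * j}) \<le> card ((S1 \<inter> {..<q}) \<union> (S \<inter> {0..<D}))"
        by (rule card_mono[rotated]) (use finS finS1 in auto)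
      also have "\<dots> \<le> card (S1 \<inter> {..<q}) + card (S \<inter> {0..<D})" by (rule card_Un_le)
      also have "\<dots> \<le> (L + 2) * card (S' \<inter> {..<q}) + (L + 2)" using S'(3)[of q] head by linarith
      finally have "real (card (S \<inter> {..<L * j})) \<le> real ((L + 2) * card (S' \<inter> {..<q}) + (L + 2))" by (rule of_nat_mono)
      then show ?thesis by (simp add: x_def algebra_simps)
    qed
    then have "real L * real (card (S \<inter> {..<L * j})) \<le> real L * ((real L + 2) * x + (real L + 2))"
      using Lp by (intro mult_left_mono) auto
    ultimately have "real L * (real L + 2) * x \<ge> \<kappa> * (real q - 2 * real L) - real M * ell - real L * (real L + 2)"
      using 1 by (simp add: algebra_simps)
    then have "2 / \<kappa> * (\<kappa> * (real q - 2 * real L) - real M * ell - real L * (real L + 2)) \<le> 2 / \<kappa> * (real L * (real L + 2) * x)"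
      using \<kappa> by (intro mult_left_mono) auto
    also have "\<dots> \<le> real (L ^ 4) * x"
    proof -
      have "2 / \<kappa> * (real L * (real L + 2)) \<le> real (L ^ 4)" using L(2) \<kappa> by (simp add: field_simps)
      then have "2 / \<kappa> * (real L * (real L + 2)) * x \<le> real (L ^ 4) * x" by (rule mult_right_mono) (simp add: x_def)
      then show ?thesis by (simp only: mult.assoc)
    qed
    finally have "2 * (real q - 2 * real L) - 2 / \<kappa> * (real M * ell + real L * (real L + 2)) \<le> real (L ^ 4) * x"
      using \<kappa> by (simp add: field_simps)
    moreover define Z where "Z = 2 / \<kappa> * (real M * ell + real L * (real L + 2))"
    ultimately have "2 * (real q - 2 * real L) - Z \<le> real (L ^ 4) * x" by simp
    moreover have "4 * real L + Z \<le> real q" using y0b(2) q(1) by (simp only: Z_def)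
    moreover have "b \<ge> q" if "2 * (q - 2 * l) - z \<le> b" "4 * l + z \<le> q" for b q l z :: real
      using that by argo
    ultimately have "real (L ^ 4) * x \<ge> real q" by blast
    moreover have "g * real q \<le> 1 * real q" using g by (intro mult_right_mono) auto
    ultimately show ?thesis by (simp add: x_def)
  qed

  have Dn: "D \<le> L ^ 4 + 1"
  proof -
    have "L ^ 2 \<le> L ^ 4" by (rule power_increasing) (use L in auto)
    then show ?thesis by (simp add: D_def power2_eq_square)
  qed
  have L41: "L ^ 4 \<ge> 1" using L by (simp add: Suc_le_eq)
  obtain m where m: "\<forall>k<n. \<exists>i<2 ^ D. m k = real i" "\<forall>k\<in>{n..<2 * n}. m k \<in> U"
    and ent: "log 2 (real (card (scale_cell {..<2 * n} \<psi> T' m ` configs S' {..<2 * n})))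
      \<ge> (1 - g) * real D * real (card S') + g * real T' - real T' * real D / real (L ^ 4)
         - 2 * C * real (card S') - C - y0"
    using long_sum_entropy[OF finS' scale_tree_subset[OF S(2) S'S] S'T D1 S'D S'(2) g(1) _ L41 Dn y00 U(1,2) \<mu> fr[OF res] dense]
      g unfolding n_def C_def by auto
  define V where "V = {c0, c0 + \<tau>} \<union> (\<lambda>k. c0 + \<tau> * m k) ` {n..<2 * n}"
  have Vs: "V \<subseteq> spt \<nu>" using c0 U(3) m(2) by (auto simp: V_def)
  have cV: "finite V" "card V \<le> n + 2"
  proof -
    show "finite V" by (simp add: V_def)
    have "card V \<le> card {c0, c0 + \<tau>} + card ((\<lambda>k. c0 + \<tau> * m k) ` {n..<2 * n})" unfolding V_def by (rule card_Un_le)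
    also have "\<dots> \<le> 2 + card {n..<2 * n}"
      by (intro add_mono card_image_le) (auto simp: card_insert_if)
    finally show "card V \<le> n + 2" by simp
  qed
  define A' where "A' = {k::int. \<delta> * of_int k \<in> A}"
  have AA': "A = (\<lambda>k. \<delta> * of_int k) ` A'" using A(1) by (auto simp: A'_def scaled_grid_def)
  have inj: "inj_on (\<lambda>k::int. \<delta> * of_int k) X" for X using \<delta>0 by (auto simp: inj_on_def)
  have cA: "card A = card A'" unfolding AA' by (rule card_image[OF inj])
  \<comment> \<open>The assumed inequality is strict, so it already rules out an empty
    \<open>A\<close>.\<close>
  obtain c where "c \<in> spt \<nu>" using c0 by auto
  from le_less_trans[OF of_nat_0_le_iff small[OF this]]
  have "0 < \<delta> powr (- \<epsilon>) * real (card A)" .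
  then have cApos: "real (card A') > 0" unfolding cA by (simp add: zero_less_mult_iff)
  then have finA': "finite A'" "A' \<noteq> {}" by (auto simp: card_gt_0_iff)
  \<comment> \<open>\<open>card\<close> of an infinite set is 0, contradicting the positive lower
    bound on \<open>card B\<close>.\<close>
  have finB: "finite B"
  proof (rule ccontr)
    assume "infinite B"
    then have "\<delta> powr (- \<beta>) \<le> 0" using B(2) by simp
    moreover have "\<delta> powr (- \<beta>) > 0" using \<delta>0 by simp
    ultimately show False by linarith
  qed
  define F where "F = insert 0 (\<Union>c\<in>V. dilate_floors \<delta> c B)"
  have finF: "finite F" using cV finB by (simp add: F_def dilate_floors_def)
  define K where "K = (real n + 3) * 2 powr (\<epsilon> * real T)"
  have grow: "real (card (A' + F)) \<le> K * real (card A')"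
  proof -
    have "real (card (A' + F)) \<le> (real (n + 2) + 1) * \<delta> powr (- \<epsilon>) * real (card A')"
      unfolding F_def
    proof (rule card_sum_all_floors_le[OF finA'(1) finB cV(1) finA'(2) \<delta>0 _ cV(2)])
      show "1 \<le> \<delta> powr (- \<epsilon>)" unfolding \<delta>pow using \<epsilon> by (simp add: ge_one_powr_ge_zero)
      show "real (dyadic_covering_number (sum_dilate ((\<lambda>k. \<delta> * of_int k) ` A') c B) \<delta>) \<le> \<delta> powr (- \<epsilon>) * real (card A')"
        if "c \<in> V" for c using small[of c] that Vs unfolding AA'[symmetric] cA by auto
    qed
    then show ?thesis by (simp add: K_def \<delta>pow algebra_simps)
  qed
  have K0: "K > 0" by (simp add: K_def add_pos_pos)
  let ?P = "{p - q |p q. p \<in> nfold_sum Q F \<and> q \<in> nfold_sum Q F}"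
  have diff: "real (card ?P) \<le> K ^ (2 * Q) * real (card A')"
    by (rule plunnecke_ruzsa[OF finA' finF grow])
  have cells: "real (card (scale_cell {..<2 * n} \<psi> T' m ` configs S' {..<2 * n})) \<le> (2 * real Q + 2) * real (card ?P)"
    unfolding Q_def F_def D_def[symmetric]
  proof (rule card_scale_cells_le[OF finS' finB cV(1) \<delta>0 \<tau>0])
    have "(2::real) ^ T \<le> 2 ^ E" using TE by (intro power_increasing) auto
    then have "y \<le> \<tau> * 2 ^ E" unfolding y_def using \<tau>0 by (intro mult_left_mono) auto
    then show "2 ^ T' \<le> \<tau> * 2 ^ E" using yT by linarith
    show "\<psi> X * 2 ^ E * \<delta> \<in> B" if "X \<subseteq> S'" for X using S(3)[of X] that S'S by (auto simp: E_def)
    show "c0 \<in> V" "c0 + \<tau> \<in> V" by (auto simp: V_def)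
    show "\<exists>i<2 ^ D. m k = real i" if "k < n" for k using m(1) that by blast
    show "c0 + \<tau> * m k \<in> V" if "k \<in> {n..<2 * n}" for k
      unfolding V_def by (rule UnI2) (rule imageI[OF that])
  qed
  have upper: "log 2 (real (card (scale_cell {..<2 * n} \<psi> T' m ` configs S' {..<2 * n})))
     \<le> log 2 (2 * real Q + 2) + 2 * real Q * (log 2 (real n + 3) + \<epsilon> * real T) + \<alpha> * real T"
  proof -
    have "real (card (scale_cell {..<2 * n} \<psi> T' m ` configs S' {..<2 * n})) \<le> (2 * real Q + 2) * (K ^ (2 * Q) * real (card A'))"
      by (rule order.trans[OF cells]) (intro mult_left_mono diff, simp)
    moreover have "0 < card (scale_cell {..<2 * n} \<psi> T' m ` configs S' {..<2 * n})"
      using finite_configs[OF finS', of "{..<2 * n}"] configs_nonempty[of S' "{..<2 * n}"] by (simp add: card_gt_0_iff)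
    ultimately have "log 2 (real (card (scale_cell {..<2 * n} \<psi> T' m ` configs S' {..<2 * n})))
       \<le> log 2 ((2 * real Q + 2) * (K ^ (2 * Q) * real (card A')))" by (intro log_mono) auto
    also have "\<dots> = log 2 (2 * real Q + 2) + (real (2 * Q) * log 2 K + log 2 (real (card A')))"
      using K0 cApos by (simp add: log_mult log_nat_power)
    also have "log 2 K = log 2 (real n + 3) + \<epsilon> * real T" unfolding K_def by (simp add: log_mult)
    also have "log 2 (real (card A')) \<le> log 2 (2 powr (\<alpha> * real T))"
      using A(2) cApos unfolding \<delta>pow cA by (intro log_mono) auto
    finally show ?thesis by simp
  qed

  have cS': "real D * real (card S') \<ge> (\<beta> - ell / real L - \<epsilon>0 - 2 / real L) * real T - c1"
  proof -
    define X0 where "X0 = (\<beta> - ell / real L - \<epsilon>0) * real T - c1"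
    have "S \<subseteq> S1 \<union> (S \<inter> {0..<D}) \<union> (S \<inter> {T'..<E})" using S(1) by (auto simp: S1_def E_def)
    then have "card S \<le> card (S1 \<union> (S \<inter> {0..<D}) \<union> (S \<inter> {T'..<E}))"
      by (rule card_mono[rotated]) (use finS finS1 in auto)
    also have "\<dots> \<le> card S1 + card (S \<inter> {0..<D}) + card (S \<inter> {T'..<E})"
      by (meson add_right_mono card_Un_le order.trans)
    finally have "card S \<le> card S1 + (L + 2) + ((E - T') div L + 2)" using head win[of T' E] by linarith
    then have "L * card S \<le> L * (card S1 + (L + 2) + ((E - T') div L + 2))" by (rule mult_left_mono) simp
    also have "\<dots> \<le> L * card S1 + L * (L + 2) + (E - T') + 2 * L"
      using div_times_less_eq_dividend[of "E - T'" L] by (simp add: algebra_simps)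
    finally have "real (L * card S) \<le> real (L * card S1 + L * (L + 2) + (E - T') + 2 * L)" by (rule of_nat_mono)
    then have a: "real L * real (card S) \<le> real L * real (card S1) + real L * (real L + 2) + (real E - real T') + 2 * real L"
      using TE T'T by (simp add: algebra_simps)
    have b: "real E - real T' \<le> real L + \<epsilon>0 * real T + 2" using TE(2) T'low by (simp add: algebra_simps)
    have c: "real M * ell \<le> ell / real L * real T + ell" using Mell by (simp add: algebra_simps)
    have X: "X0 \<le> real L * real (card S1)"
      using a b c S(5) unfolding X0_def c1_def left_diff_distrib by linarith
    have "S1 \<inter> {..<T'} = S1" "S' \<inter> {..<T'} = S'" using S'T by (auto simp: S1_def)
    then have "card S1 \<le> (L + 2) * card S'" using S'(3)[of T'] by simp
    then have "real (card S1) \<le> real ((L + 2) * card S')" by (rule of_nat_mono)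
    then have "real L * real (card S1) \<le> real L * ((real L + 2) * real (card S'))"
      by (intro mult_left_mono) (simp_all add: algebra_simps)
    then have "X0 \<le> (real L + 2) * (real L * real (card S'))" using X by (simp add: ac_simps)
    then have "X0 / (real L + 2) \<le> real L * real (card S')" using Lp by (simp add: pos_divide_le_eq mult.commute)
    then have "real L * (X0 / (real L + 2)) \<le> real L * (real L * real (card S'))" by (rule mult_left_mono) simp
    \<comment> \<open>Thinning divides by \<open>L + 2\<close> while \<open>D\<close> regains only
      \<open>L\<close> per element; the difference \<open>2 * X0 / (L + 2)\<close> is the source of
      the error term \<open>2 / L\<close>.\<close>
    moreover have "real L * (X0 / (real L + 2)) = X0 - 2 * X0 / (real L + 2)"
      using Lp by (simp add: field_simps)
    moreover have "2 * X0 / (real L + 2) \<le> 2 / real L * real T"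
    proof -
      have "(\<beta> - ell / real L - \<epsilon>0) * real T \<le> 1 * real T"
        using \<beta> ell \<epsilon> Lp by (intro mult_right_mono) (auto simp: diff_le_eq intro: add_increasing2)
      moreover have "c1 \<ge> 0" using ell by (simp add: c1_def)
      ultimately have "2 * X0 \<le> 2 * real T" by (simp add: X0_def)
      then have "2 * X0 / (real L + 2) \<le> 2 * real T / (real L + 2)" by (rule divide_right_mono) simp
      also have "\<dots> \<le> 2 * real T / real L" using Lp by (intro divide_left_mono) auto
      finally show ?thesis by simp
    qed
    ultimately have "X0 - 2 / real L * real T \<le> real L * (real L * real (card S'))" by linarith
    then show ?thesis by (simp add: X0_def D_def algebra_simps)
  qed
  have "(1 - g) * ((\<beta> - ell / real L - \<epsilon>0 - 2 / real L) * real T - c1) \<le> (1 - g) * (real D * real (card S'))"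
    by (rule mult_left_mono[OF cS']) (use g in auto)
  moreover have "g * ((1 - \<epsilon>0) * real T - 2) \<le> g * real T'" by (rule mult_left_mono[OF T'low]) (use g in auto)
  moreover have "real T' * real D / real (L ^ 4) \<le> real T / (real L)\<^sup>2"
  proof -
    have "real T' * real D / real (L ^ 4) = real T' / (real L)\<^sup>2"
      using Lp by (simp add: D_def power2_eq_square power4_eq_xxxx field_simps)
    also have "\<dots> \<le> real T / (real L)\<^sup>2" using T'T by (intro divide_right_mono) auto
    finally show ?thesis .
  qed
  moreover have "2 * C * real (card S') \<le> 2 * C * (real T / real L + 3)"
  proof -
    have "S' \<subseteq> S \<inter> {0..<E}" using S'S S(1) by (auto simp: E_def)
    then have "card S' \<le> card (S \<inter> {0..<E})" by (rule card_mono[rotated]) (use finS in auto)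
    also have "\<dots> \<le> M + 2" using win[of 0 E] L by (simp add: E_def)
    finally have "real (card S') \<le> real (M + 2)" by (rule of_nat_mono)
    then have "real (card S') \<le> real T / real L + 3" using ME by simp
    moreover have "C \<ge> 0" by (simp add: C_def)
    ultimately show ?thesis by (intro mult_left_mono) auto
  qed
  ultimately show ?thesis using ent upper by (simp add: mult.assoc)
qed

text \<open>All error coefficients are O(log L / L). This includes the cost \<open>C\<close> of an
  increment, because the number of leaves is only polynomial in \<open>L\<close>.\<close>

lemma large_parameter_exists:
  fixes \<kappa> \<sigma> :: real
  assumes "\<kappa> > 0" "\<sigma> > 0"
  obtains L :: nat where "L \<ge> 2" "2 * real L * (real L + 2) \<le> \<kappa> * real (L ^ 4)"
    "log 2 (2 * real L) / real L + 2 / real L + 1 / (real L)\<^sup>2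
      + 2 * (log 2 17 + log 2 (2 * real (L ^ 4 + 1) + 2)) / real L + 2 * log 2 (2 * real L) / (\<kappa> * real L) < \<sigma>"
proof -
  define u where "u = (\<lambda>n::nat. log 2 (real n) / real n)"
  define v where "v = (\<lambda>n::nat. 1 / real n)"
  have "(\<lambda>n. ln (real n) / real n / ln 2) \<longlonglongrightarrow> 0 / ln 2"
    by (intro tendsto_divide lim_ln_over_n tendsto_const) simp
  then have u: "u \<longlonglongrightarrow> 0" by (simp add: u_def log_def divide_divide_eq_left mult.commute)
  have v: "v \<longlonglongrightarrow> 0" unfolding v_def by (rule lim_1_over_n)
  \<comment> \<open>19 = 2 + 1 + 16 collects \<open>2 / L\<close>, the bound \<open>1 / L\<close>
    for \<open>1 / L^2\<close>, and the constant part of the term with \<open>log 2 17\<close>,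
    whose logarithmic part gives \<open>8 * u\<close>.\<close>
  have "(\<lambda>n. (1 + 2 / \<kappa>) * (u n + v n) + 19 * v n + 8 * u n) \<longlonglongrightarrow> (1 + 2 / \<kappa>) * (0 + 0) + 19 * 0 + 8 * 0"
    by (intro tendsto_add tendsto_mult tendsto_const u v)
  then have "\<forall>\<^sub>F n in sequentially. (1 + 2 / \<kappa>) * (u n + v n) + 19 * v n + 8 * u n < \<sigma>"
    by (rule order_tendstoD(2)) (use assms in auto)
  then obtain n0 where n0: "\<And>n. n \<ge> n0 \<Longrightarrow> (1 + 2 / \<kappa>) * (u n + v n) + 19 * v n + 8 * u n < \<sigma>"
    by (auto simp: eventually_sequentially)
  \<comment> \<open>With \<open>L \<ge> 4 / \<kappa>\<close> one has
    \<open>2 L (L + 2) \<le> 4 L^2 \<le> \<kappa> L^3\<close>.\<close>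
  define L where "L = Max {2, n0, nat \<lceil>4 / \<kappa>\<rceil>}"
  have L: "L \<ge> 2" "L \<ge> n0" "L \<ge> nat \<lceil>4 / \<kappa>\<rceil>" unfolding L_def by (rule Max_ge; simp)+
  have "4 / \<kappa> \<le> real (nat \<lceil>4 / \<kappa>\<rceil>)" by (rule real_nat_ceiling_ge)
  then have Lr: "real L \<ge> 2" "4 / \<kappa> \<le> real L" using L by linarith+
  have Lk: "4 \<le> \<kappa> * real L" using Lr(2) assms(1) by (simp add: pos_divide_le_eq mult.commute)
  show ?thesis
  proof (rule that[OF L(1)])
    have "2 * real L * (real L + 2) \<le> 2 * real L * (2 * real L)" using Lr by (intro mult_left_mono) auto
    also have "\<dots> = 4 * (real L)\<^sup>2" by (simp add: power2_eq_square)
    also have "\<dots> \<le> (\<kappa> * real L) * (real L)\<^sup>2" by (rule mult_right_mono[OF Lk]) simp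
    also have "\<dots> \<le> (\<kappa> * real L) * (real L) ^ 3"
      using assms(1) Lr by (intro mult_left_mono power_increasing) auto
    also have "\<dots> = \<kappa> * real (L ^ 4)" by (simp add: power_numeral_reduce)
    finally show "2 * real L * (real L + 2) \<le> \<kappa> * real (L ^ 4)" .
    have e1: "log 2 (2 * real L) = 1 + log 2 (real L)" using Lr by (simp add: log_mult)
    have e: "log 2 (2 * real L) / real L = u L + v L" unfolding e1 u_def v_def by (simp add: add_divide_distrib)
    have "log 2 17 \<le> log 2 (2 ^ 5)" by (intro log_mono) auto
    also have "log 2 (2 ^ 5) = (5::real)" using log_pow_cancel[of 2 5] by simp
    finally have c1: "log 2 17 \<le> (5::real)" .
    have "log 2 (2 * real (L ^ 4 + 1) + 2) \<le> log 2 (2 ^ 3 * (real L) ^ 4)"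
    proof (intro log_mono)
      have "1 \<le> (real L) ^ 4" using Lr by (intro one_le_power) auto
      then show "2 * real (L ^ 4 + 1) + 2 \<le> 2 ^ 3 * (real L) ^ 4" by simp
    qed (auto intro!: add_pos_nonneg)
    also have "\<dots> = 3 + 4 * log 2 (real L)"
    proof -
      have "log 2 (8::real) = 3" using log_pow_cancel[of 2 3] by simp
      then show ?thesis using Lr by (simp add: log_mult log_nat_power)
    qed
    finally have "2 * (log 2 17 + log 2 (2 * real (L ^ 4 + 1) + 2)) / real L \<le> (16 + 8 * log 2 (real L)) / real L"
      using c1 Lr by (intro divide_right_mono) auto
    also have "\<dots> = 16 * v L + 8 * u L" by (simp add: u_def v_def add_divide_distrib)
    finally have c: "2 * (log 2 17 + log 2 (2 * real (L ^ 4 + 1) + 2)) / real L \<le> 16 * v L + 8 * u L" .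
    have d: "1 / (real L)\<^sup>2 \<le> v L"
      unfolding v_def using Lr by (intro divide_left_mono) (auto simp: power2_eq_square mult_le_cancel_left1)
    have f: "2 * log 2 (2 * real L) / (\<kappa> * real L) = 2 / \<kappa> * (u L + v L)"
      unfolding e[symmetric] by simp
    define x where "x = 2 / \<kappa> * (u L + v L)"
    define w where "w = 2 * (log 2 17 + log 2 (2 * real (L ^ 4 + 1) + 2)) / real L"
    have "u L + v L + x + 19 * v L + 8 * u L < \<sigma>"
      using n0[OF L(2)] by (simp only: x_def distrib_right mult_1_left)
    moreover have "2 / real L = 2 * v L" by (simp add: v_def)
    ultimately show "log 2 (2 * real L) / real L + 2 / real L + 1 / (real L)\<^sup>2
      + 2 * (log 2 17 + log 2 (2 * real (L ^ 4 + 1) + 2)) / real L + 2 * log 2 (2 * real L) / (\<kappa> * real L) < \<sigma>"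
      using c d unfolding e f x_def[symmetric] w_def[symmetric] by linarith
  qed
qed

theorem theorem1p3:
  fixes \<alpha> \<beta> \<kappa> \<gamma> :: real
  assumes "0 < \<beta>" and "\<beta> \<le> \<alpha>" and "\<alpha> < 1" and "\<kappa> > 0"
    and "\<gamma> \<in> {(\<alpha> - \<beta>) / (1 - \<beta>) <.. 1}"
  shows "\<exists>\<epsilon>\<in>{0<..1/2::real}. \<exists>\<epsilon>\<^sub>0\<in>{0<..1/2::real}. \<exists>\<delta>\<^sub>0\<in>{0<..1/2::real}.
    \<forall>\<delta> (A :: real set) (B :: real set) (\<nu> :: real measure).
      \<delta> \<in> dyadic_scales \<longrightarrow> \<delta> \<in> {0<..\<delta>\<^sub>0} \<longrightarrow>
      A \<subseteq> scaled_grid \<delta> \<inter> {0..1} \<longrightarrow> B \<subseteq> scaled_grid \<delta> \<inter> {0..1} \<longrightarrow>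
      real (card A) \<le> \<delta> powr (- \<alpha>) \<longrightarrow>
      real (card B) \<ge> \<delta> powr (- \<beta>) \<longrightarrow>
      (\<forall>x r. \<delta> \<le> r \<and> r \<le> \<delta> powr \<epsilon>\<^sub>0 \<longrightarrow>
        real (card (B \<inter> ball x r)) \<le> r powr \<kappa> * real (card B)) \<longrightarrow>
      prob_space \<nu> \<longrightarrow> sets \<nu> = sets borel \<longrightarrow> spt \<nu> \<subseteq> {1/2..1} \<longrightarrow>
      (\<forall>x r. \<delta> \<le> r \<and> r \<le> \<delta> powr \<epsilon>\<^sub>0 \<longrightarrow> measure \<nu> (ball x r) \<le> r powr \<gamma>) \<longrightarrow>
      (\<exists>c\<in>spt \<nu>. real (dyadic_covering_number (sum_dilate A c B) \<delta>)
        \<ge> \<delta> powr (- \<epsilon>) * real (card A))"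
proof -
  \<comment> \<open>Halfway between the threshold and \<gamma>: above the threshold there is an
    entropy surplus \<sigma> > 0, and below \<gamma> there is room for
    \<open>frostman_rescaling\<close>.\<close>
  define g where "g = ((\<alpha> - \<beta>) / (1 - \<beta>) + \<gamma>) / 2"
  have b1: "1 - \<beta> > 0" using assms by linarith
  have q0: "(\<alpha> - \<beta>) / (1 - \<beta>) \<ge> 0" using assms b1 by simp
  have "(\<alpha> - \<beta>) / (1 - \<beta>) < \<gamma>" "\<gamma> \<le> 1" using assms(5) by auto
  moreover have "a < (a + b) / 2" "(a + b) / 2 < b" if "a < b" for a b :: real using that by simp_all
  ultimately have g: "(\<alpha> - \<beta>) / (1 - \<beta>) < g" "g < \<gamma>" "\<gamma> \<le> 1" unfolding g_def by blast+
  have g0: "0 < g" using g(1) q0 by linarith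
  define \<sigma> where "\<sigma> = (1 - g) * \<beta> + g - \<alpha>"
  have "\<alpha> - \<beta> < g * (1 - \<beta>)" using g(1) b1 by (simp add: pos_divide_less_eq)
  then have \<sigma>: "\<sigma> > 0" by (simp add: \<sigma>_def algebra_simps)
  obtain L :: nat where L: "L \<ge> 2" "2 * real L * (real L + 2) \<le> \<kappa> * real (L ^ 4)"
    and \<theta>: "log 2 (2 * real L) / real L + 2 / real L + 1 / (real L)\<^sup>2
      + 2 * (log 2 17 + log 2 (2 * real (L ^ 4 + 1) + 2)) / real L + 2 * log 2 (2 * real L) / (\<kappa> * real L) < \<sigma> / 8"
    by (rule large_parameter_exists[OF assms(4), of "\<sigma> / 8"]) (use \<sigma> in auto)
  define ell where "ell = log 2 (2 * real L)"
  define n where "n = L ^ 4 + 1"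
  define Q where "Q = n * 2 ^ (L * L)"
  define C where "C = log 2 17 + log 2 (2 * real n + 2)"
  define k1 where "k1 = 6 * real L + 2 / \<kappa> * (ell + real L * (real L + 2))"
  define c1 where "c1 = ell + real L * (real L + 2) + 3 * real L + 2"
  \<comment> \<open>Shares of the surplus: less than \<sigma> / 8 for the errors in
    \<open>L\<close>, \<sigma> / 12 for \<open>2 * \<epsilon>0\<close>, and \<sigma> / 4 for the
    growth \<open>2 * Q * \<epsilon>\<close>. More than \<sigma> / 2 is left.\<close>
  define \<epsilon>0 where "\<epsilon>0 = min (1/2) (\<sigma> / 24)"
  define \<epsilon> where "\<epsilon> = min (1/2) (\<sigma> / (8 * real Q))"
  define K where "K = (1 - g) * c1 + 2 * g + 7 * C + k1 + log 2 (2 * real Q + 2) + 2 * real Q * log 2 (real n + 3)"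
  have Q: "real Q > 0" by (simp add: Q_def n_def add_pos_nonneg)
  have \<epsilon>: "0 < \<epsilon>" "\<epsilon> \<le> 1/2" using \<sigma> Q by (auto simp: \<epsilon>_def)
  have Q\<epsilon>: "2 * real Q * \<epsilon> \<le> \<sigma> / 4"
  proof -
    have "2 * real Q * \<epsilon> \<le> 2 * real Q * (\<sigma> / (8 * real Q))" using Q by (intro mult_left_mono) (auto simp: \<epsilon>_def)
    also have "\<dots> = \<sigma> / 4" using Q by simp
    finally show ?thesis .
  qed
  have \<epsilon>0: "0 < \<epsilon>0" "\<epsilon>0 \<le> 1/2" "\<epsilon>0 \<le> \<sigma> / 24" using \<sigma> by (auto simp: \<epsilon>0_def)
  \<comment> \<open>The entries ensure in turn that \<delta> is small enough for the first two
    numerical conditions, that \<open>(\<delta> powr \<epsilon>0) powr (\<gamma> - g)\<close> is at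
    most 1/2, and that \<open>\<sigma> / 2 * T\<close> exceeds the constant
    \<open>K\<close>.\<close>
  define T0 where "T0 = Max {2, nat \<lceil>1 / (\<epsilon>0 * (\<gamma> - g))\<rceil>, nat \<lceil>2 * K / \<sigma>\<rceil> + 1}"
  define \<delta>0 :: real where "\<delta>0 = (1/2) ^ T0"
  have \<delta>0: "\<delta>0 \<in> {0<..1/2}"
  proof -
    have "T0 \<ge> 1" by (simp add: T0_def)
    then have "(1/2::real) ^ T0 \<le> (1/2) ^ 1" by (intro power_decreasing) auto
    then show ?thesis by (simp add: \<delta>0_def)
  qed
  show ?thesis
  proof (rule bexI[of _ \<epsilon>], rule bexI[of _ \<epsilon>0], rule bexI[of _ \<delta>0], intro allI impI)
    show "\<epsilon> \<in> {0<..1/2}" "\<epsilon>0 \<in> {0<..1/2}" "\<delta>0 \<in> {0<..1/2}" using \<epsilon> \<epsilon>0 \<delta>0 by auto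
    fix \<delta> :: real and A B :: "real set" and \<nu> :: "real measure"
    assume \<delta>: "\<delta> \<in> dyadic_scales" "\<delta> \<in> {0<..\<delta>0}"
      and A: "A \<subseteq> scaled_grid \<delta> \<inter> {0..1}" and B: "B \<subseteq> scaled_grid \<delta> \<inter> {0..1}"
      and cA: "real (card A) \<le> \<delta> powr (- \<alpha>)" and cB: "real (card B) \<ge> \<delta> powr (- \<beta>)"
      and frB: "\<forall>x r. \<delta> \<le> r \<and> r \<le> \<delta> powr \<epsilon>0 \<longrightarrow> real (card (B \<inter> ball x r)) \<le> r powr \<kappa> * real (card B)"
      and \<nu>: "prob_space \<nu>" "sets \<nu> = sets borel" "spt \<nu> \<subseteq> {1/2..1}"
      and fr\<nu>: "\<forall>x r. \<delta> \<le> r \<and> r \<le> \<delta> powr \<epsilon>0 \<longrightarrow> measure \<nu> (ball x r) \<le> r powr \<gamma>"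
    obtain T where \<delta>T: "\<delta> = (1/2) ^ T"
      using \<delta>(1) by (auto simp: dyadic_scales_def powr_minus powr_realpow power_one_over inverse_eq_divide)
    have "T0 \<le> T"
    proof (rule ccontr)
      assume "\<not> T0 \<le> T"
      then have "(1/2::real) ^ T0 < (1/2) ^ T" by (intro power_strict_decreasing) auto
      then show False using \<delta>(2) by (simp add: \<delta>T \<delta>0_def)
    qed
    moreover have "2 \<le> T0" "nat \<lceil>1 / (\<epsilon>0 * (\<gamma> - g))\<rceil> \<le> T0" "nat \<lceil>2 * K / \<sigma>\<rceil> + 1 \<le> T0"
      unfolding T0_def by (rule Max_ge; simp)+
    ultimately have T2: "T \<ge> 2" and T\<gamma>: "nat \<lceil>1 / (\<epsilon>0 * (\<gamma> - g))\<rceil> \<le> T" and TK: "nat \<lceil>2 * K / \<sigma>\<rceil> + 1 \<le> T"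
      by linarith+
    have \<delta>p: "\<delta> = 2 powr (- real T)" by (simp add: \<delta>T powr_minus powr_realpow power_one_over inverse_eq_divide)
    have \<delta>\<epsilon>: "\<delta> powr \<epsilon>0 = 2 powr (- (\<epsilon>0 * real T))" unfolding \<delta>p by (simp add: powr_powr mult.commute)
    show "\<exists>c\<in>spt \<nu>. real (dyadic_covering_number (sum_dilate A c B) \<delta>) \<ge> \<delta> powr (- \<epsilon>) * real (card A)"
    proof (rule ccontr)
      assume "\<not> ?thesis"
      then have small: "real (dyadic_covering_number (sum_dilate A c B) \<delta>) < \<delta> powr (- \<epsilon>) * real (card A)"
        if "c \<in> spt \<nu>" for c using that by auto
      have t1: "3/2 * \<delta> \<le> \<delta> powr \<epsilon>0"
      proof -
        have "\<epsilon>0 * real T \<le> 1/2 * real T" by (rule mult_right_mono[OF \<epsilon>0(2)]) simp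
        then have "1 - real T \<le> - (\<epsilon>0 * real T)" using T2 by linarith
        then have "2 powr (1 - real T) \<le> \<delta> powr \<epsilon>0" unfolding \<delta>\<epsilon> by (rule powr_mono) simp
        moreover have "2 powr (1 - real T) = 2 * \<delta>" unfolding \<delta>p by (simp add: powr_diff powr_minus_divide)
        ultimately show ?thesis using \<delta>(2) by simp
      qed
      have t2: "2 * \<delta> \<le> 1"
      proof -
        have "\<delta> \<le> (1/2) ^ 1" unfolding \<delta>T using T2 by (intro power_decreasing) auto
        then show ?thesis by simp
      qed
      have t3: "(\<delta> powr \<epsilon>0) powr (\<gamma> - g) < 2/3"
      proof -
        have p: "\<epsilon>0 * (\<gamma> - g) > 0" using \<epsilon>0(1) g(2) by simp
        have "1 / (\<epsilon>0 * (\<gamma> - g)) \<le> real (nat \<lceil>1 / (\<epsilon>0 * (\<gamma> - g))\<rceil>)" by (rule real_nat_ceiling_ge)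
        then have "1 / (\<epsilon>0 * (\<gamma> - g)) \<le> real T" using T\<gamma> by linarith
        then have "1 \<le> \<epsilon>0 * (\<gamma> - g) * real T" using p by (simp add: pos_divide_le_eq mult.commute)
        then have "(\<delta> powr \<epsilon>0) powr (\<gamma> - g) \<le> 2 powr (- 1)"
          unfolding \<delta>\<epsilon> powr_powr by (intro powr_mono) (auto simp: algebra_simps)
        also have "\<dots> < 2/3" by (simp add: powr_minus)
        finally show ?thesis .
      qed
      have main: "(1 - g) * ((\<beta> - ell / real L - \<epsilon>0 - 2 / real L) * real T - c1) + g * ((1 - \<epsilon>0) * real T - 2)
        - real T / (real L)\<^sup>2 - 2 * C * (real T / real L + 3) - C - ((2 * ell / (\<kappa> * real L) + \<epsilon>0) * real T + k1)
        \<le> log 2 (2 * real Q + 2) + 2 * real Q * (log 2 (real n + 3) + \<epsilon> * real T) + \<alpha> * real T"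
        unfolding ell_def c1_def C_def k1_def Q_def n_def
      proof (rule entropy_gain_le_growth[where A = A and B = B and \<nu> = \<nu> and \<gamma> = \<gamma> and T = T, folded \<delta>T])
        show "\<beta> \<le> 1" "\<kappa> > 0" "0 < g" "g < \<gamma>" "\<gamma> \<le> 1" "0 \<le> \<epsilon>" "0 \<le> \<epsilon>0" using b1 assms g g0 \<epsilon> \<epsilon>0 by auto
      qed (use L t1 t2 t3 A B cA cB frB fr\<nu> \<nu> small in blast)+
      define \<theta> where "\<theta> = ell / real L + 2 / real L + 1 / (real L)\<^sup>2 + 2 * C / real L + 2 * ell / (\<kappa> * real L)"
      have \<theta>8: "\<theta> < \<sigma> / 8" using \<theta> by (simp add: \<theta>_def ell_def C_def n_def)
      have ellL: "ell / real L + 2 / real L \<ge> 0" using L(1) by (simp add: ell_def)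
      have "(1 - g) * ((\<beta> - ell / real L - \<epsilon>0 - 2 / real L) * real T - c1) + g * ((1 - \<epsilon>0) * real T - 2)
        - real T / (real L)\<^sup>2 - 2 * C * (real T / real L + 3) - C - ((2 * ell / (\<kappa> * real L) + \<epsilon>0) * real T + k1)
        = (\<alpha> + \<sigma> - \<theta> - 2 * \<epsilon>0) * real T + g * (ell / real L + 2 / real L) * real T
          - ((1 - g) * c1 + 2 * g + 7 * C + k1)"
      proof -
        have gen: "(1 - g) * ((\<beta> - p - \<epsilon>0 - r) * t - c1) + g * ((1 - \<epsilon>0) * t - 2)
            - s * t - (w * t + 6 * C) - C - ((v + \<epsilon>0) * t + k1)
          = (\<alpha> + \<sigma> - (p + r + s + w + v) - 2 * \<epsilon>0) * t + g * (p + r) * t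
            - ((1 - g) * c1 + 2 * g + 7 * C + k1)" for p r s t v w
          by (simp add: \<sigma>_def algebra_simps)
        have "real T / (real L)\<^sup>2 = 1 / (real L)\<^sup>2 * real T"
          "2 * C * (real T / real L + 3) = 2 * C / real L * real T + 6 * C"
          by (simp_all add: algebra_simps)
        then show ?thesis unfolding \<theta>_def by (simp only: gen)
      qed
      moreover have "g * (ell / real L + 2 / real L) * real T \<ge> 0" using ellL g0 by simp
      moreover have "2 * real Q * (log 2 (real n + 3) + \<epsilon> * real T) = 2 * real Q * log 2 (real n + 3) + (2 * real Q * \<epsilon>) * real T"
        by (simp add: algebra_simps)
      moreover have "(2 * real Q * \<epsilon>) * real T \<le> \<sigma> / 4 * real T" by (rule mult_right_mono[OF Q\<epsilon>]) simp
      ultimately have "(\<alpha> + \<sigma> - \<theta> - 2 * \<epsilon>0) * real T \<le> K + \<sigma> / 4 * real T + \<alpha> * real T"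
        using main unfolding K_def by linarith
      then have "(\<sigma> - \<theta> - 2 * \<epsilon>0 - \<sigma> / 4) * real T \<le> K" by (simp add: algebra_simps)
      moreover have "\<sigma> / 2 * real T \<le> (\<sigma> - \<theta> - 2 * \<epsilon>0 - \<sigma> / 4) * real T"
        using \<theta>8 \<epsilon>0(3) \<sigma> by (intro mult_right_mono) auto
      ultimately have "\<sigma> / 2 * real T \<le> K" by linarith
      then have "real T \<le> 2 * K / \<sigma>" using \<sigma> by (simp add: pos_le_divide_eq mult.commute)
      moreover have "2 * K / \<sigma> < real T"
      proof -
        have "2 * K / \<sigma> \<le> real (nat \<lceil>2 * K / \<sigma>\<rceil>)" by (rule real_nat_ceiling_ge)
        then show ?thesis using TK by linarith
      qed
      ultimately show False by linarith
    qed
  qed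
qed

end
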